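(* We have $\mathrm{NP}_T(f)\ge \mathrm{HP}_q(\Delta)$, i.e. the $T$-adic Newton polygon of $C_f(s,T)$ lies on or above the $q$-Hodge polygon of $\Delta$.
   Context: Let $p$ be a prime, $a\ge 1$, $q=p^a$. For $k\ge1$ let $\mathbb{Q}_{q^k}$ be the unramified extension of $\mathbb{Q}_p$ (inside a fixed $\overline{\mathbb{Q}}_p$) with residue field $\mathbb{F}_{q^k}$ and $\mathbb{Z}_{q^k}$ its ring of integers; $\mu_r$ is the group of $r$-th roots of unity in $\overline{\mathbb{Q}}_p$. Fix $n\ge 1$ and a Laurent polynomial $f(x)=\sum_u a_ux^u\in\mathbb{Z}_q[x_1^{\pm1},\dots,x_n^{\pm1}]$ all of whose non-zero coefficients lie in $\mu_{q-1}$. Put $S_f(k,T)=\sum_{x\in\mu_{q^k-1}^n}(1+T)^{\mathrm{Tr}_{\mathbb{Q}_{q^k}/\mathbb{Q}_p}(f(x))}\in\mathbb{Z}_p[[T]]$, where $(1+T)^\beta=\sum_{i\ge 0}\binom{\beta}{i}T^i$, and $C_f(s,T)=\exp\big(\sum_{k\ge1}-(q^k-1)^{-n}S_f(k,T)\frac{s^k}{k}\big)\in 1+s\mathbb{Z}_p[[T]][[s]]$. Writing $C_f(s,T)=\sum_k c_k s^k$, $\mathrm{NP}_T(f)$ denotes its $T$-adic Newton polygon, the lower convex hull of the points $(k,\mathrm{ord}_T(c_k))$. Let $\Delta\subset\mathbb{R}^n$ be the convex hull of the origin and the exponents $u$ with $a_u\ne0$, and $C(\Delta)$ the cone generated by $\Delta$.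 The degree function $\deg$ on $C(\Delta)$ is determined by $\deg(u)=1$ when $u$ lies on a codimension $1$ face of $\Delta$ not containing the origin, and $\deg(ru)=r\deg(u)$ for $r\in\mathbb{R}_{\ge0}$. Let $M(\Delta)=C(\Delta)\cap\mathbb{Z}^n$, let $D$ be the smallest positive integer with $\deg M(\Delta)\subset\frac1D\mathbb{Z}$, and $W(k)=\#\{u\in M(\Delta):\deg(u)=k/D\}$ for $k\ge0$. The $q$-Hodge polygon $\mathrm{HP}_q(\Delta)$ is the polygon with vertices $(0,0)$ and $\big(\sum_{j=0}^iW(j),\ a(p-1)\sum_{j=0}^i\frac jD W(j)\big)$, $i=0,1,2,\dots$. *)

theory Defs
  imports
    "HOL-Analysis.Analysis"
    "HOL-Library.Poly_Mapping"
    "HOL-Computational_Algebra.Computational_Algebra"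
    "HOL-Algebra.Algebraic_Closure_Type"
    "Berlekamp_Zassenhaus.Finite_Field"
begin

unbundle no Formal_Power_Series.fps_syntax

section \<open>The \<open>p\<close>-adic numbers\<close>

text \<open>
  The prime \<open>p\<close> is \<open>CARD('p)\<close> for a type \<open>'p\<close> of class \<^class>\<open>prime_card\<close>.  The ring
  of \<open>p\<close>-adic integers is the inverse limit of the rings of integers modulo \<open>p ^ n\<close>,
  each residue class being represented by its element in \<open>{0..<p ^ n}\<close>.
\<close>

typedef (overloaded) 'p padic_int =
  "{x :: nat \<Rightarrow> int. \<forall>n. x n \<in> {0..<int CARD('p::prime_card) ^ n} \<and>
                           x (Suc n) mod int CARD('p) ^ n = x n}"
proof -
  have "int CARD('p) > 0" using prime_card[where 'a='p] prime_gt_0_nat by simp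
  then show ?thesis by (intro exI[of _ "\<lambda>_. 0"]) auto
qed

setup_lifting type_definition_padic_int

lemma padic_card_gt1: "int CARD('p::prime_card) > 1"
  using prime_card[where 'a='p] prime_gt_1_nat by simp

lemma padic_pow_pos: "int CARD('p::prime_card) ^ n > 0"
  using padic_card_gt1[where 'p='p] by simp

lemma padic_reduce:
  fixes x :: "nat \<Rightarrow> int"
  assumes "x (Suc n) mod int CARD('p::prime_card) ^ n = x n mod int CARD('p) ^ n"
  shows "x n mod int CARD('p) ^ n \<in> {0..<int CARD('p) ^ n} \<and>
         x (Suc n) mod int CARD('p) ^ Suc n mod int CARD('p) ^ n = x n mod int CARD('p) ^ n"
proof -
  have "x (Suc n) mod int CARD('p) ^ Suc n mod int CARD('p) ^ n = x (Suc n) mod int CARD('p) ^ n"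
    by (rule mod_mod_cancel) simp
  then show ?thesis
    using assms padic_pow_pos[where 'p='p, of n] by simp
qed

instantiation padic_int :: (prime_card) comm_ring_1
begin

lift_definition zero_padic_int :: "'a padic_int" is "\<lambda>n. 0 mod int CARD('a) ^ n"
  by (rule padic_reduce) simp

lift_definition one_padic_int :: "'a padic_int" is "\<lambda>n. 1 mod int CARD('a) ^ n"
  by (rule padic_reduce) simp

lift_definition plus_padic_int :: "'a padic_int \<Rightarrow> 'a padic_int \<Rightarrow> 'a padic_int"
  is "\<lambda>x y n. (x n + y n) mod int CARD('a) ^ n"
  by (rule padic_reduce) (metis mod_add_eq)

lift_definition minus_padic_int :: "'a padic_int \<Rightarrow> 'a padic_int \<Rightarrow> 'a padic_int"
  is "\<lambda>x y n. (x n - y n) mod int CARD('a) ^ n"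
  by (rule padic_reduce) (metis mod_diff_eq)

lift_definition uminus_padic_int :: "'a padic_int \<Rightarrow> 'a padic_int"
  is "\<lambda>x n. (- x n) mod int CARD('a) ^ n"
  by (rule padic_reduce) (metis mod_minus_eq)

lift_definition times_padic_int :: "'a padic_int \<Rightarrow> 'a padic_int \<Rightarrow> 'a padic_int"
  is "\<lambda>x y n. (x n * y n) mod int CARD('a) ^ n"
  by (rule padic_reduce) (metis mod_mult_eq)

instance
proof
  fix x y z :: "'a padic_int"
  show "x * y * z = x * (y * z)" by transfer (rule ext, simp add: mod_simps mult.assoc)
  show "x * y = y * x" by transfer (simp add: mult.commute)
  show "1 * x = x" by transfer (auto simp: mod_simps fun_eq_iff)
  show "x + y + z = x + (y + z)" by transfer (rule ext, simp add: mod_simps add.assoc)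
  show "x + y = y + x" by transfer (simp add: add.commute)
  show "0 + x = x" by transfer (auto simp: fun_eq_iff)
  show "- x + x = 0" by transfer (rule ext, simp add: mod_simps)
  show "x - y = x + - y" by transfer (rule ext, simp add: mod_simps)
  show "(x + y) * z = x * z + y * z" by transfer (rule ext, simp add: mod_simps distrib_right)
  show "(0::'a padic_int) \<noteq> 1"
    by transfer (use padic_card_gt1[where 'p='a] in \<open>auto simp: fun_eq_iff intro!: exI[of _ 1]\<close>)
qed

end

lemma padic_mod_pow:
  fixes x :: "'p::prime_card padic_int"
  shows "Rep_padic_int x (n + k) mod int CARD('p) ^ n = Rep_padic_int x n"
proof (induction k)
  case 0
  show ?case using Rep_padic_int[of x] by simp
next
  case (Suc k)
  have "Rep_padic_int x (n + Suc k) mod int CARD('p) ^ n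
      = (Rep_padic_int x (Suc (n + k)) mod int CARD('p) ^ (n + k)) mod int CARD('p) ^ n"
    by (simp add: mod_mod_cancel le_imp_power_dvd)
  also have "\<dots> = Rep_padic_int x (n + k) mod int CARD('p) ^ n"
    using Rep_padic_int[of x] by simp
  finally show ?case using Suc by simp
qed

instance padic_int :: (prime_card) idom
proof
  fix x y :: "'a padic_int"
  let ?p = "int CARD('a)" and ?x = "Rep_padic_int x" and ?y = "Rep_padic_int y"
  have p: "Factorial_Ring.prime ?p" using prime_card[where 'a='a] by simp
  assume "x \<noteq> 0" "y \<noteq> 0"
  then have "?x \<noteq> Rep_padic_int (0 :: 'a padic_int)" "?y \<noteq> Rep_padic_int (0 :: 'a padic_int)"
    by (simp_all add: Rep_padic_int_inject)
  then obtain i j where ij: "?x i \<noteq> 0" "?y j \<noteq> 0"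
    by (auto simp: fun_eq_iff zero_padic_int.rep_eq)
  have nx: "\<not> ?p ^ i dvd ?x (i + j)" and ny: "\<not> ?p ^ j dvd ?y (i + j)"
    using ij padic_mod_pow[of x i j] padic_mod_pow[of y j i] by (auto simp: dvd_eq_mod_eq_0 add.commute)
  have n0: "?x (i + j) \<noteq> 0" "?y (i + j) \<noteq> 0" using nx ny by auto
  have u: "\<not> is_unit ?p" using p not_prime_unit by blast
  have "multiplicity ?p (?x (i + j)) < i"
    by (rule multiplicity_lessI[OF n0(1) u nx])
  moreover have "multiplicity ?p (?y (i + j)) < j"
    by (rule multiplicity_lessI[OF n0(2) u ny])
  moreover have "multiplicity ?p (?x (i + j) * ?y (i + j)) =
      multiplicity ?p (?x (i + j)) + multiplicity ?p (?y (i + j))"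
    by (rule prime_elem_multiplicity_mult_distrib[OF prime_imp_prime_elem[OF p] n0])
  ultimately have "multiplicity ?p (?x (i + j) * ?y (i + j)) < i + j"
    by simp
  moreover have "?x (i + j) * ?y (i + j) \<noteq> 0" using n0 by simp
  ultimately have "\<not> ?p ^ (i + j) dvd ?x (i + j) * ?y (i + j)"
    using power_dvd_iff_le_multiplicity[OF _ u] by simp
  then have "Rep_padic_int (x * y) (i + j) \<noteq> 0"
    by (simp add: times_padic_int.rep_eq dvd_eq_mod_eq_0)
  then show "x * y \<noteq> 0" by (auto simp: zero_padic_int.rep_eq)
qed

lemma Rep_padic_of_nat:
  "Rep_padic_int (of_nat m :: 'p::prime_card padic_int) n = int m mod int CARD('p) ^ n"
  by (induction m) (auto simp: zero_padic_int.rep_eq one_padic_int.rep_eq plus_padic_int.rep_eq mod_simps)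

instance padic_int :: (prime_card) ring_char_0
proof
  show "inj (of_nat :: nat \<Rightarrow> 'a padic_int)"
  proof (rule injI)
    fix m n :: nat
    let ?p = "int CARD('a)"
    assume eq: "(of_nat m :: 'a padic_int) = of_nat n"
    define k where "k = m + n"
    have "CARD('a) > 1" using padic_card_gt1[where 'p='a] by simp
    then have "k < CARD('a) ^ k" by (simp add: power_gt_expt)
    then have "int m < ?p ^ k" "int n < ?p ^ k" unfolding k_def by (simp_all flip: of_nat_power)
    then have "int m mod ?p ^ k = int m" "int n mod ?p ^ k = int n" by simp_all
    moreover have "int m mod ?p ^ k = int n mod ?p ^ k"
      unfolding Rep_padic_of_nat[symmetric] eq ..
    ultimately show "m = n" by linarith
  qed
qed

instance fract :: ("{idom,ring_char_0}") field_char_0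
proof
  show "inj (of_nat :: nat \<Rightarrow> 'a fract)"
    by (rule injI) (simp add: of_nat_fract eq_fract)
qed

type_synonym 'p padic = "'p padic_int fract"
type_synonym 'p padic_closure = "'p padic alg_closure"


section \<open>Unramified extensions and the trace\<close>

definition scale_padic :: "'p::prime_card padic \<Rightarrow> 'p padic_closure \<Rightarrow> 'p padic_closure" where
  "scale_padic c x = to_ac c * x"

interpretation Qp: vector_space "scale_padic :: 'p::prime_card padic \<Rightarrow> _"
  by unfold_locales (simp_all add: scale_padic_def algebra_simps)

definition intermediate_field :: "'p::prime_card padic_closure set \<Rightarrow> bool" where
  "intermediate_field K \<longleftrightarrow>
     range to_ac \<subseteq> K \<and>
     (\<forall>x\<in>K. \<forall>y\<in>K. x + y \<in> K \<and> x * y \<in> K) \<and>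
     (\<forall>x\<in>K. - x \<in> K \<and> inverse x \<in> K)"

text \<open>The integral closure of the \<open>p\<close>-adic integers in \<open>K\<close>.\<close>

definition ring_of_integers :: "'p::prime_card padic_closure set \<Rightarrow> 'p padic_closure set" where
  "ring_of_integers K =
     {x \<in> K. \<exists>P :: 'p padic_int Polynomial.poly. Polynomial.lead_coeff P = 1 \<and>
                Polynomial.poly (Polynomial.map_poly (\<lambda>c. to_ac (Fract c 1)) P) x = 0}"

definition maximal_ideal :: "'p::prime_card padic_closure set \<Rightarrow> 'p padic_closure set" where
  "maximal_ideal K = {x \<in> ring_of_integers K. x = 0 \<or> inverse x \<notin> ring_of_integers K}"

definition residue_field :: "'p::prime_card padic_closure set \<Rightarrow> 'p padic_closure set set" where
  "residue_field K =
     ring_of_integers K // {(x, y). x \<in> ring_of_integers K \<and> y \<in> ring_of_integers K \<and>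
                                    x - y \<in> maximal_ideal K}"

text \<open>
  A finite extension is unramified if its degree equals that of the residue field extension;
  the extension of (finite) residue fields is automatically separable.  Since \<^term>\<open>Qp.dim\<close>
  is \<open>0\<close> in infinite dimension, \<open>0 < Qp.dim K\<close> states that \<open>K\<close> is a finite extension.
\<close>

definition unramified_extension :: "'p::prime_card padic_closure set \<Rightarrow> bool" where
  "unramified_extension K \<longleftrightarrow>
     intermediate_field K \<and> 0 < Qp.dim K \<and> card (residue_field K) = CARD('p) ^ Qp.dim K"

definition unramified_field :: "nat \<Rightarrow> 'p::prime_card padic_closure set" where
  "unramified_field r = (THE K. unramified_extension K \<and> card (residue_field K) = r)"

text \<open>The trace of the multiplication map \<open>y \<mapsto> x * y\<close> on \<open>K\<close>, computed in any basis.\<close>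

definition field_trace :: "'p::prime_card padic_closure set \<Rightarrow> 'p padic_closure \<Rightarrow> 'p padic" where
  "field_trace K x =
     (let B = SOME B. Qp.independent B \<and> Qp.span B = K
      in \<Sum>b\<in>B. Qp.representation B (x * b) b)"

definition roots_of_unity :: "nat \<Rightarrow> 'a::field set" where
  "roots_of_unity r = {x. x ^ r = 1}"


section \<open>The \<open>T\<close>-adic exponential sums and their generating function\<close>

text \<open>
  A Laurent polynomial in the variables indexed by \<open>'n\<close> is a finitely supported function from
  exponent vectors to coefficients.
\<close>

definition laurent_eval :: "((int ^ 'n::finite) \<Rightarrow>\<^sub>0 'a::field) \<Rightarrow> 'a ^ 'n \<Rightarrow> 'a" where
  "laurent_eval f x = (\<Sum>u\<in>Poly_Mapping.keys f. Poly_Mapping.lookup f u * (\<Prod>i\<in>UNIV. (x $ i) powi (u $ i)))"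

text \<open>
  The exponential sum \<open>S\<^sub>f(k,T)\<close>, a power series in \<open>T\<close>; \<^term>\<open>fps_binomial \<beta>\<close> is
  the series \<open>(1 + T) ^ \<beta>\<close>.
\<close>

definition exp_sum ::
    "nat \<Rightarrow> ((int ^ 'n::finite) \<Rightarrow>\<^sub>0 'p::prime_card padic_closure) \<Rightarrow> nat \<Rightarrow> 'p padic fps" where
  "exp_sum q f k =
     (\<Sum>x\<in>{x :: 'p padic_closure ^ 'n. \<forall>i. x $ i \<in> roots_of_unity (q ^ k - 1)}.
        fps_binomial (field_trace (unramified_field (q ^ k)) (laurent_eval f x)))"

text \<open>
  \<open>C\<^sub>f(s,T)\<close> as a power series in \<open>s\<close> over the power series in \<open>T\<close>.  The outer series
  of the composition is the exponential series (\<^const>\<open>fps_exp\<close> requires coefficients in a field).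
\<close>

definition C_fun ::
    "nat \<Rightarrow> ((int ^ 'n::finite) \<Rightarrow>\<^sub>0 'p::prime_card padic_closure) \<Rightarrow> 'p padic fps fps" where
  "C_fun q f =
     Abs_fps (\<lambda>i. fps_const (1 / fact i)) oo
     Abs_fps (\<lambda>k. if k = 0 then 0
                   else fps_const (- (1 / ((of_nat (q ^ k) - 1) ^ CARD('n) * of_nat k))) * exp_sum q f k)"


section \<open>Polygons\<close>

text \<open>The lower boundary of a planar set; its value is \<open>\<infinity>\<close> where the set has no point.\<close>

definition lower_boundary :: "(real \<times> real) set \<Rightarrow> real \<Rightarrow> ereal" where
  "lower_boundary S x = (INF y\<in>{y. (x, y) \<in> S}. ereal y)"

text \<open>The points \<open>(k, ord\<^sub>T c\<^sub>k)\<close> with \<open>ord\<^sub>T c\<^sub>k = \<infinity>\<close> are omitted.\<close>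

definition NP_T ::
    "nat \<Rightarrow> ((int ^ 'n::finite) \<Rightarrow>\<^sub>0 'p::prime_card padic_closure) \<Rightarrow> real \<Rightarrow> ereal" where
  "NP_T q f = lower_boundary (convex hull
     {(real k, real (subdegree (fps_nth (C_fun q f) k))) | k. fps_nth (C_fun q f) k \<noteq> 0})"

definition newton_polytope :: "((int ^ 'n::finite) \<Rightarrow>\<^sub>0 'a::zero) \<Rightarrow> (real ^ 'n) set" where
  "newton_polytope f = convex hull (insert 0 ((\<lambda>u. \<chi> i. real_of_int (u $ i)) ` Poly_Mapping.keys f))"

definition is_degree_function :: "(real ^ 'n::finite) set \<Rightarrow> (real ^ 'n \<Rightarrow> real) \<Rightarrow> bool" where
  "is_degree_function \<Delta> d \<longleftrightarrow>
     (\<forall>F. F facet_of \<Delta> \<and> 0 \<notin> F \<longrightarrow> (\<forall>u\<in>F. d u = 1)) \<and>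
     (\<forall>u\<in>cone hull \<Delta>. \<forall>r\<ge>0. d (r *\<^sub>R u) = r * d u)"

text \<open>The choice is irrelevant on the cone, the only place where \<open>deg_fun\<close> is used.\<close>

definition deg_fun :: "(real ^ 'n::finite) set \<Rightarrow> real ^ 'n \<Rightarrow> real" where
  "deg_fun \<Delta> = (SOME d. is_degree_function \<Delta> d)"

definition cone_lattice :: "(real ^ 'n::finite) set \<Rightarrow> (real ^ 'n) set" where
  "cone_lattice \<Delta> = {u \<in> cone hull \<Delta>. \<forall>i. u $ i \<in> \<int>}"

definition deg_denom :: "(real ^ 'n::finite) set \<Rightarrow> nat" where
  "deg_denom \<Delta> = (LEAST D. D > 0 \<and> (\<forall>u\<in>cone_lattice \<Delta>. \<exists>m::int. deg_fun \<Delta> u = of_int m / real D))"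

definition W_count :: "(real ^ 'n::finite) set \<Rightarrow> nat \<Rightarrow> nat" where
  "W_count \<Delta> k = card {u \<in> cone_lattice \<Delta>. deg_fun \<Delta> u = real k / real (deg_denom \<Delta>)}"

definition hodge_vertex :: "nat \<Rightarrow> nat \<Rightarrow> (real ^ 'n::finite) set \<Rightarrow> nat \<Rightarrow> real \<times> real" where
  "hodge_vertex p a \<Delta> m =
     (\<Sum>j<m. real (W_count \<Delta> j),
      real a * (real p - 1) * (\<Sum>j<m. real j / real (deg_denom \<Delta>) * real (W_count \<Delta> j)))"

text \<open>
  If \<open>W_count \<Delta>\<close> has finite support (that is, \<open>\<Delta> = {0}\<close>) the polygon is a bounded path
  and \<open>HP_q\<close> is \<open>\<infinity>\<close> to the right of its last vertex.
\<close>

definition HP_q :: "nat \<Rightarrow> nat \<Rightarrow> (real ^ 'n::finite) set \<Rightarrow> real \<Rightarrow> ereal" where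
  "HP_q p a \<Delta> = lower_boundary
     (\<Union>m. closed_segment (hodge_vertex p a \<Delta> m) (hodge_vertex p a \<Delta> (Suc m)))"

end

theory Submission
  imports Defs "Jordan_Normal_Form.Char_Poly"
begin

text \<open>
  Only \<open>T\<close>-adic orders matter, so everything happens over the power series in \<open>T\<close> with coefficients
  in the algebraic closure of the \<open>p\<close>-adic field.  On a sum of roots of unity of order prime to \<open>p\<close>
  in an unramified extension the trace is the sum of the iterates of \<open>t \<mapsto> t ^ p\<close>.  Hence
  \<open>(1 + T) ^ Tr (f x)\<close> is the product of the series \<open>(1 + T) ^ f\<^sub>j (x ^ p ^ j)\<close>, where \<open>f\<^sub>j\<close> has the
  coefficients \<open>a\<^sub>u ^ p ^ j\<close>, and the coefficient of \<open>T ^ n\<close> in \<open>(1 + T) ^ f\<^sub>j\<close> is a Laurent polynomial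
  with exponents of degree at most \<open>n\<close>.  This plays the role of Dwork's splitting function.

  Summation over the tuples of roots of unity turns \<open>S\<^sub>f(k,T)\<close> into \<open>(q ^ k - 1) ^ n\<close> times the
  sum over the closed walks of length \<open>a k\<close> of a matrix whose entry from \<open>u\<close> to \<open>v\<close> is the coefficient of
  \<open>x ^ (p v - u)\<close> in \<open>(1 + T) ^ f\<^sub>j\<close>, where \<open>j\<close> modulo \<open>a\<close> is carried along as a second index.  Therefore
  \<open>C\<^sub>f(s ^ a, T)\<close> is the characteristic determinant of that matrix.  The entry from \<open>u\<close> to \<open>v\<close> has order at
  least \<open>p deg v - deg u\<close>, and in a product over a permutation of a set of indices these bounds add up to
  \<open>p - 1\<close> times the total degree.  Comparing with the line through each edge of the Hodge polygon gives
  the inequality.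

  For the trace formula one needs that there is exactly one unramified extension with a given residue
  field.  All lifting arguments are Teichmueller lifts in rings that are finitely generated over the
  \<open>p\<close>-adic integers.
\<close>

section \<open>Arithmetic of the \<open>p\<close>-adic integers\<close>

text \<open>Since no \<open>p\<close>-adic estimate is wanted, denominators are harmless: the
  coefficient of \<open>T ^ n\<close> in \<open>(1 + T) ^ g\<close> is the polynomial
  \<open>g (g - 1) ... (g - n + 1) / n!\<close>. This is why the plain binomial series can stand
  where Dwork theory over the \<open>p\<close>-adic integers uses an Artin-Hasse exponential. Two
  features shape the rest. \<open>unramified_field\<close> is a definite description and
  \<open>field_trace\<close> uses an arbitrary basis, so both must be identified by hand; that is
  done without Galois theory, by comparing roots of a characteristic polynomial modulo
  \<open>p\<close>. And the matrix is infinite, but a finite block of it suffices for each power of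
  \<open>T\<close>, so only ordinary determinants and Newton's identities occur and no convergence
  question arises. The index modulo \<open>a\<close> turns a product of \<open>a\<close> different
  factors into a power of one matrix; every closed walk may start at any of the \<open>a\<close>
  levels, and this factor \<open>a\<close> cancels in Newton's identities.\<close>

abbreviation padic_unif :: "'p::prime_card padic_int" where
  "padic_unif \<equiv> of_nat CARD('p)"

lemma Rep_padic_range:
  fixes x :: "'p::prime_card padic_int"
  shows "0 \<le> Rep_padic_int x n" "Rep_padic_int x n < int CARD('p) ^ n"
  using Rep_padic_int[of x] by auto

lemma Rep_padic_mod_self:
  fixes x :: "'p::prime_card padic_int"
  shows "Rep_padic_int x n mod int CARD('p) ^ n = Rep_padic_int x n"
  using Rep_padic_range[of x n] by simp

lemma padic_eqI:
  fixes x y :: "'p::prime_card padic_int"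
  assumes "\<And>n. Rep_padic_int x n = Rep_padic_int y n"
  shows "x = y"
  using assms by (simp add: Rep_padic_int_inject[symmetric] fun_eq_iff)

lemma Abs_padic_inverse:
  fixes f :: "nat \<Rightarrow> int"
  assumes "\<And>n. 0 \<le> f n" "\<And>n. f n < int CARD('p::prime_card) ^ n"
    and "\<And>n. f (Suc n) mod int CARD('p) ^ n = f n"
  shows "Rep_padic_int (Abs_padic_int f :: 'p padic_int) n = f n"
  using assms by (subst Abs_padic_int_inverse) auto

text \<open>Divisibility by \<open>p ^ n\<close> is read off from one component of the inverse
  limit: if component \<open>n\<close> vanishes, then \<open>p ^ n\<close> divides all later ones,
  and dividing these and shifting the index by \<open>n\<close> gives the components of the
  quotient.\<close>

lemma padic_unif_power_dvd_iff:
  fixes x :: "'p::prime_card padic_int"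
  shows "padic_unif ^ n dvd x \<longleftrightarrow> Rep_padic_int x n = 0"
proof
  assume "padic_unif ^ n dvd x"
  then obtain y where y: "x = of_nat (CARD('p) ^ n) * y" by (auto simp: dvd_def)
  show "Rep_padic_int x n = 0"
    unfolding y times_padic_int.rep_eq Rep_padic_of_nat by simp
next
  let ?p = "int CARD('p)" and ?x = "Rep_padic_int x"
  assume x0: "?x n = 0"
  define f where "f k = ?x (n + k) div ?p ^ n" for k
  have pos: "?p ^ k > 0" for k by (rule padic_pow_pos)
  have f1: "0 \<le> f k" for k
    unfolding f_def using Rep_padic_range(1)[of x] by (simp add: pos_imp_zdiv_nonneg_iff pos)
  have f2: "f k < ?p ^ k" for k
  proof -
    have "f k * ?p ^ n \<le> ?x (n + k)"
      unfolding f_def using pos_mod_sign[OF pos[of n], of "?x (n + k)"] by (simp add: minus_mod_eq_div_mult[symmetric])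
    also have "\<dots> < ?p ^ k * ?p ^ n" using Rep_padic_range(2)[of x "n + k"] by (simp add: power_add mult.commute)
    finally show ?thesis using pos[of n] by simp
  qed
  have f3: "f (Suc k) mod ?p ^ k = f k" for k
  proof -
    have "?x (n + Suc k) mod (?p ^ n * ?p ^ k) = ?x (n + k)"
      using padic_mod_pow[of x "n + k" 1] by (simp add: power_add)
    then have "?x (n + k) = ?p ^ n * (?x (n + Suc k) div ?p ^ n mod ?p ^ k) + ?x (n + Suc k) mod ?p ^ n"
      using zmod_zmult2_eq[of "?p ^ k" "?x (n + Suc k)" "?p ^ n"] pos[of k] by simp
    moreover have "?x (n + Suc k) mod ?p ^ n = 0"
      using padic_mod_pow[of x n "Suc k"] x0 by simp
    ultimately show ?thesis unfolding f_def using pos[of n] by simp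
  qed
  define y :: "'p padic_int" where "y = Abs_padic_int f"
  have y: "Rep_padic_int y k = f k" for k
    unfolding y_def by (rule Abs_padic_inverse[OF f1 f2 f3])
  have "x = padic_unif ^ n * y"
  proof (rule padic_eqI)
    fix k
    have "?x (n + k) mod ?p ^ n = 0" using padic_mod_pow[of x n k] x0 by simp
    then have "?p ^ n * f k = ?x (n + k)" unfolding f_def by (simp add: mult_div_mod_eq[symmetric] dvd_eq_mod_eq_0)
    moreover have "Rep_padic_int (padic_unif ^ n * y) k = (?p ^ n mod ?p ^ k * f k) mod ?p ^ k"
      unfolding of_nat_power[symmetric] times_padic_int.rep_eq Rep_padic_of_nat y by simp
    ultimately have "Rep_padic_int (padic_unif ^ n * y) k = ?x (n + k) mod ?p ^ k"
      by (simp add: mod_simps)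
    then show "?x k = Rep_padic_int (padic_unif ^ n * y) k"
      using padic_mod_pow[of x k n] by (simp add: add.commute)
  qed
  then show "padic_unif ^ n dvd x" by simp
qed

lemma padic_unif_power_dvd_diff_iff:
  fixes x y :: "'p::prime_card padic_int"
  shows "padic_unif ^ n dvd x - y \<longleftrightarrow> Rep_padic_int x n = Rep_padic_int y n"
proof -
  have "(Rep_padic_int x n - Rep_padic_int y n) mod int CARD('p) ^ n = 0 \<longleftrightarrow>
      Rep_padic_int x n mod int CARD('p) ^ n = Rep_padic_int y n mod int CARD('p) ^ n"
    by (simp add: mod_eq_dvd_iff dvd_eq_mod_eq_0)
  then show ?thesis
    by (simp add: padic_unif_power_dvd_iff minus_padic_int.rep_eq Rep_padic_mod_self)
qed

lemma padic_separated:
  fixes x :: "'p::prime_card padic_int"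
  assumes "\<And>n. padic_unif ^ n dvd x"
  shows "x = 0"
  using assms by (intro padic_eqI) (simp add: padic_unif_power_dvd_iff zero_padic_int.rep_eq)

text \<open>The limit is the diagonal sequence, whose component \<open>n\<close> is component
  \<open>n\<close> of \<open>z n\<close>; the hypothesis makes these components coherent.\<close>

lemma padic_complete:
  fixes z :: "nat \<Rightarrow> 'p::prime_card padic_int"
  assumes "\<And>n. padic_unif ^ n dvd z (Suc n) - z n"
  shows "\<exists>l. \<forall>n. padic_unif ^ n dvd l - z n"
proof -
  have 1: "Rep_padic_int (z (Suc n)) n = Rep_padic_int (z n) n" for n
    using assms by (simp add: padic_unif_power_dvd_diff_iff)
  have "Rep_padic_int (Abs_padic_int (\<lambda>n. Rep_padic_int (z n) n) :: 'p padic_int) n = Rep_padic_int (z n) n" for n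
    using Rep_padic_range padic_mod_pow[of "z (Suc n)" n 1 for n] 1
    by (intro Abs_padic_inverse) auto
  then show ?thesis
    by (intro exI[of _ "Abs_padic_int (\<lambda>n. Rep_padic_int (z n) n)"]) (simp add: padic_unif_power_dvd_diff_iff)
qed

lemma padic_residue:
  fixes z :: "'p::prime_card padic_int"
  shows "padic_unif dvd z - of_nat (nat (Rep_padic_int z 1))" "nat (Rep_padic_int z 1) < CARD('p)"
proof -
  show "nat (Rep_padic_int z 1) < CARD('p)"
    using Rep_padic_range[of z 1] by (simp add: nat_less_iff)
  have "padic_unif ^ 1 dvd z - of_nat (nat (Rep_padic_int z 1))"
    unfolding padic_unif_power_dvd_diff_iff Rep_padic_of_nat
    using Rep_padic_range[of z 1] by simp
  then show "padic_unif dvd z - of_nat (nat (Rep_padic_int z 1))" by simp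
qed

text \<open>Bezout gives an inverse in each component; inverses modulo \<open>p ^ n\<close> are
  unique, so they form a coherent sequence.\<close>

lemma padic_unit:
  fixes x :: "'p::prime_card padic_int"
  assumes "\<not> padic_unif dvd x"
  shows "x dvd 1"
proof -
  let ?p = "int CARD('p)" and ?x = "Rep_padic_int x"
  have p: "Factorial_Ring.prime ?p" using prime_card[where 'a='p] by simp
  have x1: "?x 1 \<noteq> 0" using assms padic_unif_power_dvd_iff[of 1 x] by simp
  have co: "coprime (?x n) (?p ^ n)" for n
  proof (cases n)
    case (Suc m)
    have "?x (1 + m) mod ?p ^ 1 = ?x 1" by (rule padic_mod_pow)
    then have "\<not> ?p dvd ?x n" using x1 Suc by (auto simp: dvd_eq_mod_eq_0)
    then have "coprime ?p (?x n)" using p by (intro prime_imp_coprime)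
    then show ?thesis by (simp add: coprime_commute)
  qed simp
  define f where "f n = fst (bezout_coefficients (?x n) (?p ^ n)) mod ?p ^ n" for n
  have f: "(?x n * f n) mod ?p ^ n = 1 mod ?p ^ n" for n
  proof -
    have "fst (bezout_coefficients (?x n) (?p ^ n)) * ?x n +
        snd (bezout_coefficients (?x n) (?p ^ n)) * ?p ^ n = 1"
      using co[of n] bezout_coefficients_fst_snd[of "?x n" "?p ^ n"] by (simp add: coprime_iff_gcd_eq_1)
    then have "(?x n * fst (bezout_coefficients (?x n) (?p ^ n))) mod ?p ^ n = 1 mod ?p ^ n"
      by (metis mod_mult_self2 mult.commute mod_mult_self1)
    then show ?thesis unfolding f_def by (simp add: mod_simps)
  qed
  have f3: "f (Suc n) mod ?p ^ n = f n" for n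
  proof -
    have "(?x (Suc n) * f (Suc n)) mod ?p ^ n = 1 mod ?p ^ n"
    proof -
      have "(?x (Suc n) * f (Suc n)) mod ?p ^ Suc n mod ?p ^ n = 1 mod ?p ^ Suc n mod ?p ^ n"
        using f[of "Suc n"] by simp
      then show ?thesis by (simp add: mod_mod_cancel)
    qed
    moreover have "?x (Suc n) mod ?p ^ n = ?x n" using padic_mod_pow[of x n 1] by simp
    ultimately have "(?x n * f (Suc n)) mod ?p ^ n = 1 mod ?p ^ n"
      by (metis mod_mult_left_eq)
    then have "?p ^ n dvd ?x n * f (Suc n) - ?x n * f n"
      using f[of n] by (simp add: mod_eq_dvd_iff[symmetric])
    then have "?p ^ n dvd ?x n * (f (Suc n) - f n)" by (simp add: right_diff_distrib)
    then have "?p ^ n dvd f (Suc n) - f n"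
      using co[of n] by (simp add: coprime_dvd_mult_right_iff coprime_commute)
    then have "f (Suc n) mod ?p ^ n = f n mod ?p ^ n" by (simp add: mod_eq_dvd_iff)
    then show ?thesis by (simp add: f_def)
  qed
  have rep: "Rep_padic_int (Abs_padic_int f :: 'p padic_int) n = f n" for n
    using padic_pow_pos[where 'p='p] f3 by (intro Abs_padic_inverse) (auto simp: f_def)
  have "x * Abs_padic_int f = 1"
    by (rule padic_eqI) (simp add: times_padic_int.rep_eq one_padic_int.rep_eq rep f)
  then show ?thesis by (metis dvd_triv_left)
qed

lemma padic_decomp:
  fixes x :: "'p::prime_card padic_int"
  assumes "x \<noteq> 0"
  obtains n u where "x = padic_unif ^ n * u" "u dvd 1"
proof -
  obtain N where N: "\<not> padic_unif ^ N dvd x" using padic_separated assms by blast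
  define n where "n = (GREATEST n. padic_unif ^ n dvd x)"
  have bound: "k \<le> N" if "padic_unif ^ k dvd x" for k
    using that N by (meson dvd_trans le_imp_power_dvd nat_le_linear)
  have n: "padic_unif ^ n dvd x"
    unfolding n_def by (rule GreatestI_nat[of _ 0 N]) (use bound in auto)
  then obtain u where u: "x = padic_unif ^ n * u" by (auto simp: dvd_def)
  have "\<not> padic_unif dvd u"
  proof
    assume "padic_unif dvd u"
    then have "padic_unif ^ Suc n dvd x" unfolding u by (auto simp: dvd_def mult_ac)
    then have "Suc n \<le> n" unfolding n_def by (rule Greatest_le_nat[of _ _ N]) (use bound in auto)
    then show False by simp
  qed
  then show ?thesis using that u padic_unit by blast
qed

lemma padic_dvd_total:
  fixes x y :: "'p::prime_card padic_int"
  shows "x dvd y \<or> y dvd x"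
proof (cases "x = 0 \<or> y = 0")
  case False
  then have "x \<noteq> 0" "y \<noteq> 0" by auto
  obtain m u where 1: "x = padic_unif ^ m * u" "u dvd 1" by (rule padic_decomp[OF \<open>x \<noteq> 0\<close>])
  obtain n v where 2: "y = padic_unif ^ n * v" "v dvd 1" by (rule padic_decomp[OF \<open>y \<noteq> 0\<close>])
  note * = 1 2
  have "padic_unif ^ m dvd padic_unif ^ n \<or> (padic_unif ^ n :: 'p padic_int) dvd padic_unif ^ m"
    by (cases "m \<le> n") (auto intro: le_imp_power_dvd)
  moreover have "x dvd padic_unif ^ m" "y dvd padic_unif ^ n"
    using mult_dvd_mono[OF dvd_refl[of "padic_unif ^ m"] *(2)]
      mult_dvd_mono[OF dvd_refl[of "padic_unif ^ n"] *(4)] *(1,3) by (simp_all only: mult_1_right)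
  moreover have "padic_unif ^ m dvd x" "padic_unif ^ n dvd y" using *(1,3) by simp_all
  ultimately show ?thesis by (meson dvd_trans)
qed auto

text \<open>Divisibility is total, so a finite family has a member of least valuation. Such a
  coefficient serves as a pivot in linear relations.\<close>

lemma padic_dvd_min:
  fixes g :: "'b \<Rightarrow> 'p::prime_card padic_int"
  assumes "finite A" "A \<noteq> {}"
  shows "\<exists>a\<in>A. \<forall>b\<in>A. g a dvd g b"
  using assms
proof (induction A rule: finite_ne_induct)
  case (insert x F)
  then obtain a where a: "a \<in> F" "\<forall>b\<in>F. g a dvd g b" by blast
  show ?case
  proof (cases "g a dvd g x")
    case False
    then have "g x dvd g a" using padic_dvd_total by blast
    then have "\<forall>b\<in>F. g x dvd g b" using a(2) by (auto intro: dvd_trans)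
    then show ?thesis by (intro bexI[of _ x]) auto
  next
    case True
    then show ?thesis using a by (intro bexI[of _ a]) auto
  qed
qed auto

lemma prime_CARD: "Factorial_Ring.prime CARD('p::prime_card)"
  by (rule prime_card)

lemma dvd_power_diff:
  fixes x y :: "'a::comm_ring_1"
  assumes "d dvd x - y"
  shows "d dvd x ^ n - y ^ n"
  using assms by (simp add: power_diff_sumr2)

lemma padic_fermat:
  fixes z :: "'p::prime_card padic_int"
  shows "padic_unif dvd z ^ CARD('p) - z"
proof -
  let ?m = "nat (Rep_padic_int z 1)"
  have "[?m ^ CARD('p) = ?m] (mod CARD('p))"
  proof (cases "CARD('p) dvd ?m")
    case True
    then have "?m = 0" using padic_residue(2)[of z] by (auto dest: dvd_imp_le)
    then show ?thesis using prime_gt_0_nat[OF prime_CARD[where 'p='p]] by (simp only: power_0_left) simp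
  next
    case False
    then have "[?m ^ (CARD('p) - 1) = 1] (mod CARD('p))" by (intro fermat_theorem prime_CARD)
    then have "[?m * ?m ^ (CARD('p) - 1) = ?m * 1] (mod CARD('p))" by (intro cong_scalar_left)
    then show ?thesis by (simp add: power_eq_if)
  qed
  then have "int CARD('p) dvd int ?m ^ CARD('p) - int ?m"
    by (metis cong_int_iff cong_iff_dvd_diff of_nat_power)
  then obtain k where "int ?m ^ CARD('p) - int ?m = int CARD('p) * k" unfolding dvd_def by blast
  from arg_cong[OF this, of "of_int :: int \<Rightarrow> 'p padic_int"]
  have 1: "(padic_unif :: 'p padic_int) dvd of_nat ?m ^ CARD('p) - of_nat ?m"
    by (simp only: of_int_diff of_int_power of_int_mult of_int_of_nat_eq dvd_triv_left)
  have 2: "padic_unif dvd z ^ CARD('p) - of_nat ?m ^ CARD('p)"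
    by (rule dvd_power_diff[OF padic_residue(1)])
  have 3: "padic_unif dvd of_nat ?m - z"
    using padic_residue(1)[of z] by (metis dvd_minus_iff minus_diff_eq)
  show ?thesis using dvd_add[OF dvd_add[OF 1 2] 3] by simp
qed

section \<open>Orders: finitely generated rings over the \<open>p\<close>-adic integers\<close>

definition padic_emb :: "'p::prime_card padic_int \<Rightarrow> 'p padic_closure" where
  "padic_emb c = to_ac (Fract c 1)"

lemma padic_emb_simps [simp]:
  "padic_emb 0 = 0" "padic_emb 1 = 1" "padic_emb (x + y) = padic_emb x + padic_emb y"
  "padic_emb (x * y) = padic_emb x * padic_emb y" "padic_emb (- x) = - padic_emb x"
  "padic_emb (x - y) = padic_emb x - padic_emb y"
proof -
  show "padic_emb 0 = 0" "padic_emb 1 = 1"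
    unfolding padic_emb_def Zero_fract_def[symmetric] One_fract_def[symmetric] by (rule to_ac_0 to_ac_1)+
  show "padic_emb (x + y) = padic_emb x + padic_emb y"
    unfolding padic_emb_def to_ac_add[symmetric] by simp
  show "padic_emb (x * y) = padic_emb x * padic_emb y"
    unfolding padic_emb_def to_ac_mult[symmetric] by simp
  show "padic_emb (- x) = - padic_emb x"
    unfolding padic_emb_def to_ac_minus[symmetric] by simp
  show "padic_emb (x - y) = padic_emb x - padic_emb y"
    unfolding padic_emb_def to_ac_diff[symmetric] by simp
qed

lemma padic_emb_power [simp]: "padic_emb (x ^ n) = padic_emb x ^ n"
  by (induction n) auto

lemma padic_emb_of_nat [simp]: "padic_emb (of_nat n) = of_nat n"
  by (induction n) auto

lemma padic_emb_eq_0_iff [simp]: "padic_emb x = 0 \<longleftrightarrow> x = 0"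
  by (simp add: padic_emb_def Zero_fract_def eq_fract)

lemma padic_emb_sum: "padic_emb (sum g A) = (\<Sum>a\<in>A. padic_emb (g a))"
  by (induction A rule: infinite_finite_induct) auto

interpretation Zp: Modules.module "\<lambda>c x. padic_emb c * (x :: 'p::prime_card padic_closure)"
  by unfold_locales (simp_all add: algebra_simps)

text \<open>A generating subset of least cardinality is independent: in a nontrivial relation,
  cancelling a coefficient that divides all others leaves a coefficient \<open>1\<close>, and its
  element could be dropped. Cancellation is possible because the module sits in a field.\<close>

lemma Zp_independent_subset:
  fixes S :: "'p::prime_card padic_closure set"
  assumes "finite S"
  obtains B where "B \<subseteq> S" "Zp.independent B" "Zp.span B = Zp.span S"
proof -
  define Q where "Q n \<longleftrightarrow> (\<exists>B. B \<subseteq> S \<and> Zp.span B = Zp.span S \<and> card B = n)" for n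
  have "Q (card S)" unfolding Q_def by blast
  then have "Q (LEAST n. Q n)" by (rule LeastI)
  then obtain B where B: "B \<subseteq> S" "Zp.span B = Zp.span S" "card B = (LEAST n. Q n)"
    unfolding Q_def by blast
  have fin: "finite B" using B(1) assms finite_subset by blast
  have "Zp.independent B"
  proof (rule ccontr)
    assume "\<not> Zp.independent B"
    then obtain u v where uv: "v \<in> B" "u v \<noteq> 0" "(\<Sum>v\<in>B. padic_emb (u v) * v) = 0"
      using Zp.dependent_finite[OF fin] by auto
    obtain w where w: "w \<in> B" "\<forall>b\<in>B. u w dvd u b"
      using padic_dvd_min[OF fin, of u] uv(1) by blast
    have uw: "u w \<noteq> 0" using w uv by auto
    have "\<forall>b\<in>B. \<exists>c. u b = u w * c" using w(2) by (auto simp: dvd_def)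
    from bchoice[OF this] obtain c where "\<forall>b\<in>B. u b = u w * c b" ..
    then have c: "u b = u w * c b" if "b \<in> B" for b using that by (rule bspec)
    have "(\<Sum>v\<in>B. padic_emb (u v) * v) = (\<Sum>v\<in>B. padic_emb (u w) * (padic_emb (c v) * v))"
    proof (rule sum.cong[OF refl])
      fix b assume "b \<in> B"
      then show "padic_emb (u b) * b = padic_emb (u w) * (padic_emb (c b) * b)"
        using c by (simp only: padic_emb_simps mult.assoc)
    qed
    also have "\<dots> = padic_emb (u w) * (\<Sum>v\<in>B. padic_emb (c v) * v)" by (simp add: sum_distrib_left)
    finally have "(\<Sum>v\<in>B. padic_emb (c v) * v) = 0" using uw uv(3) by simp
    moreover have "c w = 1" using c[OF w(1)] uw by (metis mult_cancel_left mult_1_right)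
    ultimately have "w = - (\<Sum>v\<in>B - {w}. padic_emb (c v) * v)"
      using fin w(1) by (simp add: sum.remove eq_neg_iff_add_eq_0)
    also have "\<dots> \<in> Zp.span (B - {w})"
      by (intro Zp.span_neg Zp.span_sum Zp.span_scale Zp.span_base)
    finally have "w \<in> Zp.span (B - {w})" .
    then have "B \<subseteq> Zp.span (B - {w})" using Zp.span_superset[of "B - {w}"] by blast
    then have "Zp.span B \<subseteq> Zp.span (B - {w})"
      by (rule Zp.span_minimal[OF _ Zp.subspace_span])
    then have "Zp.span (B - {w}) = Zp.span B"
      using Zp.span_mono[of "B - {w}" B] by blast
    then have "Q (card (B - {w}))" unfolding Q_def using B by blast
    then have "card B \<le> card (B - {w})" unfolding B(3) by (rule Least_le)
    then show False using fin w(1) by (metis card_Diff1_less not_le)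
  qed
  then show ?thesis using that B by blast
qed

lemma padic_common_denominator:
  fixes c :: "'b \<Rightarrow> 'p::prime_card padic"
  assumes "finite A"
  shows "\<exists>d a. d \<noteq> 0 \<and> (\<forall>x\<in>A. Fract d 1 * c x = Fract (a x) 1)"
  using assms
proof (induction A rule: finite_induct)
  case empty
  show ?case by (intro exI[of _ 1]) auto
next
  case (insert x F)
  then obtain d a where da: "d \<noteq> 0" "\<forall>y\<in>F. Fract d 1 * c y = Fract (a y) 1" by blast
  obtain r s where rs: "c x = Fract r s" "s \<noteq> 0" by (cases "c x") auto
  have 1: "Fract (d * s) 1 * c x = Fract (d * r) 1" using rs by (simp add: eq_fract)
  have 2: "Fract (d * s) 1 * c y = Fract (s * a y) 1" if "y \<in> F" for y
  proof -
    have "Fract (d * s) 1 = Fract s 1 * Fract d 1" by (simp add: mult.commute)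
    then have "Fract (d * s) 1 * c y = Fract s 1 * (Fract d 1 * c y)" by (simp only: mult.assoc)
    then show ?thesis using da(2) that by simp
  qed
  show ?case
    using 1 2 da(1) rs(2) insert.hyps
    by (intro exI[of _ "d * s"] exI[of _ "\<lambda>y. if y = x then d * r else s * a y"]) auto
qed

lemma Zp_independent_imp_Qp_independent:
  fixes B :: "'p::prime_card padic_closure set"
  assumes "finite B" "Zp.independent B"
  shows "Qp.independent B"
proof
  assume "Qp.dependent B"
  then obtain u v where uv: "v \<in> B" "u v \<noteq> 0" "(\<Sum>v\<in>B. scale_padic (u v) v) = 0"
    using Qp.dependent_finite[OF assms(1)] by auto
  obtain d a where da: "d \<noteq> 0" "\<forall>x\<in>B. Fract d 1 * u x = Fract (a x) 1"
    using padic_common_denominator[OF assms(1)] by blast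
  have "0 = padic_emb d * (\<Sum>v\<in>B. scale_padic (u v) v)" using uv by simp
  also have "\<dots> = (\<Sum>v\<in>B. padic_emb (a v) * v)"
    unfolding sum_distrib_left
    by (intro sum.cong refl)
      (use da(2) in \<open>simp add: scale_padic_def padic_emb_def flip: mult.assoc to_ac_mult\<close>)
  finally have "a v = 0"
    using Zp.independentD[OF assms(2,1) order_refl, of a v] uv(1) by simp
  then have "Fract d 1 * u v = 0" using da uv(1) by (simp add: Zero_fract_def)
  moreover have "Fract d 1 \<noteq> 0" using da(1) by (simp add: Zero_fract_def eq_fract)
  ultimately show False using uv(2) by (metis mult_eq_0_iff)
qed

section \<open>The reversed characteristic polynomial\<close>

definition rev_char_matrix :: "nat \<Rightarrow> (nat \<Rightarrow> nat \<Rightarrow> 'a::idom) \<Rightarrow> 'a Polynomial.poly Matrix.mat" where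
  "rev_char_matrix n B =
     Matrix.mat n n (\<lambda>(i, j). (if i = j then 1 else 0) + Polynomial.monom (- B i j) 1)"

text \<open>This is \<open>det (1 - X B)\<close>. In characteristic \<open>0\<close> it is the
  exponential of minus the sum of \<open>tr (B ^ k) X ^ k / k\<close>, the shape in which
  \<open>C_fun\<close> is given.\<close>

definition rev_char_poly :: "nat \<Rightarrow> (nat \<Rightarrow> nat \<Rightarrow> 'a::idom) \<Rightarrow> 'a Polynomial.poly" where
  "rev_char_poly n B = Determinant.det (rev_char_matrix n B)"

text \<open>Matrix powers as weighted walks through an arbitrary index set, so that indices may be
  pairs of an exponent and a level.\<close>

primrec mpow :: "'i set \<Rightarrow> ('i \<Rightarrow> 'i \<Rightarrow> 'a::comm_ring_1) \<Rightarrow> nat \<Rightarrow> 'i \<Rightarrow> 'i \<Rightarrow> 'a" where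
  "mpow I B 0 x y = (if x = y then 1 else 0)"
| "mpow I B (Suc k) x y = (\<Sum>z\<in>I. mpow I B k x z * B z y)"

lemma rev_char_matrix_carrier: "rev_char_matrix n B \<in> carrier_mat n n"
  by (simp add: rev_char_matrix_def)

lemma rev_char_matrix_index:
  "i < n \<Longrightarrow> j < n \<Longrightarrow>
   rev_char_matrix n B $$ (i, j) = (if i = j then 1 else 0) + Polynomial.monom (- B i j) 1"
  by (simp add: rev_char_matrix_def)

text \<open>Jacobi's formula. The product rule gives a sum of determinants with one row
  differentiated; expanding along that row yields cofactors of \<open>P\<close> itself, because
  these do not see the row.\<close>

lemma pderiv_det:
  fixes P :: "'a::idom Polynomial.poly Matrix.mat"
  assumes P: "P \<in> carrier_mat n n"
  shows "Polynomial.pderiv (Determinant.det P) =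
    (\<Sum>i<n. \<Sum>j<n. Polynomial.pderiv (P $$ (i, j)) * cofactor P i j)"
proof -
  define R where "R i = Matrix.mat n n (\<lambda>(k, j). if k = i then Polynomial.pderiv (P $$ (i, j)) else P $$ (k, j))" for i
  have R: "R i \<in> carrier_mat n n" for i by (simp add: R_def)
  have cof: "cofactor (R i) i j = cofactor P i j" if "i < n" "j < n" for i j
  proof -
    have "mat_delete (R i) i j = mat_delete P i j"
      using that P by (intro eq_matI) (auto simp: mat_delete_def R_def)
    then show ?thesis by (simp add: cofactor_def)
  qed
  have "Polynomial.pderiv (Determinant.det P) =
      (\<Sum>p | p permutes {0..<n}. signof p * Polynomial.pderiv (\<Prod>i = 0..<n. P $$ (i, p i)))"
  proof -
    have sg: "Polynomial.pderiv (signof p * q) = signof p * Polynomial.pderiv q"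
      for p :: "nat \<Rightarrow> nat" and q :: "'a Polynomial.poly"
      by (cases "sign p = 1") (auto simp: sign_def Polynomial.pderiv_minus)
    show ?thesis
      unfolding det_def'[OF P] by (simp add: sg Missing_Polynomial.pderiv_sum)
  qed
  also have "\<dots> = (\<Sum>p | p permutes {0..<n}. \<Sum>i<n. signof p *
      (\<Prod>k = 0..<n. R i $$ (k, p k)))"
  proof (rule sum.cong[OF refl])
    fix p assume "p \<in> {p. p permutes {0..<n}}"
    then have p: "p k < n" if "k < n" for k using that permutes_in_image[of p "{0..<n}" k] by auto
    have "(\<Prod>k\<in>{0..<n} - {i}. P $$ (k, p k)) * Polynomial.pderiv (P $$ (i, p i))
        = (\<Prod>k = 0..<n. R i $$ (k, p k))" if "i < n" for i
    proof -
      have "(\<Prod>k = 0..<n. R i $$ (k, p k)) =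
        R i $$ (i, p i) * (\<Prod>k\<in>{0..<n} - {i}. R i $$ (k, p k))"
        using that by (intro prod.remove) auto
      also have "(\<Prod>k\<in>{0..<n} - {i}. R i $$ (k, p k)) = (\<Prod>k\<in>{0..<n} - {i}. P $$ (k, p k))"
        using p by (intro prod.cong) (auto simp: R_def)
      finally show ?thesis using that p by (simp add: R_def)
    qed
    then show "signof p * Polynomial.pderiv (\<Prod>i = 0..<n. P $$ (i, p i)) =
        (\<Sum>i<n. signof p * (\<Prod>k = 0..<n. R i $$ (k, p k)))"
      by (simp add: pderiv_prod sum_distrib_left[symmetric] lessThan_atLeast0)
  qed
  also have "\<dots> = (\<Sum>i<n. Determinant.det (R i))"
    by (subst sum.swap) (simp add: det_def'[OF R])
  also have "\<dots> = (\<Sum>i<n. \<Sum>j<n. Polynomial.pderiv (P $$ (i, j)) * cofactor P i j)"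
    by (intro sum.cong[OF refl])
      (auto simp: laplace_expansion_row[OF R] cof intro!: sum.cong, auto simp: R_def)
  finally show ?thesis .
qed

text \<open>This is \<open>adj (1 - X B) = det (1 - X B) (1 + X B + X ^ 2 B ^ 2 + ...)\<close>,
  coefficient by coefficient. Comparing coefficients in \<open>adj P * P = det P\<close> gives a
  recursion in \<open>k\<close>, so no inverse of \<open>1 - X B\<close> has to be formed.\<close>

lemma coeff_adj_rev_char_matrix:
  assumes i: "i < n" and j: "j < n"
  shows "Polynomial.coeff (adj_mat (rev_char_matrix n B) $$ (i, j)) k =
    (\<Sum>l\<le>k. Polynomial.coeff (rev_char_poly n B) l * mpow {..<n} B (k - l) i j)"
  using j
proof (induction k arbitrary: j)
  case (0 j)
  let ?P = "rev_char_matrix n B"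
  have P: "?P \<in> carrier_mat n n" by (rule rev_char_matrix_carrier)
  have "(adj_mat ?P * ?P) $$ (i, j) = (\<Sum>z<n. adj_mat ?P $$ (i, z) * ?P $$ (z, j))"
    using adj_mat(1)[OF P] P i 0 by (simp add: scalar_prod_def lessThan_atLeast0)
  then have "(\<Sum>z<n. adj_mat ?P $$ (i, z) * ?P $$ (z, j)) = (if i = j then rev_char_poly n B else 0)"
    using i 0 unfolding adj_mat(3)[OF P] by (auto simp: rev_char_poly_def split: if_splits)
  have "(\<Sum>z<n. if z = j then Polynomial.coeff (adj_mat ?P $$ (i, z)) 0 else 0) =
      (if i = j then Polynomial.coeff (rev_char_poly n B) 0 else 0)"
  proof -
    have "Polynomial.coeff (r * ?P $$ (z, j)) 0 = (if z = j then Polynomial.coeff r 0 else 0)"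
      if "z < n" for z r
      using that 0 by (simp add: rev_char_matrix_index coeff_mult)
    then show ?thesis
      using arg_cong[OF \<open>(\<Sum>z<n. adj_mat ?P $$ (i, z) * ?P $$ (z, j)) = _\<close>,
          of "\<lambda>q. Polynomial.coeff q 0"]
      by (simp add: Polynomial.coeff_sum split: if_splits)
  qed
  then show ?case using 0 by simp
next
  case (Suc k j)
  let ?P = "rev_char_matrix n B"
  have P: "?P \<in> carrier_mat n n" by (rule rev_char_matrix_carrier)
  have "(adj_mat ?P * ?P) $$ (i, j) = (\<Sum>z<n. adj_mat ?P $$ (i, z) * ?P $$ (z, j))"
    using adj_mat(1)[OF P] P i Suc.prems by (simp add: scalar_prod_def lessThan_atLeast0)
  then have "(\<Sum>z<n. adj_mat ?P $$ (i, z) * ?P $$ (z, j)) = (if i = j then rev_char_poly n B else 0)"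
    using i Suc.prems unfolding adj_mat(3)[OF P] by (auto simp: rev_char_poly_def split: if_splits)
  have "(\<Sum>z<n. (if z = j then Polynomial.coeff (adj_mat ?P $$ (i, z)) (Suc k) else 0)
        - Polynomial.coeff (adj_mat ?P $$ (i, z)) k * B z j) =
      (if i = j then Polynomial.coeff (rev_char_poly n B) (Suc k) else 0)"
  proof -
    have "Polynomial.coeff (r * ?P $$ (z, j)) (Suc k) =
        (if z = j then Polynomial.coeff r (Suc k) else 0) - Polynomial.coeff r k * B z j" if "z < n" for z r
      using that Suc.prems
      by (simp add: rev_char_matrix_index distrib_left mult.commute[of r "Polynomial.monom _ _"]
          coeff_monom_mult mult.commute[of "B z j"])
    then show ?thesis
      using arg_cong[OF \<open>(\<Sum>z<n. adj_mat ?P $$ (i, z) * ?P $$ (z, j)) = _\<close>,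
          of "\<lambda>q. Polynomial.coeff q (Suc k)"]
      by (simp add: Polynomial.coeff_sum split: if_splits)
  qed
  then have "Polynomial.coeff (adj_mat ?P $$ (i, j)) (Suc k) =
      (\<Sum>z<n. Polynomial.coeff (adj_mat ?P $$ (i, z)) k * B z j) +
      (if i = j then Polynomial.coeff (rev_char_poly n B) (Suc k) else 0)"
    using Suc.prems by (simp add: sum_subtractf algebra_simps)
  also have "(\<Sum>z<n. Polynomial.coeff (adj_mat ?P $$ (i, z)) k * B z j) =
      (\<Sum>z<n. \<Sum>l\<le>k. Polynomial.coeff (rev_char_poly n B) l * (mpow {..<n} B (k - l) i z * B z j))"
    using Suc.IH by (simp add: sum_distrib_right mult.assoc)
  also have "\<dots> = (\<Sum>l\<le>k. Polynomial.coeff (rev_char_poly n B) l * mpow {..<n} B (Suc k - l) i j)"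
    by (subst sum.swap) (simp add: sum_distrib_left[symmetric] Suc_diff_le)
  finally show ?case by simp
qed

text \<open>Newton's identities: by Jacobi's formula the derivative of \<open>det (1 - X B)\<close>
  is \<open>- tr (B adj (1 - X B))\<close>, and the expansion of the adjugate is known.\<close>

lemma rev_char_poly_recursion:
  "of_nat (Suc k) * Polynomial.coeff (rev_char_poly n B) (Suc k) =
    - (\<Sum>l\<le>k. Polynomial.coeff (rev_char_poly n B) l * (\<Sum>i<n. mpow {..<n} B (Suc k - l) i i))"
proof -
  let ?P = "rev_char_matrix n B"
  let ?c = "Polynomial.coeff (rev_char_poly n B)"
  have P: "?P \<in> carrier_mat n n" by (rule rev_char_matrix_carrier)
  have pd: "Polynomial.pderiv (?P $$ (i, j)) * cofactor ?P i j =
      Polynomial.smult (- B i j) (adj_mat ?P $$ (j, i))" if "i < n" "j < n" for i j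
    using that P
    by (simp add: rev_char_matrix_index adj_mat_def Polynomial.pderiv_add Polynomial.pderiv_monom Polynomial.monom_0)
  have "Polynomial.pderiv (rev_char_poly n B) =
      (\<Sum>i<n. \<Sum>j<n. Polynomial.smult (- B i j) (adj_mat ?P $$ (j, i)))"
    unfolding rev_char_poly_def pderiv_det[OF P] by (intro sum.cong refl) (simp add: pd)
  then have "of_nat (Suc k) * ?c (Suc k) =
      (\<Sum>i<n. \<Sum>j<n. - B i j * Polynomial.coeff (adj_mat ?P $$ (j, i)) k)"
    by (simp add: Polynomial.coeff_pderiv[symmetric] Polynomial.coeff_sum del: of_nat_Suc)
  also have "\<dots> = (\<Sum>i<n. \<Sum>j<n. - (\<Sum>l\<le>k. ?c l * (mpow {..<n} B (k - l) j i * B i j)))"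
    by (intro sum.cong refl) (simp add: coeff_adj_rev_char_matrix sum_distrib_left sum_negf mult_ac)
  also have "\<dots> = - (\<Sum>l\<le>k. \<Sum>j<n. \<Sum>i<n. ?c l * (mpow {..<n} B (k - l) j i * B i j))"
  proof -
    have "(\<Sum>i<n. \<Sum>j<n. (\<Sum>l\<le>k. ?c l * (mpow {..<n} B (k - l) j i * B i j))) =
      (\<Sum>j<n. \<Sum>i<n. (\<Sum>l\<le>k. ?c l * (mpow {..<n} B (k - l) j i * B i j)))"
      by (rule sum.swap)
    also have "\<dots> = (\<Sum>j<n. \<Sum>l\<le>k. \<Sum>i<n. ?c l * (mpow {..<n} B (k - l) j i * B i j))"
      by (intro sum.cong refl sum.swap)
    also have "\<dots> = (\<Sum>l\<le>k. \<Sum>j<n. \<Sum>i<n. ?c l * (mpow {..<n} B (k - l) j i * B i j))"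
      by (rule sum.swap)
    finally show ?thesis by (simp add: sum_negf)
  qed
  also have "\<dots> = - (\<Sum>l\<le>k. ?c l * (\<Sum>j<n. mpow {..<n} B (Suc k - l) j j))"
    by (simp add: sum_distrib_left Suc_diff_le)
  finally show ?thesis .
qed

lemma rev_char_poly_0:
  fixes B :: "nat \<Rightarrow> nat \<Rightarrow> 'a::idom"
  shows "Polynomial.coeff (rev_char_poly n B) 0 = 1"
proof -
  have "map_mat (\<lambda>q. Polynomial.poly q 0) (rev_char_matrix n B) = 1\<^sub>m n"
    by (rule eq_matI) (auto simp: rev_char_matrix_def Polynomial.poly_monom)
  moreover have "Polynomial.poly (rev_char_poly n B) 0 =
      Determinant.det (map_mat (\<lambda>q. Polynomial.poly q 0) (rev_char_matrix n B))"
  proof -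
    have "comm_ring_hom (\<lambda>q. Polynomial.poly q (0::'a))" by unfold_locales auto
    then show ?thesis unfolding rev_char_poly_def by (rule comm_ring_hom.hom_det[symmetric])
  qed
  ultimately show ?thesis by (simp add: poly_0_coeff_0)
qed

lemma coeff_prod_rev_char:
  fixes b d :: "nat \<Rightarrow> 'a::idom"
  assumes "finite A"
  shows "Polynomial.coeff (\<Prod>i\<in>A. [:d i:] + Polynomial.monom (- b i) 1) k =
    (\<Sum>S | S \<subseteq> A \<and> card S = k. (-1) ^ k * (\<Prod>i\<in>S. b i) * (\<Prod>i\<in>A - S. d i))"
proof -
  have m: "(\<Prod>i\<in>S. Polynomial.monom (- b i) 1) = Polynomial.monom ((-1) ^ card S * (\<Prod>i\<in>S. b i)) (card S)"
    if "finite S" for S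
    using that by (induction S rule: finite_induct) (auto simp: Polynomial.mult_monom mult_ac)
  have c: "(\<Prod>i\<in>S. [:d i:]) = [:\<Prod>i\<in>S. d i:]" for S
    by (induction S rule: infinite_finite_induct) (auto simp: mult_ac)
  have "(\<Prod>i\<in>A. [:d i:] + Polynomial.monom (- b i) 1) =
      (\<Sum>S\<in>Pow A. (\<Prod>i\<in>S. Polynomial.monom (- b i) 1) * (\<Prod>i\<in>A - S. [:d i:]))"
    by (subst prod_add[OF assms, symmetric]) (simp add: add.commute)
  also have "Polynomial.coeff \<dots> k = (\<Sum>S\<in>Pow A. if card S = k then
      (-1) ^ k * (\<Prod>i\<in>S. b i) * (\<Prod>i\<in>A - S. d i) else 0)"
    unfolding Polynomial.coeff_sum
    by (intro sum.cong refl, subst m)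
      (auto simp: c Polynomial.coeff_monom mult_ac intro: finite_subset[OF _ assms])
  also have "\<dots> = (\<Sum>S | S \<subseteq> A \<and> card S = k. (-1) ^ k * (\<Prod>i\<in>S. b i) * (\<Prod>i\<in>A - S. d i))"
    using assms by (intro sum.mono_neutral_cong_right) auto
  finally show ?thesis .
qed

text \<open>Up to sign, coefficient \<open>k\<close> is a sum of products along permutations of
  \<open>k\<close>-element index sets, the principal minors. As a closure principle for an additive
  property it serves both for the bound on the degree and for the \<open>T\<close>-adic
  orders.\<close>

lemma rev_char_poly_coeff_closed:
  fixes B :: "nat \<Rightarrow> nat \<Rightarrow> 'a::idom"
  assumes zero: "Q 0" and add: "\<And>x y. Q x \<Longrightarrow> Q y \<Longrightarrow> Q (x + y)" and neg: "\<And>x. Q x \<Longrightarrow> Q (- x)"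
    and terms: "\<And>S \<sigma>. S \<subseteq> {..<n} \<Longrightarrow> card S = k \<Longrightarrow> \<sigma> permutes S \<Longrightarrow> Q (\<Prod>i\<in>S. B i (\<sigma> i))"
  shows "Q (Polynomial.coeff (rev_char_poly n B) k)"
proof -
  have Qsum: "Q (sum g A)" if "\<And>x. x \<in> A \<Longrightarrow> Q (g x)" for A :: "'b set" and g
    using that by (induction A rule: infinite_finite_induct) (auto intro: zero add)
  have Qsign: "Q (signof p * x)" if "Q x" for x and p :: "nat \<Rightarrow> nat"
    using that neg by (cases "sign p = 1") (auto simp: sign_def)
  have Qpow: "Q ((-1) ^ j * x)" if "Q x" for x and j :: nat
    using that neg by (cases "even j") auto
  have "Polynomial.coeff (signof p * q) k = signof p * Polynomial.coeff q k" for p :: "nat \<Rightarrow> nat" and q :: "'a Polynomial.poly"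
    by (cases "sign p = 1") (auto simp: sign_def)
  then have "Polynomial.coeff (rev_char_poly n B) k = (\<Sum>p | p permutes {0..<n}. signof p *
      Polynomial.coeff (\<Prod>i = 0..<n. rev_char_matrix n B $$ (i, p i)) k)"
    unfolding rev_char_poly_def det_def'[OF rev_char_matrix_carrier] by (simp add: Polynomial.coeff_sum)
  also have "Q \<dots>"
  proof (intro Qsum Qsign)
    fix p assume "p \<in> {p. p permutes {0..<n}}"
    then have p: "p permutes {0..<n}" by simp
    then have pn: "p i < n" if "i < n" for i using that permutes_in_image[of p "{0..<n}" i] by auto
    have eq: "(\<Prod>i = 0..<n. rev_char_matrix n B $$ (i, p i)) =
      (\<Prod>i = 0..<n. [:if i = p i then 1 else 0:] + Polynomial.monom (- B i (p i)) 1)"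
      by (intro prod.cong refl) (auto simp: rev_char_matrix_index pn one_pCons)
    show "Q (Polynomial.coeff (\<Prod>i = 0..<n. rev_char_matrix n B $$ (i, p i)) k)"
      unfolding eq coeff_prod_rev_char[OF finite_atLeastLessThan]
    proof (rule Qsum)
      fix S assume "S \<in> {S. S \<subseteq> {0..<n} \<and> card S = k}"
      then have S: "S \<subseteq> {0..<n}" "card S = k" by auto
      show "Q ((-1) ^ k * (\<Prod>i\<in>S. B i (p i)) * (\<Prod>i\<in>{0..<n} - S. if i = p i then 1 else 0))"
      \<comment> \<open>Outside \<open>S\<close> the constant parts of the entries are taken, and
        these vanish off the diagonal; so only permutations that fix the complement of
        \<open>S\<close> contribute.\<close>
      proof (cases "\<forall>i\<in>{0..<n} - S. p i = i")
        case True
        then have "p permutes S"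
          using permutes_superset[OF p] S by auto
        then have "Q (\<Prod>i\<in>S. B i (p i))" using terms S by (auto simp: lessThan_atLeast0)
        moreover have "(\<Prod>i\<in>{0..<n} - S. if i = p i then 1 else 0 :: 'a) = 1"
          using True by (intro prod.neutral) auto
        ultimately show ?thesis using Qpow by simp
      next
        case False
        then obtain i where i: "i \<in> {0..<n} - S" "p i \<noteq> i" by auto
        then have z: "(\<Prod>i\<in>{0..<n} - S. if i = p i then 1 else 0 :: 'a) = 0"
          by (subst prod.remove[OF _ i(1)]) auto
        show ?thesis using zero by (simp only: z mult_zero_right)
      qed
    qed
  qed
  finally show ?thesis .
qed

section \<open>Congruences, Teichmueller lifts and units in an order\<close>

abbreviation ac_unif :: "'p::prime_card padic_closure" where
  "ac_unif \<equiv> of_nat CARD('p)"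

text \<open>A ring inside the closure that is free of finite rank over the \<open>p\<close>-adic
  integers. Its coordinates make it separated and complete, while no such finiteness is known in
  advance for the ring of integers of an intermediate field.\<close>

locale padic_order =
  fixes L B :: "'p::prime_card padic_closure set"
  assumes finite_basis: "finite B"
    and independent_basis: "Zp.independent B"
    and span_basis: "L = Zp.span B"
    and one_closed [simp]: "1 \<in> L"
    and mult_closed [simp]: "x \<in> L \<Longrightarrow> y \<in> L \<Longrightarrow> x * y \<in> L"
begin

lemma zero_closed [simp]: "0 \<in> L"
  by (simp add: span_basis Zp.span_zero)

lemma add_closed [simp]: "x \<in> L \<Longrightarrow> y \<in> L \<Longrightarrow> x + y \<in> L"
  by (simp add: span_basis Zp.span_add)

lemma diff_closed [simp]: "x \<in> L \<Longrightarrow> y \<in> L \<Longrightarrow> x - y \<in> L"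
  by (simp add: span_basis Zp.span_diff)

lemma minus_closed [simp]: "x \<in> L \<Longrightarrow> - x \<in> L"
  by (simp add: span_basis Zp.span_neg)

lemma scale_closed [simp]: "x \<in> L \<Longrightarrow> padic_emb c * x \<in> L"
  by (simp add: span_basis Zp.span_scale)

lemma emb_closed [simp]: "padic_emb c \<in> L"
  using scale_closed[OF one_closed, of c] by simp

lemma of_nat_closed [simp]: "of_nat n \<in> L"
  using emb_closed[of "of_nat n"] by simp

lemma power_closed [simp]: "x \<in> L \<Longrightarrow> x ^ n \<in> L"
  by (induction n) auto

lemma sum_closed: "(\<And>a. a \<in> A \<Longrightarrow> g a \<in> L) \<Longrightarrow> sum g A \<in> L"
  by (induction A rule: infinite_finite_induct) auto

definition ocong :: "nat \<Rightarrow> 'p padic_closure \<Rightarrow> 'p padic_closure \<Rightarrow> bool" where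
  "ocong n x y \<longleftrightarrow> (\<exists>z\<in>L. x - y = ac_unif ^ n * z)"

lemma ocong_refl [simp]: "ocong n x x"
  unfolding ocong_def by (intro bexI[of _ 0]) auto

lemma ocong_sym: "ocong n x y \<Longrightarrow> ocong n y x"
  unfolding ocong_def
proof (elim bexE)
  fix z assume "z \<in> L" "x - y = ac_unif ^ n * z"
  then show "\<exists>z\<in>L. y - x = ac_unif ^ n * z"
    by (intro bexI[of _ "- z"]) (auto simp: algebra_simps)
qed

lemma ocong_trans [trans]: "ocong n x y \<Longrightarrow> ocong n y z \<Longrightarrow> ocong n x z"
  unfolding ocong_def
proof (elim bexE)
  fix u v assume "u \<in> L" "v \<in> L" "x - y = ac_unif ^ n * u" "y - z = ac_unif ^ n * v"
  then show "\<exists>w\<in>L. x - z = ac_unif ^ n * w"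
    by (intro bexI[of _ "u + v"]) (auto simp: algebra_simps)
qed

lemma ocong_mono: "ocong n x y \<Longrightarrow> m \<le> n \<Longrightarrow> ocong m x y"
  unfolding ocong_def
proof (elim bexE)
  fix z assume "z \<in> L" "x - y = ac_unif ^ n * z" "m \<le> n"
  moreover have "ac_unif ^ n = (ac_unif ^ m * ac_unif ^ (n - m) :: 'p padic_closure)"
    using \<open>m \<le> n\<close> by (simp only: power_add[symmetric] le_add_diff_inverse)
  ultimately show "\<exists>w\<in>L. x - y = ac_unif ^ m * w"
    by (intro bexI[of _ "ac_unif ^ (n - m) * z"]) (simp_all only: mult.assoc mult_closed power_closed of_nat_closed)
qed

lemma ocong_add: "ocong n x y \<Longrightarrow> ocong n x' y' \<Longrightarrow> ocong n (x + x') (y + y')"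
  unfolding ocong_def
proof (elim bexE)
  fix u v assume "u \<in> L" "v \<in> L" "x - y = ac_unif ^ n * u" "x' - y' = ac_unif ^ n * v"
  then show "\<exists>w\<in>L. x + x' - (y + y') = ac_unif ^ n * w"
    by (intro bexI[of _ "u + v"]) (auto simp: algebra_simps)
qed

lemma ocong_sum: "(\<And>a. a \<in> A \<Longrightarrow> ocong n (g a) (h a)) \<Longrightarrow> ocong n (sum g A) (sum h A)"
  by (induction A rule: infinite_finite_induct) (auto intro: ocong_add)

lemma ocong_mult_left: "c \<in> L \<Longrightarrow> ocong n x y \<Longrightarrow> ocong n (c * x) (c * y)"
  unfolding ocong_def
proof (elim bexE)
  fix z assume "c \<in> L" "z \<in> L" "x - y = ac_unif ^ n * z"
  then show "\<exists>w\<in>L. c * x - c * y = ac_unif ^ n * w"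
    by (intro bexI[of _ "c * z"]) (auto simp: mult_ac simp flip: right_diff_distrib)
qed

lemma ocong_mult:
  assumes "x' \<in> L" "y \<in> L" "ocong n x y" "ocong n x' y'"
  shows "ocong n (x * x') (y * y')"
proof -
  have "ocong n (x' * x) (x' * y)" using assms by (intro ocong_mult_left)
  also have "x' * y = y * x'" by simp
  also have "ocong n (y * x') (y * y')" using assms by (intro ocong_mult_left)
  finally show ?thesis by (simp add: mult.commute)
qed

lemma ocong_power:
  assumes "x \<in> L" "y \<in> L" "ocong n x y"
  shows "ocong n (x ^ k) (y ^ k)"
  by (induction k) (use assms in \<open>auto intro!: ocong_mult\<close>)

lemma ocong_unif: "z \<in> L \<Longrightarrow> ocong 1 (x + ac_unif * z) x"
  unfolding ocong_def by (intro bexI[of _ z]) auto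

lemma rep_in [simp]: "x \<in> L \<Longrightarrow> (\<Sum>b\<in>B. padic_emb (Zp.representation B x b) * b) = x"
  using Zp.sum_representation_eq[OF independent_basis _ finite_basis order_refl] by (simp add: span_basis)

lemma rep_unif:
  assumes "z \<in> L"
  shows "Zp.representation B (ac_unif ^ n * z) b = padic_unif ^ n * Zp.representation B z b"
proof -
  have "ac_unif ^ n * z = padic_emb (padic_unif ^ n) * z" by (simp del: padic_emb_of_nat add: padic_emb_of_nat[of "CARD('p)"])
  then show ?thesis
    using Zp.representation_scale[OF independent_basis, of z "padic_unif ^ n"] assms by (simp add: span_basis)
qed

lemma rep_diff:
  assumes "x \<in> L" "y \<in> L"
  shows "Zp.representation B (x - y) b = Zp.representation B x b - Zp.representation B y b"
  using Zp.representation_diff[OF independent_basis, of y x] assms by (simp add: span_basis)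

text \<open>Through the basis, congruence in \<open>L\<close> is congruence of coordinates;
  separation, completeness and the finiteness of \<open>L / p L\<close> are all inherited this
  way.\<close>

lemma ocong_rep:
  assumes "x \<in> L" "y \<in> L"
  shows "ocong n x y \<longleftrightarrow> (\<forall>b\<in>B. padic_unif ^ n dvd Zp.representation B x b - Zp.representation B y b)"
proof
  assume "ocong n x y"
  then obtain z where z: "z \<in> L" "x - y = ac_unif ^ n * z" unfolding ocong_def by blast
  then show "\<forall>b\<in>B. padic_unif ^ n dvd Zp.representation B x b - Zp.representation B y b"
    using rep_diff[OF assms] rep_unif[OF z(1), of n] by (metis dvd_triv_left)
next
  assume "\<forall>b\<in>B. padic_unif ^ n dvd Zp.representation B x b - Zp.representation B y b"
  then have "\<forall>b\<in>B. \<exists>c. Zp.representation B x b - Zp.representation B y b = padic_unif ^ n * c"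
    by (simp add: dvd_def)
  from bchoice[OF this] obtain c
    where c: "\<forall>b\<in>B. Zp.representation B x b - Zp.representation B y b = padic_unif ^ n * c b" ..
  have "x - y = (\<Sum>b\<in>B. padic_emb (Zp.representation B (x - y) b) * b)" using assms by simp
  also have "\<dots> = (\<Sum>b\<in>B. ac_unif ^ n * (padic_emb (c b) * b))"
    using c by (intro sum.cong refl) (simp add: rep_diff[OF assms] mult.assoc del: padic_emb_simps(6))
  also have "\<dots> = ac_unif ^ n * (\<Sum>b\<in>B. padic_emb (c b) * b)" by (simp add: sum_distrib_left)
  finally have "x - y = ac_unif ^ n * (\<Sum>b\<in>B. padic_emb (c b) * b)" .
  moreover have "(\<Sum>b\<in>B. padic_emb (c b) * b) \<in> L"
    unfolding span_basis by (intro Zp.span_sum Zp.span_scale Zp.span_base)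
  ultimately show "ocong n x y" unfolding ocong_def by (rule bexI)
qed

lemma ocong_all_imp_eq:
  assumes "x \<in> L" "y \<in> L" "\<And>n. ocong n x y"
  shows "x = y"
proof -
  have "Zp.representation B x b = Zp.representation B y b" if "b \<in> B" for b
    using padic_separated[of "Zp.representation B x b - Zp.representation B y b"] assms that
    by (simp add: ocong_rep)
  then have "(\<Sum>b\<in>B. padic_emb (Zp.representation B x b) * b) = (\<Sum>b\<in>B. padic_emb (Zp.representation B y b) * b)"
    by simp
  then show ?thesis using assms by simp
qed

lemma order_complete:
  assumes s: "\<And>n. s n \<in> L" and "\<And>n. ocong n (s (Suc n)) (s n)"
  obtains l where "l \<in> L" "\<And>n. ocong n l (s n)"
proof -
  have "\<forall>b\<in>B. \<exists>l. \<forall>n. padic_unif ^ n dvd l - Zp.representation B (s n) b"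
    using assms by (intro ballI padic_complete) (auto simp: ocong_rep)
  from bchoice[OF this] obtain l where l: "\<forall>b\<in>B. \<forall>n. padic_unif ^ n dvd l b - Zp.representation B (s n) b" ..
  define x where "x = (\<Sum>b\<in>B. padic_emb (l b) * b)"
  have x: "x \<in> L" unfolding x_def span_basis by (intro Zp.span_sum Zp.span_scale Zp.span_base)
  have rep: "Zp.representation B x b = l b" if "b \<in> B" for b
  proof -
    have "(\<Sum>b\<in>B. padic_emb (Zp.representation B x b - l b) * b) = 0"
      using x by (simp add: left_diff_distrib sum_subtractf x_def)
    from Zp.independentD[OF independent_basis finite_basis order_refl this that] show ?thesis by simp
  qed
  show ?thesis using that[OF x] x s l rep by (simp add: ocong_rep)
qed

lemma freshman:
  assumes "x \<in> L" "y \<in> L"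
  shows "ocong 1 ((x + y) ^ CARD('p)) (x ^ CARD('p) + y ^ CARD('p))"
proof -
  let ?p = "CARD('p)"
  define c where "c k = (of_nat ((?p choose k) div ?p) * x ^ k * y ^ (?p - k) :: 'p padic_closure)" for k
  have p: "?p > 0" using prime_gt_0_nat[OF prime_CARD[where 'p='p]] by simp
  have "(x + y) ^ ?p = (\<Sum>k\<le>?p. of_nat (?p choose k) * x ^ k * y ^ (?p - k))" by (rule binomial_ring)
  also have "{..?p} = insert 0 (insert ?p {0<..<?p})" using p by auto
  also have "(\<Sum>k\<in>insert 0 (insert ?p {0<..<?p}). of_nat (?p choose k) * x ^ k * y ^ (?p - k)) =
      y ^ ?p + (x ^ ?p + (\<Sum>k\<in>{0<..<?p}. of_nat (?p choose k) * x ^ k * y ^ (?p - k)))"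
    using p by (simp add: sum.insert)
  also have "(\<Sum>k\<in>{0<..<?p}. of_nat (?p choose k) * x ^ k * y ^ (?p - k)) = (\<Sum>k\<in>{0<..<?p}. ac_unif * c k)"
  proof (intro sum.cong refl)
    fix k assume "k \<in> {0<..<?p}"
    then have "?p dvd (?p choose k)" by (intro dvd_choose_prime prime_CARD) auto
    then have "(?p choose k) = ?p * ((?p choose k) div ?p)" by simp
    then have "(of_nat (?p choose k) :: 'p padic_closure) = ac_unif * of_nat ((?p choose k) div ?p)"
      by (metis of_nat_mult)
    then show "of_nat (?p choose k) * x ^ k * y ^ (?p - k) = ac_unif * c k"
      by (simp add: c_def mult.assoc)
  qed
  also have "\<dots> = ac_unif * sum c {0<..<?p}" by (simp add: sum_distrib_left)
  finally have "(x + y) ^ ?p = x ^ ?p + y ^ ?p + ac_unif * sum c {0<..<?p}" by (simp add: add_ac)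
  moreover have "sum c {0<..<?p} \<in> L" by (rule sum_closed) (simp add: c_def assms)
  ultimately show ?thesis by (simp add: ocong_unif del: One_nat_def)
qed

lemma freshman_iter:
  assumes "x \<in> L" "y \<in> L"
  shows "ocong 1 ((x + y) ^ CARD('p) ^ e) (x ^ CARD('p) ^ e + y ^ CARD('p) ^ e)"
proof (induction e)
  case (Suc e)
  have "ocong 1 (((x + y) ^ CARD('p) ^ e) ^ CARD('p)) ((x ^ CARD('p) ^ e + y ^ CARD('p) ^ e) ^ CARD('p))"
    by (rule ocong_power) (use assms Suc in auto)
  also have "ocong 1 ((x ^ CARD('p) ^ e + y ^ CARD('p) ^ e) ^ CARD('p)) ((x ^ CARD('p) ^ e) ^ CARD('p) + (y ^ CARD('p) ^ e) ^ CARD('p))"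
    by (rule freshman) (use assms in auto)
  finally show ?case by (simp add: power_mult[symmetric] mult.commute)
qed simp

lemma freshman_sum:
  assumes "\<And>a. a \<in> A \<Longrightarrow> g a \<in> L"
  shows "ocong 1 ((sum g A) ^ CARD('p) ^ e) (\<Sum>a\<in>A. g a ^ CARD('p) ^ e)"
  using assms
proof (induction A rule: infinite_finite_induct)
  case (insert a A)
  have "ocong 1 ((g a + sum g A) ^ CARD('p) ^ e) (g a ^ CARD('p) ^ e + (sum g A) ^ CARD('p) ^ e)"
    using insert by (intro freshman_iter sum_closed) auto
  also have "ocong 1 \<dots> (g a ^ CARD('p) ^ e + (\<Sum>a\<in>A. g a ^ CARD('p) ^ e))"
    using insert by (intro ocong_add) auto
  finally show ?case using insert by simp
qed (auto simp: prime_gt_0_nat[OF prime_CARD] power_0_left)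

lemma emb_fermat: "ocong 1 (padic_emb c ^ CARD('p) ^ e) (padic_emb c)"
proof (induction e)
  case (Suc e)
  obtain d where "c ^ CARD('p) - c = padic_unif * d" using padic_fermat[of c] by (auto simp: dvd_def)
  then have "padic_emb (c ^ CARD('p) - c) = ac_unif * padic_emb d"
    by (metis padic_emb_of_nat padic_emb_simps(4))
  then have "ocong 1 (padic_emb c ^ CARD('p)) (padic_emb c)"
    unfolding ocong_def by (intro bexI[of _ "padic_emb d"]) auto
  moreover have "ocong 1 ((padic_emb c ^ CARD('p) ^ e) ^ CARD('p)) (padic_emb c ^ CARD('p))"
    by (rule ocong_power) (use Suc in auto)
  ultimately have "ocong 1 ((padic_emb c ^ CARD('p) ^ e) ^ CARD('p)) (padic_emb c)"
    using ocong_trans by blast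
  then show ?case by (simp add: power_mult[symmetric] mult.commute)
qed simp

text \<open>The cofactor of \<open>x - y\<close> in \<open>x ^ p - y ^ p\<close> is congruent to
  \<open>p y ^ (p - 1)\<close>, hence to \<open>0\<close>, modulo \<open>p\<close>; this gains one
  power of \<open>p\<close>.\<close>

lemma ocong_power_p:
  assumes xy: "x \<in> L" "y \<in> L" and n: "n \<ge> 1" "ocong n x y"
  shows "ocong (Suc n) (x ^ CARD('p)) (y ^ CARD('p))"
proof -
  let ?p = "CARD('p)"
  obtain z where z: "z \<in> L" "x - y = ac_unif ^ n * z" using n(2) unfolding ocong_def by blast
  have "ocong 1 (\<Sum>i<?p. y ^ (?p - Suc i) * x ^ i) (\<Sum>i<?p. y ^ (?p - Suc i) * y ^ i)"
    using xy ocong_mono[OF n(2,1)] by (intro ocong_sum ocong_mult_left ocong_power) auto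
  also have "(\<Sum>i<?p. y ^ (?p - Suc i) * y ^ i) = 0 + ac_unif * y ^ (?p - 1)"
    by (simp add: power_add[symmetric])
  also have "ocong 1 \<dots> 0" using xy by (intro ocong_unif) auto
  finally obtain w where w: "w \<in> L" "(\<Sum>i<?p. y ^ (?p - Suc i) * x ^ i) = ac_unif * w"
    unfolding ocong_def by auto
  have "x ^ ?p - y ^ ?p = (x - y) * (\<Sum>i<?p. y ^ (?p - Suc i) * x ^ i)"
    by (rule power_diff_sumr2)
  also have "\<dots> = ac_unif ^ Suc n * (z * w)" unfolding z(2) w(2) by (simp add: mult_ac)
  finally show ?thesis unfolding ocong_def by (rule bexI) (use z w in simp)
qed

lemma ocong_power_p_iter:
  assumes xy: "x \<in> L" "y \<in> L" and n: "n \<ge> 1" "ocong n x y"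
  shows "ocong (n + e) (x ^ CARD('p) ^ e) (y ^ CARD('p) ^ e)"
proof (induction e)
  case (Suc e)
  have "ocong (Suc (n + e)) ((x ^ CARD('p) ^ e) ^ CARD('p)) ((y ^ CARD('p) ^ e) ^ CARD('p))"
    by (rule ocong_power_p) (use Suc xy n in auto)
  then show ?case by (simp add: power_mult[symmetric] mult.commute)
qed (use n in simp)

text \<open>With \<open>r = p ^ e\<close>, the sequence \<open>x ^ (r ^ n)\<close> converges,
  because raising to the power \<open>r\<close> improves a congruence by \<open>e\<close> powers of
  \<open>p\<close>. The limit is fixed by this power map and has not moved modulo
  \<open>p\<close>.\<close>

lemma teichmueller_lift:
  assumes x: "x \<in> L" and e: "e \<ge> 1" and "ocong 1 (x ^ CARD('p) ^ e) x"
  obtains y where "y \<in> L" "y ^ CARD('p) ^ e = y" "ocong 1 y x"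
proof -
  let ?r = "CARD('p) ^ e"
  define s where "s n = x ^ ?r ^ n" for n
  have sL: "s n \<in> L" for n using x by (simp add: s_def)
  have sSuc: "s (Suc n) = s n ^ ?r" for n by (simp add: s_def power_mult[symmetric] mult.commute)
  have step: "ocong (Suc n) (s (Suc n)) (s n)" for n
  proof (induction n)
    case 0
    then show ?case using assms(3) by (simp add: s_def)
  next
    case (Suc n)
    have "ocong (Suc n + e) (s (Suc n) ^ ?r) (s n ^ ?r)"
      by (rule ocong_power_p_iter) (use Suc sL in auto)
    then have "ocong (Suc n + e) (s (Suc (Suc n))) (s (Suc n))" by (simp only: sSuc)
    then show ?case by (rule ocong_mono) (use e in simp)
  qed
  have "ocong n (s (Suc n)) (s n)" for n by (rule ocong_mono[OF step]) simp
  from order_complete[OF sL this] obtain l where l: "l \<in> L" "\<And>n. ocong n l (s n)" by blast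
  have "l ^ ?r = l"
  proof (rule ocong_all_imp_eq)
    fix n
    have "ocong n (l ^ ?r) (s n ^ ?r)" by (rule ocong_power) (use l sL in auto)
    also have "ocong n (s n ^ ?r) l"
      unfolding sSuc[symmetric] by (rule ocong_sym, rule ocong_mono[OF l(2)]) simp
    finally show "ocong n (l ^ ?r) l" .
  qed (use l in auto)
  moreover have "ocong 1 l x"
  proof -
    have "ocong 1 l (s 1)" by (rule l(2))
    also have "ocong 1 (s 1) x" using assms(3) by (simp add: s_def)
    finally show ?thesis .
  qed
  ultimately show ?thesis using that l by blast
qed

text \<open>The geometric series in \<open>p z\<close> converges in \<open>L\<close>.\<close>

lemma one_minus_unif_unit:
  assumes z: "z \<in> L"
  obtains w where "w \<in> L" "w * (1 - ac_unif * z) = 1"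
proof -
  define s where "s n = (\<Sum>i<n. (ac_unif * z) ^ i)" for n
  have sL: "s n \<in> L" for n unfolding s_def by (rule sum_closed) (use z in auto)
  have "ocong n (s (Suc n)) (s n)" for n
    unfolding ocong_def s_def by (intro bexI[of _ "z ^ n"]) (use z in \<open>auto simp: power_mult_distrib\<close>)
  from order_complete[OF sL this] obtain l where l: "l \<in> L" "\<And>n. ocong n l (s n)" by blast
  have "l * (1 - ac_unif * z) = 1"
  proof (rule ocong_all_imp_eq)
    fix n
    have "ocong n ((1 - ac_unif * z) * l) ((1 - ac_unif * z) * s n)"
      by (rule ocong_mult_left) (use l z in auto)
    also have "(1 - ac_unif * z) * s n = 1 - (ac_unif * z) ^ n"
      unfolding s_def by (simp add: one_diff_power_eq)
    also have "ocong n \<dots> 1"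
      unfolding ocong_def by (intro bexI[of _ "- (z ^ n)"]) (use z in \<open>auto simp: power_mult_distrib\<close>)
    finally show "ocong n (l * (1 - ac_unif * z)) 1" by (simp add: mult.commute)
  qed (use l z in auto)
  then show ?thesis using that l by blast
qed

definition residue_vec :: "'p padic_closure \<Rightarrow> 'p padic_closure \<Rightarrow> nat" where
  "residue_vec x = (\<lambda>b\<in>B. nat (Rep_padic_int (Zp.representation B x b) 1))"

lemma residue_vec_range: "residue_vec x \<in> B \<rightarrow>\<^sub>E {..<CARD('p)}"
  unfolding residue_vec_def using padic_residue(2) by (auto simp del: One_nat_def)

lemma residue_vec_eq_iff:
  assumes "x \<in> L" "y \<in> L"
  shows "residue_vec x = residue_vec y \<longleftrightarrow> ocong 1 x y"
proof -
  have "ocong 1 x y \<longleftrightarrow> (\<forall>b\<in>B. Rep_padic_int (Zp.representation B x b) 1 = Rep_padic_int (Zp.representation B y b) 1)"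
    unfolding ocong_rep[OF assms] padic_unif_power_dvd_diff_iff ..
  also have "\<dots> \<longleftrightarrow> (\<forall>b\<in>B. nat (Rep_padic_int (Zp.representation B x b) 1) = nat (Rep_padic_int (Zp.representation B y b) 1))"
    by (simp only: eq_nat_nat_iff[OF Rep_padic_range(1) Rep_padic_range(1)])
  also have "\<dots> \<longleftrightarrow> residue_vec x = residue_vec y"
    unfolding residue_vec_def by (auto simp: fun_eq_iff restrict_def)
  finally show ?thesis ..
qed

lemma residue_vec_surj:
  assumes "f \<in> B \<rightarrow>\<^sub>E {..<CARD('p)}"
  obtains x where "x \<in> L" "residue_vec x = f"
proof -
  define x where "x = (\<Sum>b\<in>B. padic_emb (of_nat (f b)) * b)"
  have x: "x \<in> L" unfolding x_def span_basis by (intro Zp.span_sum Zp.span_scale Zp.span_base)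
  have rep: "Zp.representation B x b = of_nat (f b)" if "b \<in> B" for b
  proof -
    have "(\<Sum>b\<in>B. padic_emb (Zp.representation B x b - of_nat (f b)) * b) = 0"
      using x by (simp add: left_diff_distrib sum_subtractf x_def)
    from Zp.independentD[OF independent_basis finite_basis order_refl this that] show ?thesis by simp
  qed
  have "residue_vec x = f"
  proof
    fix b show "residue_vec x b = f b"
      using assms by (cases "b \<in> B") (auto simp: residue_vec_def rep Rep_padic_of_nat PiE_iff extensional_def)
  qed
  then show ?thesis using that x by blast
qed

lemma card_residue_system:
  assumes "R \<subseteq> L" and inj: "\<And>x y. x \<in> R \<Longrightarrow> y \<in> R \<Longrightarrow> ocong 1 x y \<Longrightarrow> x = y"
    and surj: "\<And>x. x \<in> L \<Longrightarrow> \<exists>y\<in>R. ocong 1 x y"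
  shows "card R = CARD('p) ^ card B"
proof -
  have "bij_betw residue_vec R (B \<rightarrow>\<^sub>E {..<CARD('p)})"
    unfolding bij_betw_def
  proof
    show "inj_on residue_vec R"
      using assms(1) inj residue_vec_eq_iff by (intro inj_onI) blast
    show "residue_vec ` R = (B \<rightarrow>\<^sub>E {..<CARD('p)})"
    proof
      show "residue_vec ` R \<subseteq> (B \<rightarrow>\<^sub>E {..<CARD('p)})" using residue_vec_range by blast
      show "(B \<rightarrow>\<^sub>E {..<CARD('p)}) \<subseteq> residue_vec ` R"
      proof
        fix f assume "f \<in> B \<rightarrow>\<^sub>E {..<CARD('p)}"
        then obtain x where x: "x \<in> L" "residue_vec x = f" using residue_vec_surj by blast
        then obtain y where y: "y \<in> R" "ocong 1 x y" using surj by blast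
        then have "residue_vec y = f" using x residue_vec_eq_iff[of x y] assms(1) by auto
        then show "f \<in> residue_vec ` R" using y by blast
      qed
    qed
  qed
  then have "card R = card (B \<rightarrow>\<^sub>E {..<CARD('p)})" by (rule bij_betw_same_card)
  also have "\<dots> = CARD('p) ^ card B" using finite_basis by (simp add: card_PiE)
  finally show ?thesis .
qed

text \<open>\<open>L / p L\<close> is finite, so the powers of \<open>x\<close> become periodic
  modulo \<open>p\<close> and some \<open>g = x ^ e\<close> is idempotent there. It lifts to
  \<open>y\<close> with \<open>y ^ p = y\<close>. In a field either \<open>y = 0\<close>, which
  makes \<open>x\<close> nilpotent modulo \<open>p\<close>, or \<open>y ^ (p - 1) = 1\<close>, which
  makes a power of \<open>x\<close> congruent to \<open>1\<close> and so a unit.\<close>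

lemma unit_or_nilpotent:
  assumes x: "x \<in> L"
  shows "(\<exists>e\<ge>1. ocong 1 (x ^ e) 0) \<or> (x \<noteq> 0 \<and> inverse x \<in> L)"
proof -
  have "\<not> inj (\<lambda>i::nat. residue_vec (x ^ i))"
  proof
    assume "inj (\<lambda>i::nat. residue_vec (x ^ i))"
    moreover have "range (\<lambda>i::nat. residue_vec (x ^ i)) \<subseteq> B \<rightarrow>\<^sub>E {..<CARD('p)}" using residue_vec_range by blast
    moreover have "finite (B \<rightarrow>\<^sub>E {..<CARD('p)})" using finite_basis by (intro finite_PiE) auto
    ultimately have "finite (UNIV :: nat set)" using finite_imageD finite_subset by blast
    then show False by simp
  qed
  then obtain i j where "i \<noteq> j" "residue_vec (x ^ i) = residue_vec (x ^ j)" by (auto simp: inj_def)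
  then have "\<exists>i j. i < j \<and> residue_vec (x ^ i) = residue_vec (x ^ j)"
    by (metis nat_neq_iff)
  then obtain i j where "i < j" "residue_vec (x ^ i) = residue_vec (x ^ j)" by blast
  then have ij: "i < j" "ocong 1 (x ^ i) (x ^ j)"
    using residue_vec_eq_iff[of "x ^ i" "x ^ j"] x by auto
  define l where "l = j - i"
  have l: "l \<ge> 1" "j = i + l" using ij by (auto simp: l_def)
  have per: "ocong 1 (x ^ k) (x ^ (k + l * t))" if "k \<ge> i" for k t
  proof (induction t)
    case (Suc t)
    have "ocong 1 (x ^ (k - i + l * t) * x ^ i) (x ^ (k - i + l * t) * x ^ j)"
      by (rule ocong_mult_left) (use x ij in auto)
    then have "ocong 1 (x ^ (k + l * t)) (x ^ (k + l * Suc t))"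
      using that by (simp add: power_add[symmetric] l(2) add_ac)
    then show ?case using Suc ocong_trans by blast
  qed simp
  \<comment> \<open>A multiple of the period \<open>l\<close> that is not below the preperiod
    \<open>i\<close>, so that \<open>x ^ e\<close> and \<open>x ^ (2 e)\<close> agree modulo
    \<open>p\<close>.\<close>
  define e where "e = l * (i + 1)"
  have e: "e \<ge> 1" "e \<ge> i" using l(1) mult_le_mono1[OF l(1), of "i + 1"] by (auto simp: e_def)
  define g where "g = x ^ e"
  have gL: "g \<in> L" using x by (simp add: g_def)
  have gg: "ocong 1 g (g * g)"
    using per[OF e(2), of "i + 1"] by (simp add: g_def power_add[symmetric] e_def)
  have gn: "ocong 1 (g ^ Suc n) g" for n
  proof (induction n)
    case (Suc n)
    have "ocong 1 (g * g ^ Suc n) (g * g)" by (rule ocong_mult_left) (use Suc gL in auto)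
    then show ?case using ocong_trans ocong_sym[OF gg] by auto
  qed simp
  have p: "CARD('p) = Suc (CARD('p) - 1)" using prime_gt_0_nat[OF prime_CARD[where 'p='p]] by simp
  have "ocong 1 (g ^ CARD('p) ^ 1) g" using gn[of "CARD('p) - 1"] p by simp
  from teichmueller_lift[OF gL order_refl this]
  obtain y where y: "y \<in> L" "y ^ CARD('p) = y" "ocong 1 y g" by auto
  show ?thesis
  proof (cases "y = 0")
    case True
    then have "ocong 1 (x ^ e) 0" using y(3) ocong_sym by (simp add: g_def)
    then show ?thesis using e by blast
  next
    case False
    let ?k = "CARD('p) - 1"
    have k: "?k \<ge> 1" using prime_gt_1_nat[OF prime_CARD[where 'p='p]] by simp
    have "y * y ^ ?k = y * 1" using y(2) p by (metis mult.right_neutral power_Suc)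
    then have "y ^ ?k = 1" using False by simp
    moreover have "ocong 1 (y ^ ?k) (g ^ ?k)" by (rule ocong_power) (use y gL in auto)
    ultimately obtain z where z: "z \<in> L" "1 - g ^ ?k = ac_unif * z" unfolding ocong_def by auto
    obtain w where w: "w \<in> L" "w * (1 - ac_unif * z) = 1" using one_minus_unif_unit[OF z(1)] by blast
    have "1 - ac_unif * z = x ^ (e * ?k)" using z(2) by (simp add: g_def power_mult[symmetric] algebra_simps)
    also have "\<dots> = x * x ^ (e * ?k - 1)" using e k by (simp flip: power_Suc)
    finally have "x * (w * x ^ (e * ?k - 1)) = 1" using w by (simp add: mult_ac)
    then have "x \<noteq> 0" "inverse x = w * x ^ (e * ?k - 1)" by (auto intro: inverse_unique)
    then show ?thesis using w x by simp
  qed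
qed

end

section \<open>Integral elements and residue fields\<close>

definition padic_integral :: "'p::prime_card padic_closure \<Rightarrow> bool" where
  "padic_integral x \<longleftrightarrow> (\<exists>P. Polynomial.lead_coeff P = 1 \<and> Polynomial.poly (Polynomial.map_poly padic_emb P) x = 0)"

lemma ring_of_integers_eq: "ring_of_integers K = {x \<in> K. padic_integral x}"
  unfolding ring_of_integers_def padic_integral_def padic_emb_def[abs_def] ..

lemma comm_ring_hom_padic_emb: "comm_ring_hom (padic_emb :: 'p::prime_card padic_int \<Rightarrow> _)"
  by unfold_locales auto

lemma Zp_span_mult:
  assumes "\<And>s. s \<in> S \<Longrightarrow> a * s \<in> Zp.span S" "t \<in> Zp.span S"
  shows "a * t \<in> Zp.span S"
proof -
  have "Zp.subspace {t. a * t \<in> Zp.span S}"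
    by (rule Zp.subspaceI)
      (auto simp: distrib_left mult.left_commute[of a] intro: Zp.span_zero Zp.span_add Zp.span_scale)
  then have "Zp.span S \<subseteq> {t. a * t \<in> Zp.span S}"
    by (rule Zp.span_minimal[rotated]) (use assms(1) in auto)
  then show ?thesis using assms(2) by blast
qed

text \<open>The determinant trick: the generators are the entries of an eigenvector for the
  eigenvalue \<open>x\<close> of a matrix over the \<open>p\<close>-adic integers, and its
  characteristic polynomial is monic. The element \<open>s0\<close> makes the vector
  nonzero.\<close>

lemma finitely_generated_imp_integral:
  fixes x :: "'p::prime_card padic_closure"
  assumes S: "finite S" "s0 \<in> S" "s0 \<noteq> 0" and stable: "\<And>s. s \<in> S \<Longrightarrow> x * s \<in> Zp.span S"
  shows "padic_integral x"
proof -
  define n where "n = card S"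
  obtain h where h: "bij_betw h {0..<n} S" using ex_bij_betw_nat_finite[OF S(1)] unfolding n_def by blast
  have "\<forall>s\<in>S. \<exists>c. x * s = (\<Sum>t\<in>S. padic_emb (c t) * t)"
    using stable unfolding Zp.span_finite[OF S(1)] by blast
  from bchoice[OF this] obtain c where c: "\<forall>s\<in>S. x * s = (\<Sum>t\<in>S. padic_emb (c s t) * t)" ..
  define A where "A = Matrix.mat n n (\<lambda>(i, j). c (h i) (h j))"
  have A: "A \<in> carrier_mat n n" by (simp add: A_def)
  let ?A = "map_mat padic_emb A"
  have A': "?A \<in> carrier_mat n n" using A by simp
  define v where "v = Matrix.vec n h"
  have hS: "h i \<in> S" if "i < n" for i using h that by (auto simp: bij_betw_def)
  have "eigenvector ?A v x"
    unfolding eigenvector_def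
  proof (intro conjI)
    show "v \<in> carrier_vec (dim_row ?A)" using A by (simp add: v_def)
    obtain i where i: "i < n" "h i = s0" using h S(2) by (auto simp: bij_betw_def)
    show "v \<noteq> 0\<^sub>v (dim_row ?A)"
    proof
      assume "v = 0\<^sub>v (dim_row ?A)"
      then have "vec_index v i = vec_index (0\<^sub>v n) i" using A by simp
      then show False using i S(3) by (simp add: v_def)
    qed
    show "?A *\<^sub>v v = x \<cdot>\<^sub>v v"
    proof (rule eq_vecI)
      fix i assume "i < dim_vec (x \<cdot>\<^sub>v v)"
      then have i: "i < n" by (simp add: v_def)
      have "vec_index (?A *\<^sub>v v) i = (\<Sum>j = 0..<n. padic_emb (c (h i) (h j)) * h j)"
        using i A by (simp add: scalar_prod_def A_def v_def)
      also have "\<dots> = (\<Sum>t\<in>S. padic_emb (c (h i) t) * t)"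
        using sum.reindex_bij_betw[OF h, of "\<lambda>t. padic_emb (c (h i) t) * t"] .
      also have "\<dots> = x * h i" using c hS[OF i] by simp
      finally show "vec_index (?A *\<^sub>v v) i = vec_index (x \<cdot>\<^sub>v v) i" using i by (simp add: v_def)
    qed (use A in \<open>simp add: v_def\<close>)
  qed
  then have "Polynomial.poly (char_poly ?A) x = 0"
    using eigenvalue_root_char_poly[OF A', of x] unfolding eigenvalue_def by blast
  then have "Polynomial.poly (Polynomial.map_poly padic_emb (char_poly A)) x = 0"
    by (simp add: comm_ring_hom.char_poly_hom[OF comm_ring_hom_padic_emb A])
  moreover have "Polynomial.lead_coeff (char_poly A) = 1"
    using degree_monic_char_poly[OF A] by simp
  ultimately show ?thesis unfolding padic_integral_def by blast
qed

lemma (in padic_order) order_integral: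
  assumes "x \<in> L"
  shows "padic_integral x"
proof -
  have "\<exists>s0\<in>B. s0 \<noteq> 0"
  proof (rule ccontr)
    assume "\<not> (\<exists>s0\<in>B. s0 \<noteq> 0)"
    then have "B \<subseteq> {0}" by blast
    then have "L \<subseteq> Zp.span {0}" unfolding span_basis by (rule Zp.span_mono)
    from subsetD[OF this one_closed] show False unfolding Zp.span_singleton by auto
  qed
  then obtain s0 where "s0 \<in> B" "s0 \<noteq> 0" by blast
  then show ?thesis
  proof (rule finitely_generated_imp_integral[OF finite_basis])
    fix s assume "s \<in> B"
    then have "s \<in> L" unfolding span_basis by (rule Zp.span_base)
    then show "x * s \<in> Zp.span B" using assms mult_closed unfolding span_basis by blast
  qed
qed

lemma integral_power_expansion:
  fixes x :: "'p::prime_card padic_closure"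
  assumes "padic_integral x"
  obtains n c where "n \<ge> 1" "x ^ n = (\<Sum>i<n. padic_emb (c i) * x ^ i)"
proof -
  obtain P :: "'p padic_int Polynomial.poly" where P: "Polynomial.lead_coeff P = 1" "Polynomial.poly (Polynomial.map_poly padic_emb P) x = 0"
    using assms unfolding padic_integral_def by blast
  let ?n = "Polynomial.degree P"
  have deg: "Polynomial.degree (Polynomial.map_poly padic_emb P) = ?n"
    using P(1) by (intro Polynomial.map_poly_degree_eq) simp
  have "0 = (\<Sum>i\<le>?n. padic_emb (Polynomial.coeff P i) * x ^ i)"
    using P(2) unfolding Polynomial.poly_altdef deg by (simp add: Polynomial.coeff_map_poly)
  also have "\<dots> = (\<Sum>i<?n. padic_emb (Polynomial.coeff P i) * x ^ i) + x ^ ?n"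
    using P(1) by (simp add: lessThan_Suc_atMost[symmetric])
  finally have eq: "x ^ ?n = (\<Sum>i<?n. padic_emb (- Polynomial.coeff P i) * x ^ i)"
    by (simp add: sum_negf eq_neg_iff_add_eq_0 add.commute)
  have "?n \<ge> 1"
  proof (rule ccontr)
    assume "\<not> ?n \<ge> 1"
    then have "?n = 0" by simp
    then show False using eq by simp
  qed
  then show ?thesis by (rule that[OF _ eq])
qed

text \<open>The monomials \<open>x ^ i * y ^ j\<close> below the degrees of two monic equations span
  a ring. The last clause keeps all that is constructed in it, limits in particular, inside every
  intermediate field that contains \<open>x\<close> and \<open>y\<close>.\<close>

lemma integral_order:
  fixes x y :: "'p::prime_card padic_closure"
  assumes "padic_integral x" "padic_integral y"
  obtains L B where "padic_order L B" "x \<in> L" "y \<in> L"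
    "\<forall>K. intermediate_field K \<longrightarrow> x \<in> K \<longrightarrow> y \<in> K \<longrightarrow> L \<subseteq> K"
proof -
  obtain m c where m: "m \<ge> 1" "x ^ m = (\<Sum>i<m. padic_emb (c i) * x ^ i)" by (rule integral_power_expansion[OF assms(1)])
  obtain n d where n: "n \<ge> 1" "y ^ n = (\<Sum>i<n. padic_emb (d i) * y ^ i)" by (rule integral_power_expansion[OF assms(2)])
  define S where "S = (\<lambda>(i, j). x ^ i * y ^ j) ` ({..<m} \<times> {..<n})"
  have fin: "finite S" by (simp add: S_def)
  have base: "x ^ i * y ^ j \<in> Zp.span S" if "i < m" "j < n" for i j
    by (rule Zp.span_base) (use that in \<open>auto simp: S_def\<close>)
  have x1: "x * s \<in> Zp.span S" if "s \<in> S" for s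
  proof -
    obtain i j where ij: "i < m" "j < n" "s = x ^ i * y ^ j" using \<open>s \<in> S\<close> by (auto simp: S_def)
    show ?thesis
    proof (cases "Suc i < m")
      case True
      then show ?thesis using base[OF True ij(2)] by (simp add: ij(3) mult.assoc)
    next
      case False
      then have "x * s = x ^ m * y ^ j" using ij by (simp add: mult.assoc[symmetric] power_Suc[symmetric] le_antisym del: power_Suc) (metis Suc_lessI power_Suc)
      also have "\<dots> = (\<Sum>i<m. padic_emb (c i) * (x ^ i * y ^ j))"
        unfolding m(2) by (simp add: sum_distrib_right mult.assoc)
      also have "\<dots> \<in> Zp.span S" by (intro Zp.span_sum Zp.span_scale base) (use ij in auto)
      finally show ?thesis .
    qed
  qed
  have y1: "y * s \<in> Zp.span S" if "s \<in> S" for s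
  proof -
    obtain i j where ij: "i < m" "j < n" "s = x ^ i * y ^ j" using \<open>s \<in> S\<close> by (auto simp: S_def)
    show ?thesis
    proof (cases "Suc j < n")
      case True
      then show ?thesis using base[OF ij(1) True] by (simp add: ij(3) mult_ac)
    next
      case False
      then have "n = Suc j" using ij by simp
      then have "y * s = x ^ i * y ^ n" using ij by (simp add: mult_ac)
      also have "\<dots> = (\<Sum>j<n. padic_emb (d j) * (x ^ i * y ^ j))"
        unfolding n(2) by (simp add: sum_distrib_left mult_ac)
      also have "\<dots> \<in> Zp.span S" by (intro Zp.span_sum Zp.span_scale base) (use ij in auto)
      finally show ?thesis .
    qed
  qed
  have xp: "x ^ i * t \<in> Zp.span S" if "t \<in> Zp.span S" for i t
    by (induction i) (use that Zp_span_mult[of S x] x1 in \<open>auto simp: mult.assoc\<close>)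
  have yp: "y ^ i * t \<in> Zp.span S" if "t \<in> Zp.span S" for i t
    by (induction i) (use that Zp_span_mult[of S y] y1 in \<open>auto simp: mult.assoc\<close>)
  have S1: "t * s \<in> Zp.span S" if "s \<in> S" "t \<in> Zp.span S" for s t
    using that xp yp by (auto simp: S_def mult.commute[of t] mult.assoc)
  have S2: "t * u \<in> Zp.span S" if "u \<in> Zp.span S" "t \<in> Zp.span S" for u t
    by (rule Zp_span_mult[OF S1]) (use that in auto)
  have one: "1 \<in> Zp.span S" using base[of 0 0] m(1) n(1) by simp
  obtain B where B: "B \<subseteq> S" "Zp.independent B" "Zp.span B = Zp.span S"
    by (rule Zp_independent_subset[OF fin])
  have "padic_order (Zp.span S) B"
    by standard (use B fin finite_subset one S2 in auto)
  moreover have "x \<in> Zp.span S" "y \<in> Zp.span S" using xp[OF one, of 1] yp[OF one, of 1] by simp_all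
  moreover have "Zp.span S \<subseteq> K" if K: "intermediate_field K" "x \<in> K" "y \<in> K" for K
  proof (rule Zp.span_minimal)
    have emb: "padic_emb z \<in> K" for z using K(1) unfolding intermediate_field_def padic_emb_def by blast
    have mult: "u * v \<in> K" if "u \<in> K" "v \<in> K" for u v using K(1) that unfolding intermediate_field_def by blast
    have add: "u + v \<in> K" if "u \<in> K" "v \<in> K" for u v using K(1) that unfolding intermediate_field_def by blast
    have pow: "u ^ k \<in> K" if "u \<in> K" for u k
      using emb[of 1] mult that by (induction k) auto
    show "S \<subseteq> K" using mult pow K by (auto simp: S_def)
    show "Zp.subspace K" by (rule Zp.subspaceI) (use emb[of 0] add mult emb in auto)
  qed
  ultimately show ?thesis using that by blast
qed

lemma padic_integral_1: "padic_integral 1"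
  unfolding padic_integral_def by (intro exI[of _ "[:-1, 1:]"]) (simp add: Polynomial.map_poly_pCons)

lemma padic_integral_arith:
  assumes "padic_integral x" "padic_integral y"
  shows "padic_integral (x + y)" "padic_integral (x * y)" "padic_integral (x - y)"
proof -
  obtain L B where L: "padic_order L B" "x \<in> L" "y \<in> L" by (rule integral_order[OF assms])
  interpret padic_order L B by (rule L(1))
  show "padic_integral (x + y)" "padic_integral (x * y)" "padic_integral (x - y)"
    using L by (simp_all add: order_integral)
qed

lemma padic_integral_emb: "padic_integral (padic_emb c)"
  unfolding padic_integral_def by (intro exI[of _ "[:-c, 1:]"]) (simp add: Polynomial.map_poly_pCons)

text \<open>In an order that contains \<open>1 / p\<close>, the element \<open>1\<close> would be
  divisible by every power of \<open>p\<close>, against separation.\<close>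

lemma not_integral_inverse_unif: "\<not> padic_integral (inverse ac_unif :: 'p::prime_card padic_closure)"
proof
  assume i: "padic_integral (inverse ac_unif :: 'p padic_closure)"
  obtain L B where L: "padic_order L B" "inverse (ac_unif :: 'p padic_closure) \<in> L" by (rule integral_order[OF i i])
  interpret padic_order L B by (rule L(1))
  have "ocong n 1 0" for n
    unfolding ocong_def
    by (intro bexI[of _ "inverse ac_unif ^ n"] power_closed L) (simp add: power_inverse)
  then show False using ocong_all_imp_eq[of 1 0] by simp
qed

section \<open>The ring of integers of an intermediate field and its residue field\<close>

locale padic_field =
  fixes K :: "'p::prime_card padic_closure set"
  assumes intermediate: "intermediate_field K"
begin

abbreviation "R \<equiv> ring_of_integers K"
abbreviation "M \<equiv> maximal_ideal K"

lemma K_closed [simp]: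
  "x \<in> K \<Longrightarrow> y \<in> K \<Longrightarrow> x + y \<in> K" "x \<in> K \<Longrightarrow> y \<in> K \<Longrightarrow> x * y \<in> K" "x \<in> K \<Longrightarrow> - x \<in> K"
  "x \<in> K \<Longrightarrow> inverse x \<in> K" "to_ac c \<in> K"
  using intermediate unfolding intermediate_field_def by blast+

lemma K_diff [simp]: "x \<in> K \<Longrightarrow> y \<in> K \<Longrightarrow> x - y \<in> K"
  using K_closed(1)[of x "- y"] by simp

lemma K_one [simp]: "1 \<in> K" using K_closed(5)[of 1] by simp

lemma K_emb [simp]: "padic_emb c \<in> K" by (simp add: padic_emb_def)

lemma R_closed [simp]:
  "x \<in> R \<Longrightarrow> y \<in> R \<Longrightarrow> x + y \<in> R" "x \<in> R \<Longrightarrow> y \<in> R \<Longrightarrow> x * y \<in> R"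
  "x \<in> R \<Longrightarrow> y \<in> R \<Longrightarrow> x - y \<in> R" "1 \<in> R" "padic_emb c \<in> R"
  by (simp_all add: ring_of_integers_eq padic_integral_arith padic_integral_1 padic_integral_emb)

lemma R_of_nat [simp]: "of_nat n \<in> R" using R_closed(5)[of "of_nat n"] by simp

lemma R_zero [simp]: "0 \<in> R" using R_of_nat[of 0] by simp

lemma R_power [simp]: "x \<in> R \<Longrightarrow> x ^ n \<in> R" by (induction n) auto

lemma R_sum: "(\<And>a. a \<in> A \<Longrightarrow> g a \<in> R) \<Longrightarrow> sum g A \<in> R"
  by (induction A rule: infinite_finite_induct) auto

lemma R_prod: "(\<And>a. a \<in> A \<Longrightarrow> g a \<in> R) \<Longrightarrow> prod g A \<in> R"
  by (induction A rule: infinite_finite_induct) auto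

text \<open>\<open>R\<close> itself is not known to be finitely generated, so completeness is always
  applied in an order around the elements at hand.\<close>

lemma order_in_R:
  assumes "x \<in> R" "y \<in> R"
  obtains L B where "padic_order L B" "x \<in> L" "y \<in> L" "L \<subseteq> R"
proof -
  have xy: "x \<in> K" "padic_integral x" "y \<in> K" "padic_integral y" using assms by (auto simp: ring_of_integers_eq)
  obtain L B where L: "padic_order L B" "x \<in> L" "y \<in> L"
    and sub: "\<forall>K. intermediate_field K \<longrightarrow> x \<in> K \<longrightarrow> y \<in> K \<longrightarrow> L \<subseteq> K"
    by (rule integral_order[OF xy(2,4)])
  have "L \<subseteq> K" using sub intermediate xy(1,3) by blast
  then have "L \<subseteq> R" using padic_order.order_integral[OF L(1)] by (auto simp: ring_of_integers_eq)
  then show ?thesis using that L by blast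
qed

text \<open>A nonunit of an order is nilpotent modulo \<open>p\<close>; conversely, an invertible
  \<open>x\<close> with \<open>x ^ e\<close> divisible by \<open>p\<close> would make
  \<open>1 / p\<close> integral. This description stands in for a valuation when \<open>M\<close> is
  shown to be an ideal.\<close>

lemma maximal_ideal_iff: "x \<in> M \<longleftrightarrow> x \<in> R \<and> (\<exists>e\<ge>1. \<exists>z\<in>R. x ^ e = ac_unif * z)"
proof
  assume "x \<in> M"
  then have x: "x \<in> R" "x = 0 \<or> inverse x \<notin> R" by (auto simp: maximal_ideal_def)
  obtain L B where L: "padic_order L B" "x \<in> L" "x \<in> L" "L \<subseteq> R" by (rule order_in_R[OF x(1) x(1)])
  interpret padic_order L B by (rule L(1))
  from unit_or_nilpotent[OF L(2)] x(2) L(4) consider "x = 0" | "\<exists>e\<ge>1. ocong 1 (x ^ e) 0" by blast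
  then have "\<exists>e\<ge>1. \<exists>z\<in>R. x ^ e = ac_unif * z"
  proof cases
    case 1
    then show ?thesis by (intro exI[of _ 1] conjI bexI[of _ 0]) auto
  next
    case 2
    then show ?thesis using L(4) unfolding ocong_def by auto
  qed
  then show "x \<in> R \<and> (\<exists>e\<ge>1. \<exists>z\<in>R. x ^ e = ac_unif * z)" using x(1) by blast
next
  assume "x \<in> R \<and> (\<exists>e\<ge>1. \<exists>z\<in>R. x ^ e = ac_unif * z)"
  then obtain e z where x: "x \<in> R" "z \<in> R" "x ^ e = ac_unif * z" by blast
  have "x = 0" if "inverse x \<in> R"
  proof (rule ccontr)
    assume "x \<noteq> 0"
    then have "x ^ e * inverse x ^ e = 1" by (simp add: power_inverse)
    then have "ac_unif * (z * inverse x ^ e) = 1" unfolding x(3) by (simp add: mult.assoc)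
    then have "inverse ac_unif = z * inverse x ^ e" by (rule inverse_unique)
    also have "\<dots> \<in> R" using x that by simp
    finally show False using not_integral_inverse_unif[where 'p = 'p] by (simp add: ring_of_integers_eq)
  qed
  then show "x \<in> M" using x(1) by (auto simp: maximal_ideal_def)
qed

lemma M_one [simp]: "1 \<notin> M" by (simp add: maximal_ideal_def)

lemma M_unif: "z \<in> R \<Longrightarrow> ac_unif * z \<in> M"
  unfolding maximal_ideal_iff by (auto intro!: exI[of _ 1])

lemma M_zero [simp]: "0 \<in> M" using M_unif[of 0] by simp

lemma M_mult: "x \<in> M \<Longrightarrow> r \<in> R \<Longrightarrow> r * x \<in> M"
proof -
  assume "x \<in> M" and r: "r \<in> R"
  then obtain e z where x: "x \<in> R" "e \<ge> 1" "z \<in> R" "x ^ e = ac_unif * z" unfolding maximal_ideal_iff by blast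
  then have "(r * x) ^ e = ac_unif * (r ^ e * z)" by (simp add: power_mult_distrib mult_ac)
  then show ?thesis unfolding maximal_ideal_iff using x r by (auto intro!: exI[of _ e])
qed

lemma M_add:
  assumes "x \<in> M" "y \<in> M"
  shows "x + y \<in> M"
proof -
  obtain e z where x: "x \<in> R" "e \<ge> 1" "z \<in> R" "x ^ e = ac_unif * z"
    using assms(1) unfolding maximal_ideal_iff by blast
  obtain f w where y: "y \<in> R" "f \<ge> 1" "w \<in> R" "y ^ f = ac_unif * w"
    using assms(2) unfolding maximal_ideal_iff by blast
  \<comment> \<open>The \<open>k\<close>-th term in the expansion of
    \<open>(x + y) ^ (e + f)\<close>, divided by \<open>p\<close>: every term contains
    \<open>x ^ e\<close> or \<open>y ^ f\<close>.\<close>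
  define c where "c k = (if k \<ge> e then of_nat (e + f choose k) * (z * x ^ (k - e)) * y ^ (e + f - k)
    else of_nat (e + f choose k) * x ^ k * (w * y ^ (e - k)))" for k
  have c: "c k \<in> R" for k using x y by (simp add: c_def)
  have "of_nat (e + f choose k) * x ^ k * y ^ (e + f - k) = ac_unif * c k" for k
  proof (cases "k \<ge> e")
    case True
    then have "x ^ k = ac_unif * (z * x ^ (k - e))"
      using x(4) by (metis le_add_diff_inverse mult.assoc power_add)
    then show ?thesis using True by (simp add: c_def mult_ac)
  next
    case False
    then have "e + f - k = f + (e - k)" by simp
    then have "y ^ (e + f - k) = y ^ f * y ^ (e - k)" by (simp only: power_add)
    then show ?thesis using False y(4) by (simp add: c_def mult_ac)
  qed
  then have "(x + y) ^ (e + f) = ac_unif * (\<Sum>k\<le>e + f. c k)"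
    by (simp add: binomial_ring sum_distrib_left)
  moreover have "(\<Sum>k\<le>e + f. c k) \<in> R" by (rule R_sum) (rule c)
  ultimately show ?thesis unfolding maximal_ideal_iff using x y
    by (intro conjI exI[of _ "e + f"] bexI[of _ "\<Sum>k\<le>e + f. c k"]) auto
qed

lemma M_minus: "x \<in> M \<Longrightarrow> - x \<in> M"
  using M_mult[of x "- 1"] R_closed(3)[OF R_zero R_closed(4)] by simp

lemma M_diff: "x \<in> M \<Longrightarrow> y \<in> M \<Longrightarrow> x - y \<in> M"
  using M_add[of x "- y"] M_minus by simp

lemma M_prime:
  assumes "x \<in> R" "y \<in> R" "x * y \<in> M"
  shows "x \<in> M \<or> y \<in> M"
proof (rule ccontr)
  assume "\<not> (x \<in> M \<or> y \<in> M)"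
  then have "x \<noteq> 0" "y \<noteq> 0" "inverse x \<in> R" "inverse y \<in> R" using assms by (auto simp: maximal_ideal_def)
  moreover have "inverse (x * y) = inverse x * inverse y" by simp
  ultimately have "inverse (x * y) \<in> R" "x * y \<noteq> 0" by (simp_all del: inverse_mult_distrib)
  then show False using assms(3) by (simp add: maximal_ideal_def del: inverse_mult_distrib)
qed

lemma M_prime_prod:
  assumes "finite A" "\<And>a. a \<in> A \<Longrightarrow> g a \<in> R" "prod g A \<in> M"
  shows "\<exists>a\<in>A. g a \<in> M"
  using assms
proof (induction A rule: finite_induct)
  case (insert a A)
  then show ?case using M_prime[of "g a" "prod g A"] R_prod[of A g] by auto
qed simp

lemma M_prod_cong:
  assumes "\<And>a. a \<in> A \<Longrightarrow> g a \<in> R" "\<And>a. a \<in> A \<Longrightarrow> h a \<in> R" "\<And>a. a \<in> A \<Longrightarrow> g a - h a \<in> M"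
  shows "prod g A - prod h A \<in> M"
  using assms
proof (induction A rule: infinite_finite_induct)
  case (insert a A)
  have "g a * (prod g A - prod h A) + prod h A * (g a - h a) \<in> M"
    using insert by (intro M_add M_mult R_prod) auto
  also have "g a * (prod g A - prod h A) + prod h A * (g a - h a) = prod g (insert a A) - prod h (insert a A)"
    using insert by (simp add: algebra_simps)
  finally show ?case .
qed auto

lemma M_power_cong: "x \<in> R \<Longrightarrow> y \<in> R \<Longrightarrow> x - y \<in> M \<Longrightarrow> x ^ n - y ^ n \<in> M"
  using M_prod_cong[of "{..<n}" "\<lambda>_. x" "\<lambda>_. y"] by simp

definition residue_rel :: "('p padic_closure \<times> 'p padic_closure) set" where
  "residue_rel = {(x, y). x \<in> R \<and> y \<in> R \<and> x - y \<in> M}"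

lemma equiv_residue_rel: "equiv R residue_rel"
proof (rule equivI)
  show "residue_rel \<subseteq> R \<times> R" by (auto simp: residue_rel_def)
  show "refl_on R residue_rel" by (auto simp: refl_on_def residue_rel_def)
  show "sym residue_rel" using M_minus by (auto simp: sym_def residue_rel_def) (metis minus_diff_eq)
  show "trans residue_rel"
  proof (rule transI)
    fix x y z assume "(x, y) \<in> residue_rel" "(y, z) \<in> residue_rel"
    then show "(x, z) \<in> residue_rel"
      using M_add[of "x - y" "y - z"] by (auto simp: residue_rel_def)
  qed
qed

lemma residue_field_eq: "residue_field K = R // residue_rel"
  unfolding residue_field_def residue_rel_def ..

lemma card_residue_field:
  assumes "T \<subseteq> R" "\<And>x y. x \<in> T \<Longrightarrow> y \<in> T \<Longrightarrow> x - y \<in> M \<Longrightarrow> x = y"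
    "\<And>x. x \<in> R \<Longrightarrow> \<exists>y\<in>T. x - y \<in> M"
  shows "card (residue_field K) = card T"
proof -
  have "bij_betw (\<lambda>x. residue_rel `` {x}) T (residue_field K)"
    unfolding bij_betw_def
  proof
    show "inj_on (\<lambda>x. residue_rel `` {x}) T"
    proof (rule inj_onI)
      fix x y assume xy: "x \<in> T" "y \<in> T" "residue_rel `` {x} = residue_rel `` {y}"
      then have "(x, y) \<in> residue_rel" using eq_equiv_class[OF xy(3) equiv_residue_rel] assms(1) by blast
      then show "x = y" using assms(2) xy by (simp add: residue_rel_def)
    qed
    show "(\<lambda>x. residue_rel `` {x}) ` T = residue_field K"
    proof
      show "(\<lambda>x. residue_rel `` {x}) ` T \<subseteq> residue_field K"
        using assms(1) by (auto simp: residue_field_eq intro: quotientI)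
      show "residue_field K \<subseteq> (\<lambda>x. residue_rel `` {x}) ` T"
      proof
        fix C assume "C \<in> residue_field K"
        then obtain x where x: "x \<in> R" "C = residue_rel `` {x}" unfolding residue_field_eq by (rule quotientE)
        then obtain y where y: "y \<in> T" "x - y \<in> M" using assms(3) by blast
        then have "(x, y) \<in> residue_rel" using x assms(1) by (auto simp: residue_rel_def)
        then have "C = residue_rel `` {y}" using x equiv_class_eq[OF equiv_residue_rel] by blast
        then show "C \<in> (\<lambda>x. residue_rel `` {x}) ` T" using y by blast
      qed
    qed
  qed
  then show ?thesis by (rule bij_betw_same_card[symmetric])
qed

lemma residue_system:
  obtains T where "T \<subseteq> R" "\<And>x y. x \<in> T \<Longrightarrow> y \<in> T \<Longrightarrow> x - y \<in> M \<Longrightarrow> x = y"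
    "\<And>x. x \<in> R \<Longrightarrow> \<exists>y\<in>T. x - y \<in> M"
proof -
  define rep where "rep C = (SOME x. x \<in> C)" for C :: "'p padic_closure set"
  have rep: "rep C \<in> C" if "C \<in> R // residue_rel" for C
    unfolding rep_def using in_quotient_imp_non_empty[OF equiv_residue_rel that] by (simp add: some_in_eq)
  have repR: "rep C \<in> R" if "C \<in> R // residue_rel" for C
    using rep[OF that] in_quotient_imp_subset[OF equiv_residue_rel that] by blast
  show ?thesis
  proof (rule that[of "rep ` (R // residue_rel)"])
    show "rep ` (R // residue_rel) \<subseteq> R" using repR by blast
    fix x y assume "x \<in> rep ` (R // residue_rel)" "y \<in> rep ` (R // residue_rel)" "x - y \<in> M"
    then obtain C D where CD: "C \<in> R // residue_rel" "D \<in> R // residue_rel" "x = rep C" "y = rep D" by blast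
    have "(x, y) \<in> residue_rel" using \<open>x - y \<in> M\<close> CD repR by (auto simp: residue_rel_def)
    then have "C = D" using quotient_eqI[OF equiv_residue_rel CD(1,2) rep[OF CD(1)] rep[OF CD(2)]] CD by blast
    then show "x = y" using CD by simp
  next
    fix x assume x: "x \<in> R"
    let ?C = "residue_rel `` {x}"
    have C: "?C \<in> R // residue_rel" using x by (rule quotientI)
    have "x - rep ?C \<in> M" using rep[OF C] by (auto simp: residue_rel_def)
    then show "\<exists>y\<in>rep ` (R // residue_rel). x - y \<in> M" using C by blast
  qed
qed

text \<open>Multiplication by \<open>x\<close> permutes the nonzero residue classes, and comparing
  the products of their representatives gives \<open>x ^ (r - 1) = 1\<close> modulo
  \<open>M\<close>.\<close>

lemma residue_fermat:
  assumes r: "card (residue_field K) = r" "r > 0" and x: "x \<in> R"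
  shows "x ^ r - x \<in> M"
proof (cases "x \<in> M")
  case True
  have "x ^ (r - 1) * x - x \<in> M" using True x by (intro M_diff M_mult) auto
  then show ?thesis using r(2) by (simp flip: power_Suc2)
next
  case False
  obtain T where T: "T \<subseteq> R" "\<And>x y. x \<in> T \<Longrightarrow> y \<in> T \<Longrightarrow> x - y \<in> M \<Longrightarrow> x = y"
    "\<And>x. x \<in> R \<Longrightarrow> \<exists>y\<in>T. x - y \<in> M" using residue_system by blast
  have cT: "card T = r" using card_residue_field[OF T] r(1) by simp
  then have fT: "finite T" using r(2) by (metis card.infinite less_irrefl)
  obtain t0 where t0: "t0 \<in> T" "0 - t0 \<in> M" using T(3)[OF R_zero] by blast
  have t0M: "t0 \<in> M" using M_minus[OF t0(2)] by simp
  define Q where "Q = T - {t0}"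
  have Q: "finite Q" "card Q = r - 1" "Q \<subseteq> R" using fT cT t0 T(1) by (auto simp: Q_def)
  have QM: "t \<notin> M" if "t \<in> Q" for t
    using that T(2)[of t t0] t0 M_diff[OF _ t0M, of t] by (auto simp: Q_def)
  define f where "f t = (SOME s. s \<in> T \<and> x * t - s \<in> M)" for t
  have f: "f t \<in> T \<and> x * t - f t \<in> M" if "t \<in> Q" for t
  proof -
    have "x * t \<in> R" using x Q(3) that by auto
    from T(3)[OF this] have "\<exists>s. s \<in> T \<and> x * t - s \<in> M" by blast
    then show ?thesis unfolding f_def by (rule someI_ex)
  qed
  have fQ: "f t \<in> Q" if "t \<in> Q" for t
  proof -
    have "f t \<noteq> t0"
    proof
      assume "f t = t0"
      then have "x * t \<in> M" using f[OF that] M_add[of "x * t - t0" t0] t0M by simp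
      then show False using M_prime[of x t] x False QM[OF that] Q(3) that by blast
    qed
    then show ?thesis using f[OF that] by (simp add: Q_def)
  qed
  have "inj_on f Q"
  proof (rule inj_onI)
    fix s t assume st: "s \<in> Q" "t \<in> Q" "f s = f t"
    have "x * s - f s \<in> M" "x * t - f t \<in> M" using f st by blast+
    then have "(x * s - f s) - (x * t - f t) \<in> M" by (rule M_diff)
    then have "x * (s - t) \<in> M" using st(3) by (simp add: algebra_simps)
    moreover have "s - t \<in> R" using Q(3) st by (intro R_closed) blast+
    ultimately have "s - t \<in> M" using M_prime[of x "s - t"] x False by blast
    then show "s = t" using T(2) st by (simp add: Q_def)
  qed
  moreover have "f ` Q \<subseteq> Q" using fQ by blast
  ultimately have bij: "bij_betw f Q Q" using Q(1) by (simp add: bij_betw_def endo_inj_surj)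
  have "(\<Prod>t\<in>Q. x * t) - (\<Prod>t\<in>Q. f t) \<in> M"
    using x Q(3) f fQ by (intro M_prod_cong) auto
  then have "x ^ (r - 1) * (\<Prod>t\<in>Q. t) - (\<Prod>t\<in>Q. t) \<in> M"
    using Q(2) prod.reindex_bij_betw[OF bij, of "\<lambda>t. t"] by (simp add: prod.distrib)
  then have "(\<Prod>t\<in>Q. t) * (x ^ (r - 1) - 1) \<in> M" by (simp add: algebra_simps)
  moreover have "(\<Prod>t\<in>Q. t) \<in> R" "(\<Prod>t\<in>Q. t) \<notin> M"
    using Q M_prime_prod[of Q "\<lambda>t. t"] QM by (auto intro: R_prod)
  ultimately have "x ^ (r - 1) - 1 \<in> M" using M_prime[of "\<Prod>t\<in>Q. t" "x ^ (r - 1) - 1"] x by auto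
  then have "x * (x ^ (r - 1) - 1) \<in> M" using x by (rule M_mult)
  then show ?thesis using r(2) by (simp add: right_diff_distrib flip: power_Suc)
qed

end

lemma finite_fixed_power:
  assumes "r \<ge> 2"
  shows "finite {y :: 'a::idom. y ^ r = y}" "card {y :: 'a. y ^ r = y} \<le> r"
proof -
  let ?P = "Polynomial.monom 1 r - [:0, 1:] :: 'a Polynomial.poly"
  have "Polynomial.coeff ?P r = 1" using assms by (simp add: Polynomial.coeff_pCons split: nat.splits)
  then have P: "?P \<noteq> 0" by (metis Polynomial.coeff_0 zero_neq_one)
  have deg: "Polynomial.degree ?P \<le> r" using assms by (intro Polynomial.degree_diff_le) (auto simp: Polynomial.degree_monom_le)
  have eq: "{y :: 'a. y ^ r = y} = {y. Polynomial.poly ?P y = 0}" by (simp add: Polynomial.poly_monom)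
  show "finite {y :: 'a. y ^ r = y}" unfolding eq by (rule Polynomial.poly_roots_finite[OF P])
  show "card {y :: 'a. y ^ r = y} \<le> r" unfolding eq using Polynomial.card_poly_roots_bound[OF P] deg by simp
qed

text \<open>Every residue class contains a solution of \<open>y ^ r = y\<close>, where
  \<open>r = p ^ m\<close>. There are \<open>r\<close> classes and at most \<open>r\<close>
  solutions in the closure, so all solutions already lie in \<open>K\<close>.\<close>

lemma (in padic_field) residue_card_imp_roots:
  assumes m: "m \<ge> 1" and card: "card (residue_field K) = CARD('p) ^ m"
  shows "{y. y ^ CARD('p) ^ m = y} \<subseteq> K"
proof -
  let ?r = "CARD('p) ^ m"
  let ?T = "{y :: 'p padic_closure. y ^ ?r = y}"
  have p1: "CARD('p) > 1" by (rule prime_gt_1_nat[OF prime_CARD])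
  have "CARD('p) ^ 1 \<le> ?r" using p1 m by (intro power_increasing) auto
  then have r2: "?r \<ge> 2" using p1 by simp
  have fermat: "x ^ ?r - x \<in> M" if "x \<in> R" for x
    using residue_fermat[OF card _ that] r2 by simp
  have surj: "\<exists>y\<in>?T \<inter> R. x - y \<in> M" if x: "x \<in> R" for x
  proof -
    obtain e z where z: "e \<ge> 1" "z \<in> R" "(x ^ ?r - x) ^ e = ac_unif * z"
      using fermat[OF x] unfolding maximal_ideal_iff by blast
    obtain L B where L: "padic_order L B" "x \<in> L" "z \<in> L" "L \<subseteq> R" by (rule order_in_R[OF x z(2)])
    interpret padic_order L B by (rule L(1))
    \<comment> \<open>\<open>x ^ r - x\<close> is only known to be nilpotent modulo
      \<open>p\<close>. The exponent \<open>s\<close> is a power of \<open>p\<close> and at least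
      \<open>e\<close>, so raising to it kills this difference additively and \<open>x ^ s\<close>
      satisfies the congruence required for lifting.\<close>
    define s where "s = ?r ^ e"
    have s: "s = CARD('p) ^ (m * e)" by (simp add: s_def power_mult)
    have "e < 2 ^ e" by simp
    also have "2 ^ e \<le> s" unfolding s_def using r2 by (rule power_mono) simp
    finally have es: "e \<le> s" by simp
    define a where "a = x ^ s"
    have aL: "a \<in> L" using L by (simp add: a_def)
    have "(x ^ ?r - x) ^ s = ac_unif * (z * (x ^ ?r - x) ^ (s - e))"
      using es by (simp add: z(3)[symmetric] mult.assoc[symmetric] power_add[symmetric])
    then have 1: "ocong 1 ((x ^ ?r - x) ^ s) 0"
      unfolding ocong_def using L by (intro bexI[of _ "z * (x ^ ?r - x) ^ (s - e)"]) auto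
    have "ocong 1 (((x ^ ?r - x) + x) ^ s) ((x ^ ?r - x) ^ s + x ^ s)"
      unfolding s by (rule freshman_iter) (use L in auto)
    also have "ocong 1 \<dots> (0 + x ^ s)" by (rule ocong_add[OF 1]) simp
    finally have "ocong 1 (a ^ ?r) a" by (simp add: a_def power_mult[symmetric] mult.commute)
    from teichmueller_lift[OF aL m this] obtain y where y: "y \<in> L" "y ^ ?r = y" "ocong 1 y a" by blast
    have "y - a \<in> M" using y(3) L(4) M_unif unfolding ocong_def by auto
    moreover have "x ^ ?r ^ n - x \<in> M" for n
    proof (induction n)
      case (Suc n)
      have "(x ^ ?r ^ n) ^ ?r - x ^ ?r ^ n + (x ^ ?r ^ n - x) \<in> M"
        using Suc x by (intro M_add fermat) auto
      then show ?case by (simp add: power_mult[symmetric] mult.commute)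
    qed simp
    then have "a - x \<in> M" by (simp add: a_def s_def)
    ultimately have "- ((y - a) + (a - x)) \<in> M" by (intro M_minus M_add)
    then show ?thesis using y L(4) by (intro bexI[of _ y]) auto
  qed
  obtain T where T: "T \<subseteq> R" "\<And>x y. x \<in> T \<Longrightarrow> y \<in> T \<Longrightarrow> x - y \<in> M \<Longrightarrow> x = y"
    "\<And>x. x \<in> R \<Longrightarrow> \<exists>y\<in>T. x - y \<in> M" using residue_system by blast
  have cT: "card T = ?r" using card_residue_field[OF T] card by simp
  have "\<forall>t\<in>T. \<exists>y. y \<in> ?T \<inter> R \<and> t - y \<in> M" using surj T(1) by blast
  from bchoice[OF this] obtain g where g: "\<forall>t\<in>T. g t \<in> ?T \<inter> R \<and> t - g t \<in> M" ..
  have "inj_on g T"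
  proof (rule inj_onI)
    fix s t assume st: "s \<in> T" "t \<in> T" "g s = g t"
    have "s - g s \<in> M" "t - g t \<in> M" using g st by blast+
    then have "(s - g s) - (t - g t) \<in> M" by (rule M_diff)
    then show "s = t" using T(2) st by simp
  qed
  moreover have "g ` T \<subseteq> ?T \<inter> R" using g by blast
  moreover have "finite (?T \<inter> R)" using finite_fixed_power(1)[OF r2] by blast
  ultimately have "?r \<le> card (?T \<inter> R)" using card_inj_on_le[of g T "?T \<inter> R"] cT by simp
  moreover have "card (?T \<inter> R) \<le> card ?T" by (rule card_mono[OF finite_fixed_power(1)[OF r2]]) auto
  ultimately have "card (?T \<inter> R) = card ?T" using finite_fixed_power(2)[OF r2, where 'a = "'p padic_closure"] by simp
  then have "?T \<inter> R = ?T" by (intro card_subset_eq[OF finite_fixed_power(1)[OF r2]]) auto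
  then show ?thesis by (auto simp: ring_of_integers_eq)
qed

section \<open>Roots of unity and unramified extensions\<close>

text \<open>\<open>X ^ n - 1\<close> splits, and a double root would be a root of
  \<open>n X ^ (n - 1)\<close>.\<close>

lemma card_roots_of_unity:
  assumes "n \<ge> 1"
  shows "card {x :: 'a::{alg_closed_field, field_char_0}. x ^ n = 1} = n"
proof -
  let ?P = "Polynomial.monom 1 n - 1 :: 'a Polynomial.poly"
  have cn: "Polynomial.coeff ?P n = 1" using assms by (simp add: Polynomial.coeff_1)
  then have P0: "?P \<noteq> 0" by (metis Polynomial.coeff_0 zero_neq_one)
  have deg: "Polynomial.degree ?P = n"
  proof (rule antisym)
    show "Polynomial.degree ?P \<le> n" by (intro Polynomial.degree_diff_le) (auto simp: Polynomial.degree_monom_le)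
    show "n \<le> Polynomial.degree ?P" using cn by (intro Polynomial.le_degree) simp
  qed
  obtain A where A: "size A = n" "?P = Polynomial.smult (Polynomial.lead_coeff ?P) (\<Prod>x\<in>#A. [:-x, 1:])"
    using alg_closed_imp_factorization[OF P0] deg by auto
  have PA: "?P = (\<Prod>x\<in>#A. [:-x, 1:])" using A(2) unfolding deg cn by simp
  have roots: "set_mset A = {x. x ^ n = 1}"
  proof -
    have "x \<in># A \<longleftrightarrow> Polynomial.poly ?P x = 0" for x
      unfolding PA by (induction A) auto
    then show ?thesis by (auto simp: Polynomial.poly_monom)
  qed
  have "count A x \<le> 1" for x
  proof (rule ccontr)
    assume "\<not> count A x \<le> 1"
    then have x: "x \<in># A" "x \<in># A - {#x#}" by (auto simp: count_greater_zero_iff[symmetric] simp del: count_greater_zero_iff)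
    then obtain A' where "A = add_mset x (add_mset x A')" by (metis mset_add insert_DiffM)
    then have "?P = [:-x, 1:] * ([:-x, 1:] * (\<Prod>x\<in>#A'. [:-x, 1:]))" unfolding PA by simp
    then have "Polynomial.poly (Polynomial.pderiv ?P) x = 0"
      by (simp only: Polynomial.pderiv_mult) simp
    then have "of_nat n * x ^ (n - 1) = 0"
      by (simp add: Polynomial.pderiv_diff Polynomial.pderiv_monom Polynomial.poly_monom)
    moreover have "x ^ n = 1" using x(1) roots by blast
    ultimately show False using assms by (auto simp: power_0_left)
  qed
  then have "A = mset_set (set_mset A)"
    by (intro multiset_eqI) (metis One_nat_def count_greater_eq_one_iff count_mset_set(1) count_mset_set(3) finite_set_mset le_antisym not_in_iff)
  then have "card (set_mset A) = n" using A(1) by (metis size_mset_set)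
  then show ?thesis using roots by simp
qed

lemma power_gcd_eq_1:
  fixes w :: "'a::idom"
  assumes "w ^ a = 1" "w ^ b = 1"
  shows "w ^ gcd a b = 1"
proof (cases "a = 0")
  case False
  then obtain x y where "a * x = b * y + gcd a b" using bezout_nat by blast
  then have "w ^ (a * x) = w ^ (b * y) * w ^ gcd a b" by (simp add: power_add)
  then show ?thesis using assms by (simp add: power_mult)
qed (use assms in simp)

text \<open>A generator is the product of one element of exact order \<open>l ^ e\<close> for each prime power
  \<open>l ^ e\<close> exactly dividing \<open>N\<close>.\<close>

lemma primitive_root_of_unity:
  assumes N: "N \<ge> 1"
  obtains g :: "'a::{alg_closed_field, field_char_0}"
  where "g ^ N = 1" "inj_on (\<lambda>i. g ^ i) {..<N}" "{x. x ^ N = 1} = (\<lambda>i. g ^ i) ` {..<N}"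
proof -
  let ?\<mu> = "\<lambda>n. {x :: 'a. x ^ n = 1}"
  have fin: "finite (?\<mu> n)" if "n \<ge> 1" for n
    using card_roots_of_unity[OF that, where 'a = 'a] that by (metis card.infinite not_one_le_zero)
  \<comment> \<open>Otherwise the \<open>N\<close> solutions of \<open>x ^ N = 1\<close> would be
    among the fewer solutions of \<open>x ^ (N div l) = 1\<close>.\<close>
  have "\<exists>x. x ^ N = 1 \<and> x ^ (N div l) \<noteq> (1::'a)" if l: "l \<in> prime_factors N" for l
  proof (rule ccontr)
    assume "\<not> ?thesis"
    then have sub: "?\<mu> N \<subseteq> ?\<mu> (N div l)" by blast
    have l': "l dvd N" "l > 1" using l prime_gt_1_nat[OF in_prime_factors_imp_prime[OF l]] by auto
    have "N div l \<ge> 1" "N div l < N" using l' N by (auto simp: dvd_div_eq_0_iff Suc_le_eq dvd_imp_le)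
    then show False using card_mono[OF fin sub] card_roots_of_unity[where 'a = 'a] N by simp
  qed
  then have "\<forall>l\<in>prime_factors N. \<exists>x. x ^ N = 1 \<and> x ^ (N div l) \<noteq> (1::'a)" by blast
  from bchoice[OF this] obtain x where x: "\<forall>l\<in>prime_factors N. x l ^ N = 1 \<and> x l ^ (N div l) \<noteq> (1::'a)" ..
  define e where "e l = multiplicity l N" for l
  define y where "y l = x l ^ (N div l ^ e l)" for l
  define g where "g = (\<Prod>l\<in>prime_factors N. y l)"
  have dvd: "l ^ e l dvd N" for l by (simp add: e_def multiplicity_dvd)
  have y1: "y l ^ (l ^ e l) = 1" if "l \<in> prime_factors N" for l
    using x that dvd[of l] by (simp add: y_def power_mult[symmetric])
  have gN: "g ^ N = 1"
  proof -
    have "y l ^ N = 1" if "l \<in> prime_factors N" for l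
      using x that by (simp add: y_def power_mult[symmetric] mult.commute) (simp add: power_mult)
    then show ?thesis by (simp add: g_def prod_power_distrib)
  qed
  have gl: "g ^ (N div l) \<noteq> 1" if l: "l \<in> prime_factors N" for l
  proof
    assume g1: "g ^ (N div l) = 1"
    have pl: "Factorial_Ring.prime l" "l dvd N" using l by auto
    have other: "y k ^ (N div l) = 1" if k: "k \<in> prime_factors N - {l}" for k
    proof -
      have "coprime k l" using k pl by (intro primes_coprime) auto
      then have "coprime (k ^ e k) l" by simp
      moreover have "k ^ e k dvd l * (N div l)" using dvd[of k] pl by simp
      ultimately have "k ^ e k dvd N div l" by (simp add: coprime_dvd_mult_right_iff)
      then show ?thesis using y1[of k] k by (auto simp: dvd_def power_mult)
    qed
    have "g ^ (N div l) = y l ^ (N div l) * (\<Prod>k\<in>prime_factors N - {l}. y k ^ (N div l))"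
      unfolding g_def prod_power_distrib using l by (simp add: prod.remove)
    then have "y l ^ (N div l) = 1" using g1 other by simp
    \<comment> \<open>\<open>w\<close> is killed by \<open>l\<close> and by the part of
      \<open>N\<close> prime to \<open>l\<close>, two coprime exponents.\<close>
    moreover define w where "w = x l ^ (N div l)"
    moreover have "y l ^ (N div l) = w ^ (N div l ^ e l)"
      by (simp add: y_def w_def power_mult[symmetric] mult.commute)
    ultimately have "w ^ (N div l ^ e l) = 1" by simp
    moreover have "w ^ l = 1" using x l pl by (simp add: w_def power_mult[symmetric])
    ultimately have "w ^ gcd (N div l ^ e l) l = 1" by (rule power_gcd_eq_1)
    moreover have "coprime (N div l ^ e l) l"
    proof -
      have "\<not> l dvd N div l ^ e l"
        unfolding e_def using multiplicity_decompose[of N l] N prime_gt_1_nat[OF pl(1)] by auto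
      then show ?thesis using pl(1) by (simp add: prime_imp_coprime coprime_commute)
    qed
    ultimately have "w = 1" by simp
    then show False using x l by (simp add: w_def)
  qed
  have inj: "inj_on (\<lambda>i. g ^ i) {..<N}"
  proof (rule linorder_inj_onI)
    fix i j assume ij: "i < j" "i \<in> {..<N}" "j \<in> {..<N}"
    show "g ^ i \<noteq> g ^ j"
    proof
      assume eq: "g ^ i = g ^ j"
      define c where "c = gcd (j - i) N"
      have "i + (j - i) = j" using ij by simp
      then have "g ^ i * g ^ (j - i) = g ^ j" by (simp only: power_add[symmetric])
      then have "g ^ i * g ^ (j - i) = g ^ i * 1" by (simp only: eq mult_1_right)
      moreover have "g \<noteq> 0" using gN N by (auto simp: power_0_left)
      ultimately have "g ^ (j - i) = 1" by simp
      then have gc: "g ^ c = 1" unfolding c_def using gN by (rule power_gcd_eq_1)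
      have "c dvd N" by (simp add: c_def)
      have "c \<le> j - i" unfolding c_def using ij by (intro gcd_le1_nat) simp
      then have "c < N" using ij by simp
      have "c > 0" using N by (simp add: c_def)
      have "N div c * c = N" using \<open>c dvd N\<close> by simp
      then have "N div c \<noteq> 1" using \<open>c < N\<close> by auto
      then obtain l where l: "Factorial_Ring.prime l" "l dvd N div c" using prime_factor_nat by blast
      then have "l * c dvd N" using \<open>c dvd N\<close> \<open>c > 0\<close> by (simp add: dvd_div_iff_mult)
      then have "c dvd N div l" "l dvd N" using l(1) by (auto simp: dvd_div_iff_mult prime_gt_0_nat mult.commute dest: dvd_mult_left)
      then have "g ^ (N div l) = 1" using gc by (auto simp: dvd_def power_mult)
      then show False using gl[of l] l \<open>l dvd N\<close> N by (auto simp: prime_factors_dvd)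
    qed
  qed auto
  have "(\<lambda>i. g ^ i) ` {..<N} = ?\<mu> N"
  proof (rule card_subset_eq[OF fin[OF N]])
    show "(\<lambda>i. g ^ i) ` {..<N} \<subseteq> ?\<mu> N" using gN by (auto simp: power_commutes power_mult[symmetric] mult.commute[of _ N], simp add: power_mult)
    show "card ((\<lambda>i. g ^ i) ` {..<N}) = card (?\<mu> N)" using inj card_roots_of_unity[OF N, where 'a = 'a] by (simp add: card_image)
  qed
  then show ?thesis using that gN inj by simp
qed

section \<open>The field generated by the roots of unity of order p ^ m - 1\<close>

lemma Qp_span_mult:
  assumes "\<And>s. s \<in> S \<Longrightarrow> a * s \<in> Qp.span S" "t \<in> Qp.span S"
  shows "a * t \<in> Qp.span S"
proof -
  have "Qp.subspace {t. a * t \<in> Qp.span S}"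
  proof (rule Qp.subspaceI)
    fix c x assume "x \<in> {t. a * t \<in> Qp.span S}"
    then have "scale_padic c (a * x) \<in> Qp.span S" by (intro Qp.span_scale) simp
    then show "scale_padic c x \<in> {t. a * t \<in> Qp.span S}" by (simp add: scale_padic_def mult_ac)
  qed (auto simp: distrib_left intro: Qp.span_zero Qp.span_add)
  then have "Qp.span S \<subseteq> {t. a * t \<in> Qp.span S}"
    by (rule Qp.span_minimal[rotated]) (use assms(1) in auto)
  then show ?thesis using assms(2) by blast
qed

lemma Zp_span_subset_Qp_span: "Zp.span S \<subseteq> Qp.span S"
proof (rule Zp.span_minimal[OF Qp.span_superset])
  show "Zp.subspace (Qp.span S)"
  proof (rule Zp.subspaceI)
    fix c x assume "x \<in> Qp.span S"
    then have "scale_padic (Fract c 1) x \<in> Qp.span S" by (rule Qp.span_scale)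
    then show "padic_emb c * x \<in> Qp.span S" by (simp add: scale_padic_def padic_emb_def)
  qed (auto intro: Qp.span_zero Qp.span_add)
qed

text \<open>Together with \<open>0\<close>, these roots of unity are to represent a residue field
  with \<open>p ^ m\<close> elements; their span over the \<open>p\<close>-adic field is the
  candidate for the unramified extension.\<close>

locale unramified_roots =
  fixes m N :: nat and mu :: "'p::prime_card padic_closure set"
  assumes m: "m \<ge> 1" and N_def: "N = CARD('p) ^ m - 1" and mu_def: "mu = {x. x ^ N = 1}"
begin

lemma CARD_gt1: "CARD('p) > 1" by (rule prime_gt_1_nat[OF prime_CARD])

lemma r_ge2: "CARD('p) ^ m \<ge> 2"
proof -
  have "CARD('p) ^ 1 \<le> CARD('p) ^ m" using CARD_gt1 m by (intro power_increasing) auto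
  then show ?thesis using CARD_gt1 by simp
qed

lemma N: "N \<ge> 1" "CARD('p) ^ m = Suc N" using r_ge2 by (auto simp: N_def)

definition teich :: "'p padic_closure set" where "teich = {y. y ^ CARD('p) ^ m = y}"

lemma teich_eq: "teich = insert 0 mu"
proof -
  have "y ^ CARD('p) ^ m = y \<longleftrightarrow> y = 0 \<or> y ^ N = 1" for y :: "'p padic_closure"
  proof -
    have "y ^ CARD('p) ^ m = y \<longleftrightarrow> y * y ^ N = y * 1" by (simp add: N(2))
    then show ?thesis by (simp only: mult_cancel_left)
  qed
  then show ?thesis by (auto simp: teich_def mu_def)
qed

lemma card_mu: "card mu = N"
  unfolding mu_def by (rule card_roots_of_unity[OF N(1)])

lemma finite_mu [simp]: "finite mu"
  using card_mu N(1) by (metis card.infinite not_one_le_zero)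

lemma mu_nonzero: "x \<in> mu \<Longrightarrow> x \<noteq> 0"
  using N(1) by (auto simp: mu_def power_0_left)

lemma card_teich: "card teich = CARD('p) ^ m"
  unfolding teich_eq using mu_nonzero card_mu N(2) by (subst card_insert_disjoint) auto

lemma mu_one [simp]: "1 \<in> mu" by (simp add: mu_def)

lemma mu_mult [simp]: "x \<in> mu \<Longrightarrow> y \<in> mu \<Longrightarrow> x * y \<in> mu" by (simp add: mu_def power_mult_distrib)

lemma mu_inverse [simp]: "x \<in> mu \<Longrightarrow> inverse x \<in> mu" by (simp add: mu_def power_inverse)

lemma mu_power [simp]: "x \<in> mu \<Longrightarrow> x ^ n \<in> mu" by (induction n) auto

definition L0 :: "'p padic_closure set" where "L0 = Zp.span mu"
definition K0 :: "'p padic_closure set" where "K0 = Qp.span mu"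
definition B0 :: "'p padic_closure set" where
  "B0 = (SOME B. B \<subseteq> mu \<and> Zp.independent B \<and> Zp.span B = L0)"

lemma B0: "B0 \<subseteq> mu" "Zp.independent B0" "Zp.span B0 = L0"
proof -
  have "\<exists>B. B \<subseteq> mu \<and> Zp.independent B \<and> Zp.span B = L0"
    using Zp_independent_subset[OF finite_mu] unfolding L0_def by metis
  from someI_ex[OF this] show "B0 \<subseteq> mu" "Zp.independent B0" "Zp.span B0 = L0" unfolding B0_def by auto
qed

lemma mu_L0: "x \<in> mu \<Longrightarrow> x \<in> L0" unfolding L0_def by (rule Zp.span_base)

sublocale padic_order L0 B0
proof
  show "finite B0" using B0(1) finite_mu by (rule finite_subset)
  show "1 \<in> L0" by (rule mu_L0) simp
  fix x y assume x: "x \<in> L0" and y: "y \<in> L0"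
  have 1: "s * t \<in> Zp.span mu" if "s \<in> mu" "t \<in> Zp.span mu" for s t
    by (rule Zp_span_mult[OF _ that(2)]) (use that in \<open>auto intro: Zp.span_base\<close>)
  show "x * y \<in> L0"
    using y unfolding L0_def
    by (rule Zp_span_mult[rotated]) (use 1 x in \<open>auto simp: mult.commute[of x] L0_def\<close>)
qed (use B0 in auto)

text \<open>The generators are fixed by the power map, the coefficients obey Fermat's congruence,
  and raising to a power of \<open>p\<close> is additive modulo \<open>p\<close>.\<close>

lemma L0_frobenius:
  assumes "x \<in> L0"
  shows "ocong 1 (x ^ CARD('p) ^ m) x"
proof -
  let ?c = "\<lambda>b. padic_emb (Zp.representation B0 x b)"
  have BL: "b \<in> L0" "b ^ CARD('p) ^ m = b" if "b \<in> B0" for b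
    using that B0(1) mu_L0 teich_eq by (auto simp: teich_def)
  have "ocong 1 ((\<Sum>b\<in>B0. ?c b * b) ^ CARD('p) ^ m) (\<Sum>b\<in>B0. (?c b * b) ^ CARD('p) ^ m)"
    by (rule freshman_sum) (use BL in auto)
  also have "(\<Sum>b\<in>B0. (?c b * b) ^ CARD('p) ^ m) = (\<Sum>b\<in>B0. b * ?c b ^ CARD('p) ^ m)"
    using BL by (intro sum.cong refl) (simp add: power_mult_distrib mult.commute)
  also have "ocong 1 \<dots> (\<Sum>b\<in>B0. b * ?c b)"
    using BL by (intro ocong_sum ocong_mult_left emb_fermat) auto
  also have "(\<Sum>b\<in>B0. b * ?c b) = (\<Sum>b\<in>B0. ?c b * b)" by (simp add: mult.commute)
  finally show ?thesis using assms by simp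
qed

lemma L0_teich:
  assumes "x \<in> L0"
  obtains t where "t \<in> teich" "ocong 1 x t"
proof -
  obtain y where y: "y \<in> L0" "y ^ CARD('p) ^ m = y" "ocong 1 y x"
    by (rule teichmueller_lift[OF assms m L0_frobenius[OF assms]])
  show ?thesis by (rule that[of y]) (use y ocong_sym in \<open>auto simp: teich_def\<close>)
qed

lemma teich_L0: "t \<in> teich \<Longrightarrow> t \<in> L0"
  using teich_eq mu_L0 by auto

lemma ocong_1_0: "\<not> ocong 1 1 0"
proof
  assume "ocong 1 1 0"
  then obtain z where "z \<in> L0" "ac_unif * z = 1" unfolding ocong_def by auto
  then have "padic_integral (inverse ac_unif :: 'p padic_closure)"
    using inverse_unique order_integral by metis
  then show False using not_integral_inverse_unif by blast
qed

text \<open>Such an \<open>x\<close> is congruent to a root of unity, so none of its powers is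
  divisible by \<open>p\<close>, and the dichotomy for elements of an order makes it
  invertible.\<close>

lemma L0_unit:
  assumes "x \<in> L0" "\<not> ocong 1 x 0"
  shows "x \<noteq> 0" "inverse x \<in> L0"
proof -
  show "x \<noteq> 0" using assms(2) by auto
  obtain t where t: "t \<in> teich" "ocong 1 x t" by (rule L0_teich[OF assms(1)])
  have "t \<noteq> 0" using t(2) assms(2) by auto
  then have tmu: "t \<in> mu" using t(1) teich_eq by auto
  have "\<not> ocong 1 (x ^ e) 0" for e
  proof
    assume *: "ocong 1 (x ^ e) 0"
    have "ocong 1 (t ^ e) (x ^ e)" by (rule ocong_power) (use t teich_L0 ocong_sym assms in auto)
    also have "ocong 1 (x ^ e) 0" by (rule *)
    finally have "ocong 1 (inverse t ^ e * t ^ e) (inverse t ^ e * 0)"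
      by (intro ocong_mult_left power_closed mu_L0 mu_inverse tmu)
    then show False using ocong_1_0 \<open>t \<noteq> 0\<close> by (simp add: power_mult_distrib[symmetric])
  qed
  then show "inverse x \<in> L0" using unit_or_nilpotent[OF assms(1)] by blast
qed

text \<open>\<open>L0\<close> is a discrete valuation ring in which \<open>p\<close> itself is a
  uniformizer; this is where the extension shows itself to be unramified.\<close>

lemma L0_decomp:
  assumes "y \<in> L0" "y \<noteq> 0"
  obtains k u where "u \<in> L0" "u \<noteq> 0" "inverse u \<in> L0" "y = ac_unif ^ k * u" "\<not> ocong 1 u 0"
proof -
  obtain n where n: "\<not> ocong n y 0" using ocong_all_imp_eq[of y 0] assms by auto
  define k where "k = (GREATEST k. ocong k y 0)"
  have bound: "j \<le> n" if "ocong j y 0" for j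
    using that n ocong_mono nat_le_linear by blast
  have "ocong 0 y 0" unfolding ocong_def using assms by auto
  then have k: "ocong k y 0" unfolding k_def by (rule GreatestI_nat[of _ 0 n]) (use bound in auto)
  then obtain u where u: "u \<in> L0" "y = ac_unif ^ k * u" unfolding ocong_def by auto
  have "\<not> ocong 1 u 0"
  proof
    assume "ocong 1 u 0"
    then obtain z where "z \<in> L0" "u = ac_unif * z" unfolding ocong_def by auto
    then have "ocong (Suc k) y 0" using u unfolding ocong_def by (auto simp: mult_ac)
    then have "Suc k \<le> k" unfolding k_def by (rule Greatest_le_nat[of _ _ n]) (use bound in auto)
    then show False by simp
  qed
  then show ?thesis using that u L0_unit[OF u(1)] by blast
qed

lemma K0_scale: "x \<in> K0 \<Longrightarrow> to_ac c * x \<in> K0"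
  using Qp.span_scale[of x mu c] by (simp add: K0_def scale_padic_def)

lemma L0_K0: "x \<in> L0 \<Longrightarrow> x \<in> K0"
  using Zp_span_subset_Qp_span unfolding L0_def K0_def by blast

lemma K0_denominator:
  assumes "x \<in> K0"
  obtains n where "ac_unif ^ n * x \<in> L0"
proof -
  obtain c where c: "x = (\<Sum>s\<in>mu. scale_padic (c s) s)"
    using assms unfolding K0_def Qp.span_finite[OF finite_mu] by blast
  obtain d a where da: "d \<noteq> 0" "\<forall>s\<in>mu. Fract d 1 * c s = Fract (a s) 1"
    using padic_common_denominator[OF finite_mu] by blast
  have "padic_emb d * x = (\<Sum>s\<in>mu. padic_emb (a s) * s)"
    unfolding c sum_distrib_left
    by (intro sum.cong refl)
      (use da(2) in \<open>simp add: scale_padic_def padic_emb_def flip: mult.assoc to_ac_mult\<close>)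
  also have "\<dots> \<in> L0" unfolding L0_def by (intro Zp.span_sum Zp.span_scale Zp.span_base)
  finally have dx: "padic_emb d * x \<in> L0" .
  obtain n u where nu: "d = padic_unif ^ n * u" "u dvd 1" using padic_decomp[OF da(1)] by blast
  then obtain v where v: "u * v = 1" by (metis dvdE)
  have "padic_emb v * (padic_emb d * x) \<in> L0" by (rule scale_closed[OF dx])
  also have "padic_emb v * (padic_emb d * x) = padic_emb (v * d) * x" by (simp only: padic_emb_simps mult.assoc)
  also have "v * d = padic_unif ^ n" using v nu by (simp add: mult_ac)
  finally show ?thesis using that[of n] by (simp del: of_nat_power)
qed

lemma K0_decomp:
  assumes "x \<in> K0" "x \<noteq> 0"
  obtains n k u where "u \<in> L0" "u \<noteq> 0" "inverse u \<in> L0" "\<not> ocong 1 u 0" "ac_unif ^ n * x = ac_unif ^ k * u"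
proof -
  obtain n where n: "ac_unif ^ n * x \<in> L0" by (rule K0_denominator[OF assms(1)])
  moreover have "ac_unif ^ n * x \<noteq> 0" using assms(2) by simp
  ultimately obtain k u where "u \<in> L0" "u \<noteq> 0" "inverse u \<in> L0" "ac_unif ^ n * x = ac_unif ^ k * u" "\<not> ocong 1 u 0"
    by (rule L0_decomp)
  then show ?thesis using that by blast
qed

lemma intermediate_K0: "intermediate_field K0"
  unfolding intermediate_field_def
proof (intro conjI ballI subsetI)
  fix x :: "'p padic_closure" assume "x \<in> range to_ac"
  then show "x \<in> K0" using K0_scale[OF L0_K0[OF one_closed]] by auto
next
  fix x y assume xy: "x \<in> K0" "y \<in> K0"
  show "x + y \<in> K0" using xy unfolding K0_def by (rule Qp.span_add)
  have 1: "s * t \<in> Qp.span mu" if "s \<in> mu" "t \<in> Qp.span mu" for s t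
    by (rule Qp_span_mult[OF _ that(2)]) (use that in \<open>auto intro: Qp.span_base\<close>)
  show "x * y \<in> K0"
    using xy(2) unfolding K0_def
    by (rule Qp_span_mult[rotated]) (use 1 xy(1) in \<open>auto simp: mult.commute[of x] K0_def\<close>)
next
  fix x assume x: "x \<in> K0"
  show "- x \<in> K0" using x unfolding K0_def by (rule Qp.span_neg)
  show "inverse x \<in> K0"
  proof (cases "x = 0")
    case False
    obtain n k u where u: "u \<in> L0" "u \<noteq> 0" "inverse u \<in> L0" "ac_unif ^ n * x = ac_unif ^ k * u"
      using K0_decomp[OF x False] by metis
    have "x * (ac_unif ^ n / ac_unif ^ k * inverse u) = (ac_unif ^ n * x) * inverse u / ac_unif ^ k"
      by simp
    also have "\<dots> = 1" unfolding u(4) using u(2) by simp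
    finally have "inverse x = ac_unif ^ n / ac_unif ^ k * inverse u" by (rule inverse_unique)
    also have "\<dots> = to_ac (of_nat CARD('p) ^ n / of_nat CARD('p) ^ k) * inverse u" by simp
    also have "\<dots> \<in> K0" by (rule K0_scale[OF L0_K0[OF u(3)]])
    finally show ?thesis .
  qed (use x in simp)
qed

sublocale padic_field K0
  by standard (rule intermediate_K0)

lemma L0_R: "x \<in> L0 \<Longrightarrow> x \<in> R"
  by (simp add: ring_of_integers_eq L0_K0 order_integral)

lemma mu_not_M: "x \<in> mu \<Longrightarrow> x \<notin> M"
  using mu_L0[of "inverse x"] L0_R mu_nonzero by (auto simp: maximal_ideal_def)

lemma N_not_M: "of_nat N \<notin> M"
proof
  assume "of_nat N \<in> M"
  moreover have "ac_unif * ac_unif ^ (m - 1) \<in> M" by (rule M_unif) simp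
  then have "of_nat (CARD('p) ^ m) \<in> M" using m by (simp flip: power_Suc)
  ultimately have "of_nat (CARD('p) ^ m) - of_nat N \<in> M" by (intro M_diff)
  then show False unfolding N(2) by simp
qed

text \<open>If \<open>w = s / t\<close> is congruent to \<open>1\<close>, the sum of the
  \<open>w ^ i\<close> over \<open>i < N\<close> is congruent to \<open>N\<close>, which is not in
  \<open>M\<close>. But this sum vanishes for an \<open>N\<close>-th root of unity other than
  \<open>1\<close>.\<close>

lemma teich_inj:
  assumes "s \<in> teich" "t \<in> teich" "s - t \<in> M"
  shows "s = t"
proof (cases "s = 0 \<or> t = 0")
  case True
  have *: "x = 0" if "x \<in> teich" "x \<in> M" for x
    using that mu_not_M teich_eq by blast
  show ?thesis using True *[of s] *[of t] assms M_minus[of "s - t"] by auto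
next
  case False
  then have st: "s \<in> mu" "t \<in> mu" using assms teich_eq by auto
  define w where "w = s * inverse t"
  have w: "w \<in> mu" using st by (simp add: w_def)
  have "inverse t * (s - t) \<in> M" using assms(3) L0_R mu_L0 st by (intro M_mult) auto
  then have wM: "w - 1 \<in> M" using False by (simp add: w_def algebra_simps)
  have "w = 1"
  proof (rule ccontr)
    assume "w \<noteq> 1"
    have "(w - 1) * (\<Sum>i<N. w ^ i) = 0" using w by (simp add: power_diff_1_eq[symmetric] mu_def)
    then have "(\<Sum>i<N. w ^ i) = 0" using \<open>w \<noteq> 1\<close> by simp
    moreover have "(\<Sum>i<N. w ^ i - 1) \<in> M"
    proof -
      have "w ^ i - 1 ^ i \<in> M" for i using wM w L0_R mu_L0 by (intro M_power_cong) auto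
      then have "w ^ i - 1 \<in> M" for i by (metis power_one)
      then show ?thesis by (induction N) (auto intro: M_add)
    qed
    ultimately have "- of_nat N \<in> M" by (simp add: sum_subtractf)
    then show False using N_not_M M_minus by fastforce
  qed
  then show ?thesis using False by (simp add: w_def field_simps)
qed

lemma ocong_M: "x \<in> L0 \<Longrightarrow> y \<in> L0 \<Longrightarrow> ocong 1 x y \<Longrightarrow> x - y \<in> M"
  unfolding ocong_def using L0_R M_unif by auto

text \<open>\<open>L0 / p L0\<close> is counted twice: by coordinates, and by Teichmueller
  representatives.\<close>

lemma card_B0: "card B0 = m"
proof -
  have "card teich = CARD('p) ^ card B0"
  proof (rule card_residue_system)
    show "teich \<subseteq> L0" using teich_L0 by blast
    fix x y assume "x \<in> teich" "y \<in> teich" "ocong 1 x y"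
    then show "x = y" using teich_inj ocong_M teich_L0 by blast
  next
    fix x assume "x \<in> L0"
    then show "\<exists>y\<in>teich. ocong 1 x y" using L0_teich by blast
  qed
  then show ?thesis using card_teich CARD_gt1 by simp
qed

text \<open>The point is that integral elements of \<open>K0\<close> lie in \<open>L0\<close>: an
  element with \<open>p\<close> in the denominator would put the unit \<open>u\<close> into the
  maximal ideal.\<close>

lemma R_teich:
  assumes x: "x \<in> R"
  shows "\<exists>t\<in>teich. x - t \<in> M"
proof (cases "x = 0")
  case True
  then show ?thesis by (intro bexI[of _ 0]) (auto simp: teich_eq)
next
  case False
  have "x \<in> K0" using x by (simp add: ring_of_integers_eq)
  then obtain n k u where u: "u \<in> L0" "u \<noteq> 0" "inverse u \<in> L0" "\<not> ocong 1 u 0" "ac_unif ^ n * x = ac_unif ^ k * u"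
    using False by (rule K0_decomp)
  have "x \<in> L0"
  proof (cases "n \<le> k")
    case True
    then have "ac_unif ^ n * x = ac_unif ^ n * (ac_unif ^ (k - n) * u)"
      using u(5) by (simp only: mult.assoc[symmetric] power_add[symmetric] le_add_diff_inverse)
    then have "x = ac_unif ^ (k - n) * u" by (simp only: mult_cancel_left) simp
    then show ?thesis using u(1) by (simp del: of_nat_power)
  next
    case False
    then have "ac_unif ^ k * (ac_unif ^ (n - k) * x) = ac_unif ^ k * u"
      using u(5) by (simp only: mult.assoc[symmetric] power_add[symmetric] le_add_diff_inverse nat_le_linear less_imp_le not_le)
    then have "u = ac_unif ^ (n - k) * x" by (simp only: mult_cancel_left) simp
    also have "n - k = Suc (n - k - 1)" using False by simp
    finally have "u = ac_unif * (ac_unif ^ (n - k - 1) * x)" by (simp only: power_Suc mult.assoc)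
    also have "\<dots> \<in> M" using x by (intro M_unif) (simp del: of_nat_power)
    finally show ?thesis using u(2,3) L0_R by (auto simp: maximal_ideal_def)
  qed
  then obtain t where "t \<in> teich" "ocong 1 x t" by (rule L0_teich)
  then show ?thesis using ocong_M \<open>x \<in> L0\<close> teich_L0 by blast
qed

lemma card_residue_K0: "card (residue_field K0) = CARD('p) ^ m"
  unfolding card_teich[symmetric]
  by (rule card_residue_field) (use teich_inj R_teich L0_R teich_L0 in auto)

lemma Qp_span_B0: "Qp.span B0 = K0"
proof
  show "Qp.span B0 \<subseteq> K0" unfolding K0_def by (rule Qp.span_mono[OF B0(1)])
  have "mu \<subseteq> Qp.span B0" using mu_L0 Zp_span_subset_Qp_span[of B0] B0(3) by blast
  then show "K0 \<subseteq> Qp.span B0" unfolding K0_def by (rule Qp.span_minimal[OF _ Qp.subspace_span])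
qed

lemma Qp_independent_B0: "Qp.independent B0"
  by (rule Zp_independent_imp_Qp_independent[OF finite_basis B0(2)])

lemma dim_K0: "Qp.dim K0 = m"
proof -
  have "Qp.span B0 = Qp.span K0" unfolding Qp_span_B0 by (simp add: K0_def Qp.span_span)
  from Qp.dim_eq_card[OF this Qp_independent_B0] show ?thesis by (simp add: card_B0)
qed

lemma unramified_K0: "unramified_extension K0"
  unfolding unramified_extension_def using intermediate_K0 dim_K0 card_residue_K0 m by simp

text \<open>The size of the residue field forces the roots of unity, hence \<open>K0\<close>, into
  \<open>K\<close>; equality of the degrees does the rest.\<close>

lemma unramified_unique:
  assumes K: "unramified_extension K" "card (residue_field K) = CARD('p) ^ m"
  shows "K = K0"
proof -
  have I: "intermediate_field K" and dim: "Qp.dim K = m"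
    using K CARD_gt1 unfolding unramified_extension_def by auto
  interpret F: padic_field K by standard (rule I)
  have sub: "Qp.subspace K"
    by (rule Qp.subspaceI) (auto simp: scale_padic_def intro: F.K_emb[of 0, simplified])
  have "mu \<subseteq> K" using F.residue_card_imp_roots[OF m K(2)] teich_eq unfolding teich_def by blast
  then have K0K: "K0 \<subseteq> K" unfolding K0_def using sub by (rule Qp.span_minimal)
  have "B0 \<subseteq> K" using B0(1) \<open>mu \<subseteq> K\<close> by blast
  then obtain B where B: "B0 \<subseteq> B" "B \<subseteq> K" "Qp.independent B" "K \<subseteq> Qp.span B"
    using Qp.maximal_independent_subset_extend[OF _ Qp_independent_B0] by blast
  have spB: "Qp.span B = K" using B(2,4) sub Qp.span_minimal by blast
  have "Qp.span K = K" using sub by (simp only: Qp.span_eq_iff)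
  then have "Qp.span B = Qp.span K" by (simp only: spB)
  from Qp.dim_eq_card[OF this B(3)] have "card B = m" using dim by simp
  then have "finite B" "card B0 = card B" using m card_B0 by (auto intro: card_ge_0_finite)
  then have "B0 = B" using card_subset_eq B(1) by blast
  then show ?thesis using spB Qp_span_B0 by simp
qed

lemma unramified_field_eq: "unramified_field (CARD('p) ^ m) = K0"
  unfolding unramified_field_def
proof (rule the_equality)
  show "unramified_extension K0 \<and> card (residue_field K0) = CARD('p) ^ m"
    using unramified_K0 card_residue_K0 by (rule conjI)
  show "K = K0" if "unramified_extension K \<and> card (residue_field K) = CARD('p) ^ m" for K
    using that unramified_unique by (elim conjE)
qed

end

section \<open>The trace of a root of unity\<close>

lemma Qp_representation_lincomb:
  assumes "Qp.independent B" "\<And>i. i \<in> I \<Longrightarrow> v i \<in> Qp.span B"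
  shows "Qp.representation B (\<Sum>i\<in>I. scale_padic (c i) (v i)) b = (\<Sum>i\<in>I. c i * Qp.representation B (v i) b)"
  using assms by (simp add: Qp.representation_sum Qp.representation_scale Qp.span_scale)

lemma Zp_representation_lincomb:
  assumes "Zp.independent B" "\<And>i. i \<in> I \<Longrightarrow> v i \<in> Zp.span B"
  shows "Zp.representation B (\<Sum>i\<in>I. padic_emb (c i) * v i) b = (\<Sum>i\<in>I. c i * Zp.representation B (v i) b)"
  using assms by (simp add: Zp.representation_sum Zp.representation_scale Zp.span_scale)

text \<open>\<open>field_trace\<close> refers to a chosen basis. Expanding the elements of each
  basis in the other one leads to the same double sum.\<close>

lemma trace_basis_independent:
  assumes B: "finite B" "Qp.independent B" "Qp.span B = V"
    and C: "finite C" "Qp.independent C" "Qp.span C = V"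
    and stable: "\<And>v. v \<in> V \<Longrightarrow> x * v \<in> V"
  shows "(\<Sum>b\<in>B. Qp.representation B (x * b) b) = (\<Sum>c\<in>C. Qp.representation C (x * c) c)"
proof -
  have BV: "b \<in> V" if "b \<in> B" for b using that B(3) Qp.span_base by blast
  have CV: "c \<in> V" if "c \<in> C" for c using that C(3) Qp.span_base by blast
  have "Qp.representation B (x * b) b = (\<Sum>c\<in>C. Qp.representation C b c * Qp.representation B (x * c) b)" if "b \<in> B" for b
  proof -
    have "b = (\<Sum>c\<in>C. scale_padic (Qp.representation C b c) c)"
      using Qp.sum_representation_eq[OF C(2) _ C(1) order_refl, of b] BV[OF that] C(3) by simp
    then have "x * b = x * (\<Sum>c\<in>C. scale_padic (Qp.representation C b c) c)" by (rule arg_cong)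
    also have "\<dots> = (\<Sum>c\<in>C. scale_padic (Qp.representation C b c) (x * c))"
      by (simp add: sum_distrib_left scale_padic_def mult_ac)
    finally have "Qp.representation B (x * b) b =
      Qp.representation B (\<Sum>c\<in>C. scale_padic (Qp.representation C b c) (x * c)) b" by (rule arg_cong)
    also have "\<dots> = (\<Sum>c\<in>C. Qp.representation C b c * Qp.representation B (x * c) b)"
      by (rule Qp_representation_lincomb[OF B(2)]) (use CV stable B(3) in auto)
    finally show ?thesis .
  qed
  then have "(\<Sum>b\<in>B. Qp.representation B (x * b) b) =
      (\<Sum>b\<in>B. \<Sum>c\<in>C. Qp.representation B (x * c) b * Qp.representation C b c)" by (simp add: mult.commute)
  also have "\<dots> = (\<Sum>c\<in>C. \<Sum>b\<in>B. Qp.representation B (x * c) b * Qp.representation C b c)" by (rule sum.swap)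
  also have "\<dots> = (\<Sum>c\<in>C. Qp.representation C (x * c) c)"
  proof (rule sum.cong[OF refl])
    fix c assume c: "c \<in> C"
    have "(\<Sum>b\<in>B. Qp.representation B (x * c) b * Qp.representation C b c) =
      Qp.representation C (\<Sum>b\<in>B. scale_padic (Qp.representation B (x * c) b) b) c"
      by (rule Qp_representation_lincomb[OF C(2), symmetric]) (use BV C(3) in auto)
    also have "(\<Sum>b\<in>B. scale_padic (Qp.representation B (x * c) b) b) = x * c"
      using Qp.sum_representation_eq[OF B(2) _ B(1) order_refl, of "x * c"] stable[OF CV[OF c]] B(3) by simp
    finally show "(\<Sum>b\<in>B. Qp.representation B (x * c) b * Qp.representation C b c) = Qp.representation C (x * c) c" .
  qed
  finally show ?thesis .
qed

lemma field_trace_basis: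
  assumes B: "finite B" "Qp.independent B" "Qp.span B = K" and stable: "\<And>v. v \<in> K \<Longrightarrow> x * v \<in> K"
  shows "field_trace K x = (\<Sum>b\<in>B. Qp.representation B (x * b) b)"
proof -
  define C where "C = (SOME B. Qp.independent B \<and> Qp.span B = K)"
  have C: "Qp.independent C \<and> Qp.span C = K"
    unfolding C_def by (rule someI[of _ B]) (use B in auto)
  have "C \<subseteq> Qp.span B" using C Qp.span_superset B(3) by blast
  then have "finite C" using Qp.independent_span_bound[OF B(1)] C by blast
  then show ?thesis
    unfolding field_trace_def Let_def C_def[symmetric]
    using C by (intro trace_basis_independent[OF _ _ _ B stable]) auto
qed

text \<open>Read as a recursion for the power sums, Newton's identities have leading coefficient
  \<open>d 0 = 1\<close> and so determine them. Two matrices with the same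
  \<open>rev_char_poly\<close> thus have equal traces of all positive powers.\<close>

lemma newton_sums_unique:
  fixes d s t :: "nat \<Rightarrow> 'a::comm_ring_1"
  assumes "d 0 = 1"
    and s: "\<And>k. of_nat (Suc k) * d (Suc k) = - (\<Sum>l\<le>k. d l * s (Suc k - l))"
    and t: "\<And>k. of_nat (Suc k) * d (Suc k) = - (\<Sum>l\<le>k. d l * t (Suc k - l))"
  shows "s (Suc k) = t (Suc k)"
proof (induction k rule: less_induct)
  case (less k)
  have split: "(\<Sum>l\<le>k. d l * u (Suc k - l)) = u (Suc k) + (\<Sum>l\<in>{1..k}. d l * u (Suc k - l))" for u
    using assms(1) by (simp add: atMost_atLeast0 sum.atLeast_Suc_atMost)
  have "(\<Sum>l\<in>{1..k}. d l * s (Suc k - l)) = (\<Sum>l\<in>{1..k}. d l * t (Suc k - l))"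
  proof (rule sum.cong[OF refl])
    fix l assume "l \<in> {1..k}"
    then have "Suc k - l = Suc (k - l)" "k - l < k" by auto
    then show "d l * s (Suc k - l) = d l * t (Suc k - l)" using less by simp
  qed
  moreover have "(\<Sum>l\<le>k. d l * s (Suc k - l)) = (\<Sum>l\<le>k. d l * t (Suc k - l))"
    using s[of k] t[of k] by simp
  ultimately show ?case unfolding split by simp
qed

lemma degree_rev_char_poly: "Polynomial.degree (rev_char_poly n B) \<le> n"
proof (rule Polynomial.degree_le, intro allI impI)
  fix k assume k: "n < k"
  show "Polynomial.coeff (rev_char_poly n B) k = 0"
  proof (rule rev_char_poly_coeff_closed[where Q = "\<lambda>x. x = 0"])
    fix S \<sigma> assume "S \<subseteq> {..<n}" "card S = k"
    then have "k \<le> n" using card_mono[of "{..<n}" S] by simp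
    then show "(\<Prod>i\<in>S. B i (\<sigma> i)) = 0" using k by simp
  qed auto
qed

lemma rev_char_poly_diagonal:
  "rev_char_poly n (\<lambda>i j. if i = j then g i else 0) = (\<Prod>i<n. [:1, - g i:])"
proof -
  let ?P = "rev_char_matrix n (\<lambda>i j. if i = j then g i else 0)"
  have "upper_triangular ?P"
    by (auto simp: upper_triangular_def rev_char_matrix_def)
  then have "rev_char_poly n (\<lambda>i j. if i = j then g i else 0) = prod_list (diag_mat ?P)"
    unfolding rev_char_poly_def by (rule det_upper_triangular[OF _ rev_char_matrix_carrier])
  also have "diag_mat ?P = map (\<lambda>i. [:1, - g i:]) [0..<n]"
    unfolding diag_mat_def
    by (rule map_cong) (auto simp: rev_char_matrix_def one_pCons Polynomial.monom_Suc Polynomial.monom_0)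
  also have "prod_list \<dots> = (\<Prod>i<n. [:1, - g i:])"
    by (simp add: prod.distinct_set_conv_list[symmetric] lessThan_atLeast0)
  finally show ?thesis .
qed

lemma mpow_diagonal:
  fixes n :: nat
  shows "i < n \<Longrightarrow> mpow {..<n} (\<lambda>i j. if i = j then g i else 0) k i j = (if i = j then g i ^ k else 0)"
  by (induction k arbitrary: j) (auto simp: if_distrib if_distribR mult.commute cong: if_cong)

context unramified_roots
begin

lemma K0_stable: "x \<in> K0 \<Longrightarrow> v \<in> K0 \<Longrightarrow> x * v \<in> K0" by simp

lemma field_trace_K0: "x \<in> K0 \<Longrightarrow> field_trace K0 x = (\<Sum>b\<in>B0. Qp.representation B0 (x * b) b)"
  by (rule field_trace_basis[OF finite_basis Qp_independent_B0 Qp_span_B0 K0_stable])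

lemma B0_L0: "b \<in> B0 \<Longrightarrow> b \<in> L0" using B0(1) mu_L0 by blast

lemma mu_K0: "x \<in> mu \<Longrightarrow> x \<in> K0" by (rule L0_K0[OF mu_L0])

lemma field_trace_sum:
  assumes "\<And>i. i \<in> I \<Longrightarrow> x i \<in> K0"
  shows "field_trace K0 (\<Sum>i\<in>I. x i) = (\<Sum>i\<in>I. field_trace K0 (x i))"
proof -
  have sum: "(\<Sum>i\<in>I. x i) \<in> K0" using assms unfolding K0_def by (intro Qp.span_sum)
  have "Qp.representation B0 ((\<Sum>i\<in>I. x i) * b) b = (\<Sum>i\<in>I. Qp.representation B0 (x i * b) b)" if "b \<in> B0" for b
  proof -
    have "x i * b \<in> Qp.span B0" if "i \<in> I" for i
      unfolding Qp_span_B0 using assms that \<open>b \<in> B0\<close> B0_L0 L0_K0 by simp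
    then show ?thesis by (simp add: sum_distrib_right Qp.representation_sum[OF Qp_independent_B0])
  qed
  then show ?thesis
    unfolding field_trace_K0[OF sum] by (simp add: sum.swap[of _ I] field_trace_K0 assms)
qed

lemma representation_Fract:
  assumes v: "v \<in> L0" and b: "b \<in> B0"
  shows "Qp.representation B0 v b = Fract (Zp.representation B0 v b) 1"
proof -
  have "v = (\<Sum>c\<in>B0. scale_padic (Fract (Zp.representation B0 v c) 1) c)"
    using rep_in[OF v] by (simp add: scale_padic_def padic_emb_def)
  then have "Qp.representation B0 v b =
      Qp.representation B0 (\<Sum>c\<in>B0. scale_padic (Fract (Zp.representation B0 v c) 1) c) b" by simp
  also have "\<dots> = (\<Sum>c\<in>B0. Fract (Zp.representation B0 v c) 1 * Qp.representation B0 c b)"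
    by (rule Qp_representation_lincomb[OF Qp_independent_B0]) (rule Qp.span_base)
  also have "\<dots> = (\<Sum>c\<in>B0. if c = b then Fract (Zp.representation B0 v c) 1 else 0)"
    by (intro sum.cong refl) (auto simp: Qp.representation_basis[OF Qp_independent_B0])
  finally show ?thesis using b finite_basis by simp
qed

text \<open>Let \<open>D\<close> be \<open>det (1 - X Z)\<close> for the matrix \<open>Z\<close> of
  multiplication by a primitive root of unity \<open>\<zeta>\<close>. Its coefficients are integral
  and it vanishes at \<open>1 / \<zeta>\<close>, so it vanishes modulo \<open>M\<close> at the
  inverses \<open>y j\<close> of all \<open>\<zeta> ^ (p ^ j)\<close>. All roots of \<open>D\<close>
  lie in \<open>mu\<close>, because \<open>Z ^ N = 1\<close>, and distinct elements of
  \<open>mu\<close> differ modulo \<open>M\<close>; hence the \<open>y j\<close> are true roots.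
  These \<open>m\<close> roots and the value \<open>1\<close> at \<open>0\<close> fix
  \<open>D\<close>, and Newton's identities yield the traces of the powers of
  \<open>\<zeta>\<close>.\<close>

lemma trace_mu:
  assumes x: "x \<in> mu"
  shows "to_ac (field_trace K0 x) = (\<Sum>j<m. x ^ CARD('p) ^ j)"
proof -
  obtain \<zeta> :: "'p padic_closure" where \<zeta>: "\<zeta> ^ N = 1" "inj_on (\<lambda>i. \<zeta> ^ i) {..<N}" "{x. x ^ N = 1} = (\<lambda>i. \<zeta> ^ i) ` {..<N}"
    by (rule primitive_root_of_unity[OF N(1)])
  have \<zeta>mu: "\<zeta> \<in> mu" using \<zeta>(1) by (simp add: mu_def)
  have \<zeta>0: "\<zeta> \<noteq> 0" by (rule mu_nonzero[OF \<zeta>mu])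
  obtain h where h: "bij_betw h {..<m} B0"
    using ex_bij_betw_nat_finite[OF finite_basis] unfolding card_B0 lessThan_atLeast0 by blast
  have hB: "h i \<in> B0" if "i < m" for i using h that by (auto simp: bij_betw_def)
  have hL: "h i \<in> L0" if "i < m" for i by (rule B0_L0[OF hB[OF that]])
  have h_eq: "h i = h j \<longleftrightarrow> i = j" if "i < m" "j < m" for i j
    using h that by (auto simp: bij_betw_def inj_on_def)
  have \<zeta>L: "\<zeta> ^ k * h i \<in> L0" if "i < m" for i k
    by (intro mult_closed power_closed mu_L0 \<zeta>mu hL that)
  define Z where "Z i j = Zp.representation B0 (\<zeta> * h i) (h j)" for i j
  have expand: "v = (\<Sum>z<m. padic_emb (Zp.representation B0 v (h z)) * h z)" if "v \<in> L0" for v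
    using rep_in[OF that] sum.reindex_bij_betw[OF h, of "\<lambda>b. padic_emb (Zp.representation B0 v b) * b"] by simp
  have mpowZ: "mpow {..<m} Z k i j = Zp.representation B0 (\<zeta> ^ k * h i) (h j)" if "i < m" "j < m" for i j k
    using that(2)
  proof (induction k arbitrary: j)
    case 0
    then show ?case using h_eq[OF that(1) 0] by (auto simp: Zp.representation_basis[OF B0(2) hB[OF that(1)]])
  next
    case (Suc k)
    have "\<zeta> ^ Suc k * h i = \<zeta> * (\<zeta> ^ k * h i)" by simp
    also have "\<dots> = \<zeta> * (\<Sum>z<m. padic_emb (mpow {..<m} Z k i z) * h z)"
      using expand[OF \<zeta>L[OF that(1), of k]] Suc.IH by simp
    also have "\<dots> = (\<Sum>z<m. padic_emb (mpow {..<m} Z k i z) * (\<zeta> * h z))"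
      by (simp add: sum_distrib_left mult_ac)
    finally have "Zp.representation B0 (\<zeta> ^ Suc k * h i) (h j) =
        Zp.representation B0 (\<Sum>z<m. padic_emb (mpow {..<m} Z k i z) * (\<zeta> * h z)) (h j)" by simp
    also have "\<dots> = (\<Sum>z<m. mpow {..<m} Z k i z * Zp.representation B0 (\<zeta> * h z) (h j))"
      by (rule Zp_representation_lincomb[OF B0(2)]) (use \<zeta>L[of _ 1] B0(3) in auto)
    finally show ?case unfolding mpow.simps Z_def[symmetric] by (rule sym)
  qed
  have trace: "to_ac (field_trace K0 (\<zeta> ^ k)) = padic_emb (\<Sum>i<m. mpow {..<m} Z k i i)" for k
  proof -
    have "field_trace K0 (\<zeta> ^ k) = (\<Sum>b\<in>B0. Qp.representation B0 (\<zeta> ^ k * b) b)"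
      by (rule field_trace_K0) (intro mu_K0 mu_power \<zeta>mu)
    also have "\<dots> = (\<Sum>i<m. Qp.representation B0 (\<zeta> ^ k * h i) (h i))"
      using sum.reindex_bij_betw[OF h, of "\<lambda>b. Qp.representation B0 (\<zeta> ^ k * b) b"] by simp
    also have "\<dots> = (\<Sum>i<m. Fract (mpow {..<m} Z k i i) 1)"
      by (intro sum.cong refl) (simp add: representation_Fract \<zeta>L hB mpowZ)
    finally show ?thesis unfolding padic_emb_sum by (simp add: to_ac_sum padic_emb_def)
  qed
  define D where "D = Polynomial.map_poly padic_emb (rev_char_poly m Z)"
  have coeffD: "Polynomial.coeff D k = padic_emb (Polynomial.coeff (rev_char_poly m Z) k)" for k
    unfolding D_def by (simp add: Polynomial.coeff_map_poly)
  have D0: "Polynomial.poly D 0 = 1" unfolding Polynomial.poly_0_coeff_0 coeffD rev_char_poly_0 by simp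
  have degD: "Polynomial.degree D \<le> m"
  proof (rule Polynomial.degree_le, intro allI impI)
    fix k assume "m < k"
    then have "Polynomial.degree (rev_char_poly m Z) < k" using degree_rev_char_poly le_less_trans by blast
    then show "Polynomial.coeff D k = 0" unfolding coeffD by (simp add: Polynomial.coeff_eq_0)
  qed
  define A where "A y = Matrix.mat m m (\<lambda>(i, j). (if i = j then 1 else 0) - y * padic_emb (Z i j))" for y
  have A: "A y \<in> carrier_mat m m" for y by (simp add: A_def)
  have polyD: "Polynomial.poly D y = Determinant.det (A y)" for y
  proof -
    interpret E: map_poly_comm_ring_hom "padic_emb :: 'p padic_int \<Rightarrow> _"
      by (simp add: map_poly_comm_ring_hom_def comm_ring_hom_padic_emb)
    have hom: "comm_ring_hom (\<lambda>q. Polynomial.poly (Polynomial.map_poly (padic_emb :: 'p padic_int \<Rightarrow> _) q) y)"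
      by unfold_locales (simp_all add: E.hom_add E.hom_mult)
    have "A y = map_mat (\<lambda>q. Polynomial.poly (Polynomial.map_poly padic_emb q) y) (rev_char_matrix m Z)"
      by (rule eq_matI)
        (auto simp: A_def rev_char_matrix_def E.hom_add Polynomial.map_poly_monom Polynomial.poly_monom)
    then show ?thesis
      unfolding D_def rev_char_poly_def by (simp add: comm_ring_hom.hom_det[OF hom])
  qed
  \<comment> \<open>A vector killed by \<open>1 - y Z\<close> satisfies
    \<open>v = y ^ k Z ^ k v\<close> for all \<open>k\<close>; the case \<open>k = N\<close> gives
    \<open>y ^ N = 1\<close>.\<close>
  have root_mu: "y \<in> mu" if root: "Polynomial.poly D y = 0" for y
  proof -
    obtain v where v: "v \<in> carrier_vec m" "v \<noteq> 0\<^sub>v m" "A y *\<^sub>v v = 0\<^sub>v m"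
      using det_0_iff_vec_prod_zero_field[OF A, of y] root unfolding polyD by blast
    let ?v = "vec_index v"
    have step: "?v i = y * (\<Sum>j<m. padic_emb (Z i j) * ?v j)" if "i < m" for i
    proof -
      have "0 = vec_index (A y *\<^sub>v v) i" using v(3) that by simp
      also have "\<dots> = (\<Sum>j<m. ((if i = j then 1 else 0) - y * padic_emb (Z i j)) * ?v j)"
        using v(1) that by (simp add: A_def scalar_prod_def lessThan_atLeast0)
      also have "\<dots> = (\<Sum>j<m. (if i = j then ?v j else 0) - y * (padic_emb (Z i j) * ?v j))"
        by (intro sum.cong refl) (auto simp: algebra_simps)
      also have "\<dots> = ?v i - y * (\<Sum>j<m. padic_emb (Z i j) * ?v j)"
        using that by (simp add: sum_subtractf sum_distrib_left)
      finally show ?thesis by simp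
    qed
    have iter: "?v i = y ^ k * (\<Sum>j<m. padic_emb (mpow {..<m} Z k i j) * ?v j)" if "i < m" for i k
    proof (induction k)
      case 0
      then show ?case using that by (simp add: if_distrib if_distribR cong: if_cong)
    next
      case (Suc k)
      have "?v i = y ^ k * (\<Sum>z<m. padic_emb (mpow {..<m} Z k i z) * (y * (\<Sum>j<m. padic_emb (Z z j) * ?v j)))"
        using Suc step by simp
      also have "\<dots> = y ^ Suc k * (\<Sum>z<m. \<Sum>j<m. padic_emb (mpow {..<m} Z k i z) * padic_emb (Z z j) * ?v j)"
        by (simp add: sum_distrib_left mult_ac)
      also have "\<dots> = y ^ Suc k * (\<Sum>j<m. padic_emb (mpow {..<m} Z (Suc k) i j) * ?v j)"
        by (subst sum.swap) (simp add: padic_emb_sum sum_distrib_right)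
      finally show ?case .
    qed
    obtain i where i: "i < m" "?v i \<noteq> 0" using v(1,2) by (metis carrier_vecD eq_vecI index_zero_vec)
    have "mpow {..<m} Z N i j = (if i = j then 1 else 0)" if "j < m" for j
      using that mpowZ[OF i(1) that, of N] mpowZ[OF i(1) that, of 0] \<zeta>(1) by simp
    then have "(\<Sum>j<m. padic_emb (mpow {..<m} Z N i j) * ?v j) = (\<Sum>j<m. if j = i then ?v j else 0)"
      by (intro sum.cong refl) auto
    then have "?v i = y ^ N * ?v i" using iter[OF i(1), of N] i(1) by simp
    then show ?thesis using i(2) by (simp add: mu_def)
  qed
  define y where "y j = inverse \<zeta> ^ CARD('p) ^ j" for j
  have ymu: "y j \<in> mu" for j using \<zeta>mu by (simp add: y_def)
  have root0: "Polynomial.poly D (inverse \<zeta>) = 0"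
  proof -
    define v where "v = Matrix.vec m h"
    have "A (inverse \<zeta>) *\<^sub>v v = 0\<^sub>v m"
    proof (rule eq_vecI)
      fix i assume "i < dim_vec (0\<^sub>v m :: 'p padic_closure Matrix.vec)"
      then have i: "i < m" by simp
      have "vec_index (A (inverse \<zeta>) *\<^sub>v v) i = (\<Sum>j<m. ((if i = j then 1 else 0) - inverse \<zeta> * padic_emb (Z i j)) * h j)"
        using i by (simp add: A_def v_def scalar_prod_def lessThan_atLeast0)
      also have "\<dots> = (\<Sum>j<m. (if i = j then h j else 0) - inverse \<zeta> * (padic_emb (Z i j) * h j))"
        by (intro sum.cong refl) (auto simp: algebra_simps)
      also have "\<dots> = h i - inverse \<zeta> * (\<Sum>j<m. padic_emb (Z i j) * h j)"
        using i by (simp add: sum_subtractf sum_distrib_left)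
      also have "(\<Sum>j<m. padic_emb (Z i j) * h j) = \<zeta> * h i"
        using expand[OF \<zeta>L[OF i, of 1]] by (simp add: Z_def)
      finally show "vec_index (A (inverse \<zeta>) *\<^sub>v v) i = vec_index (0\<^sub>v m) i" using i \<zeta>0 by simp
    qed (simp add: A_def)
    moreover have "v \<noteq> 0\<^sub>v m"
    proof
      assume "v = 0\<^sub>v m"
      then have "vec_index v 0 = vec_index (0\<^sub>v m) 0" by simp
      then have "h 0 = 0" using m by (simp add: v_def)
      then show False using hB[of 0] B0(1) mu_nonzero m by force
    qed
    moreover have "v \<in> carrier_vec m" by (simp add: v_def)
    ultimately show ?thesis unfolding polyD using det_0_iff_vec_prod_zero_field[OF A, of "inverse \<zeta>"] by blast
  qed
  have polyD_sum: "Polynomial.poly D z = (\<Sum>k\<le>m. Polynomial.coeff D k * z ^ k)" for z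
  proof -
    have "Polynomial.poly D z = (\<Sum>k\<le>Polynomial.degree D. Polynomial.coeff D k * z ^ k)" by (rule Polynomial.poly_altdef)
    also have "\<dots> = (\<Sum>k\<le>m. Polynomial.coeff D k * z ^ k)"
      using degD by (intro sum.mono_neutral_left) (auto simp: Polynomial.coeff_eq_0)
    finally show ?thesis .
  qed
  \<comment> \<open>Modulo \<open>p\<close>, raising a value of \<open>D\<close> to the power
    \<open>p ^ j\<close> amounts to raising the argument, because the coefficients come from the
    \<open>p\<close>-adic integers.\<close>
  have root_y_mod: "Polynomial.poly D (y j) \<in> M" for j
  proof -
    let ?z = "inverse \<zeta>"
    have z: "?z \<in> L0" using \<zeta>mu mu_L0 by simp
    have cL: "Polynomial.coeff D k * ?z ^ k \<in> L0" for k using z by (simp add: coeffD)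
    have "ocong 1 ((\<Sum>k\<le>m. Polynomial.coeff D k * ?z ^ k) ^ CARD('p) ^ j) (\<Sum>k\<le>m. (Polynomial.coeff D k * ?z ^ k) ^ CARD('p) ^ j)"
      by (rule freshman_sum) (rule cL)
    also have "(\<Sum>k\<le>m. (Polynomial.coeff D k * ?z ^ k) ^ CARD('p) ^ j) = (\<Sum>k\<le>m. y j ^ k * Polynomial.coeff D k ^ CARD('p) ^ j)"
      by (simp add: power_mult_distrib y_def power_mult[symmetric] mult.commute)
    also have "ocong 1 \<dots> (\<Sum>k\<le>m. y j ^ k * Polynomial.coeff D k)"
      unfolding coeffD by (intro ocong_sum ocong_mult_left emb_fermat power_closed mu_L0 ymu)
    also have "(\<Sum>k\<le>m. y j ^ k * Polynomial.coeff D k) = Polynomial.poly D (y j)"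
      unfolding polyD_sum by (simp add: mult.commute)
    finally have "ocong 1 (Polynomial.poly D ?z ^ CARD('p) ^ j) (Polynomial.poly D (y j))" unfolding polyD_sum[of ?z] .
    then have "ocong 1 (Polynomial.poly D (y j)) 0" unfolding root0 using ocong_sym by (simp add: power_0_left)
    moreover have "Polynomial.poly D (y j) \<in> L0"
      unfolding polyD_sum coeffD by (intro sum_closed scale_closed power_closed mu_L0 ymu)
    ultimately show ?thesis using ocong_M[of "Polynomial.poly D (y j)" 0] by simp
  qed
  \<comment> \<open>The product of \<open>y j - x\<close> over the roots \<open>x\<close> of
    \<open>D\<close> lies in the prime ideal \<open>M\<close>, so one factor does, and then
    \<open>y j = x\<close>. The leading coefficient stays out of \<open>M\<close> because the value
    \<open>1\<close> at \<open>0\<close> is a multiple of it.\<close>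
  have root_y: "Polynomial.poly D (y j) = 0" for j
  proof -
    have "D \<noteq> 0" using D0 by auto
    then obtain rs where rs: "D = Polynomial.smult (Polynomial.lead_coeff D) (prod_mset (image_mset (\<lambda>x. [:- x, 1:]) rs))"
      using alg_closed_imp_factorization by blast
    let ?c = "Polynomial.lead_coeff D"
    have polyX: "Polynomial.poly D z = ?c * prod_mset (image_mset (\<lambda>x. z - x) rs)" for z
    proof -
      have "Polynomial.poly (prod_mset (image_mset (\<lambda>x. [:- x, 1:]) rs)) z = prod_mset (image_mset (\<lambda>x. z - x) rs)"
        by (induction rs) (auto simp: algebra_simps)
      then show ?thesis by (subst rs) simp
    qed
    have Xroot: "x \<in> mu" if "x \<in># rs" for x
    proof (rule root_mu)
      have "0 \<in># image_mset (\<lambda>x'. x - x') rs" using that by force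
      then have "prod_mset (image_mset (\<lambda>x'. x - x') rs) = 0" by (simp add: prod_mset_zero_iff)
      then show "Polynomial.poly D x = 0" unfolding polyX by simp
    qed
    have cR: "?c \<in> R" by (simp add: coeffD)
    have muR: "x \<in> R" if "x \<in> mu" for x by (rule L0_R[OF mu_L0[OF that]])
    have prodR: "prod_mset (image_mset (\<lambda>x. z - x) Y) \<in> R" if "z \<in> R" "set_mset Y \<subseteq> mu" for z Y
      using that(2,1) by (induction Y) (auto simp: muR)
    have "?c \<notin> M"
    proof
      assume "?c \<in> M"
      then have "prod_mset (image_mset (\<lambda>x. 0 - x) rs) * ?c \<in> M" using Xroot by (intro M_mult prodR) auto
      then have "?c * prod_mset (image_mset (\<lambda>x. 0 - x) rs) \<in> M" by (simp only: mult.commute)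
      then show False using D0 unfolding polyX by (simp only: M_one)
    qed
    have yR: "y j \<in> R" by (rule L0_R[OF mu_L0[OF ymu]])
    have "prod_mset (image_mset (\<lambda>x. y j - x) rs) \<in> M"
    proof -
      have "prod_mset (image_mset (\<lambda>x. y j - x) rs) \<in> R" by (rule prodR[OF yR]) (use Xroot in blast)
      then show ?thesis
        using root_y_mod[of j] M_prime[OF cR] \<open>?c \<notin> M\<close> unfolding polyX by blast
    qed
    then have "\<exists>x\<in>#rs. y j - x \<in> M"
      using Xroot
    proof (induction rs)
      case (add x rs)
      have "y j - x \<in> R" using add.prems yR muR by simp
      moreover have "prod_mset (image_mset (\<lambda>x. y j - x) rs) \<in> R" using add.prems yR by (intro prodR) auto
      ultimately have "y j - x \<in> M \<or> prod_mset (image_mset (\<lambda>x. y j - x) rs) \<in> M" using add.prems M_prime by auto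
      then show ?case using add by auto
    qed simp
    then obtain x where x: "x \<in># rs" "y j - x \<in> M" by blast
    then have "y j = x" using teich_inj[of "y j" x] ymu Xroot teich_eq by blast
    then have "0 \<in># image_mset (\<lambda>x. y j - x) rs" using x by force
    then have "prod_mset (image_mset (\<lambda>x. y j - x) rs) = 0" by (simp add: prod_mset_zero_iff)
    then show ?thesis unfolding polyX by simp
  qed
  let ?g = "\<lambda>i. \<zeta> ^ CARD('p) ^ i"
  let ?G = "\<lambda>i j. if i = j then ?g i else 0"
  have ginj: "inj_on ?g {..<m}"
  proof (rule inj_onI)
    fix i j assume ij: "i \<in> {..<m}" "j \<in> {..<m}" "?g i = ?g j"
    \<comment> \<open>The exponents \<open>p ^ i\<close> with \<open>i < m\<close> stay below
      \<open>N\<close>, where powers of \<open>\<zeta>\<close> are distinct. For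
      \<open>m = 1\<close> only \<open>i = 0\<close> occurs, and there \<open>N\<close> may be
      \<open>1\<close>.\<close>
    have lt: "CARD('p) ^ i < N \<or> m = 1" if "i < m" for i
    proof (cases "m = 1")
      case False
      then have m2: "m = Suc (m - 1)" "m - 1 \<ge> 1" using m by auto
      have "CARD('p) ^ i \<le> CARD('p) ^ (m - 1)" using that CARD_gt1 by (intro power_increasing) auto
      moreover have "CARD('p) ^ 1 \<le> CARD('p) ^ (m - 1)" using m2(2) CARD_gt1 by (intro power_increasing) auto
      then have "CARD('p) ^ (m - 1) \<ge> 2" using CARD_gt1 by simp
      moreover have "2 * CARD('p) ^ (m - 1) \<le> CARD('p) ^ m"
        using CARD_gt1 by (subst m2(1)) (simp del: One_nat_def)
      ultimately show ?thesis using N(2) by linarith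
    qed simp
    show "i = j"
    proof (cases "m = 1")
      case False
      then have "CARD('p) ^ i = CARD('p) ^ j"
        using inj_onD[OF \<zeta>(2) ij(3)] lt[of i] lt[of j] ij by auto
      then show ?thesis using CARD_gt1 by simp
    qed (use ij in simp)
  qed
  have "D = rev_char_poly m ?G"
  proof -
    let ?E = "rev_char_poly m ?G"
    have E: "Polynomial.poly ?E z = (\<Prod>i<m. 1 - z * ?g i)" for z
      unfolding rev_char_poly_diagonal by (simp add: Polynomial.poly_prod)
    have yE: "Polynomial.poly ?E (y j) = 0" if "j < m" for j
    proof -
      have "y j * ?g j = 1" using \<zeta>0 by (simp add: y_def power_inverse)
      then show ?thesis unfolding E using that by (intro prod_zero) auto
    qed
    have yinv: "y j = inverse (?g j)" for j by (simp add: y_def power_inverse)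
    have inj: "inj_on y {..<m}"
      using ginj unfolding yinv[abs_def] by (auto simp: inj_on_def)
    have "0 \<notin> y ` {..<m}" using ymu mu_nonzero by force
    then have card: "card (insert 0 (y ` {..<m})) = Suc m" using inj by (simp add: card_image)
    show ?thesis
    proof (rule ccontr)
      assume "D \<noteq> ?E"
      then have nz: "D - ?E \<noteq> 0" by simp
      have "insert 0 (y ` {..<m}) \<subseteq> {z. Polynomial.poly (D - ?E) z = 0}"
        using root_y yE D0 by (auto simp: E)
      then have "Suc m \<le> card {z. Polynomial.poly (D - ?E) z = 0}"
        unfolding card[symmetric] by (rule card_mono[OF Polynomial.poly_roots_finite[OF nz]])
      also have "\<dots> \<le> Polynomial.degree (D - ?E)" by (rule Polynomial.card_poly_roots_bound[OF nz])
      also have "\<dots> \<le> m" using degD degree_rev_char_poly by (intro Polynomial.degree_diff_le)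
      finally show False by simp
    qed
  qed
  note DE = this
  have "padic_emb (\<Sum>i<m. mpow {..<m} Z (Suc k) i i) = (\<Sum>i<m. mpow {..<m} ?G (Suc k) i i)" for k
  proof (rule newton_sums_unique[where d = "Polynomial.coeff D"])
    show "Polynomial.coeff D 0 = 1" using D0 by (simp add: Polynomial.poly_0_coeff_0)
    fix k
    have "padic_emb (of_nat (Suc k) * Polynomial.coeff (rev_char_poly m Z) (Suc k)) =
      padic_emb (- (\<Sum>l\<le>k. Polynomial.coeff (rev_char_poly m Z) l * (\<Sum>i<m. mpow {..<m} Z (Suc k - l) i i)))"
      by (rule arg_cong[OF rev_char_poly_recursion])
    then show "of_nat (Suc k) * Polynomial.coeff D (Suc k) =
        - (\<Sum>l\<le>k. Polynomial.coeff D l * padic_emb (\<Sum>i<m. mpow {..<m} Z (Suc k - l) i i))"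
      unfolding coeffD by (simp only: padic_emb_simps padic_emb_of_nat padic_emb_sum)
    show "of_nat (Suc k) * Polynomial.coeff D (Suc k) =
        - (\<Sum>l\<le>k. Polynomial.coeff D l * (\<Sum>i<m. mpow {..<m} ?G (Suc k - l) i i))"
      unfolding DE by (rule rev_char_poly_recursion)
  qed
  then have tr: "to_ac (field_trace K0 (\<zeta> ^ Suc k)) = (\<Sum>i<m. (?g i) ^ Suc k)" for k
    unfolding trace by (simp add: mpow_diagonal del: mpow.simps power_Suc)
  obtain k where k: "x = \<zeta> ^ k" using x \<zeta>(3) by (auto simp: mu_def)
  \<comment> \<open>Newton's identities do not reach the exponent \<open>0\<close>, so the exponent
    is raised by the order \<open>N\<close>.\<close>
  have "x = \<zeta> ^ Suc (k + N - 1)" using k \<zeta>(1) N(1) by (simp add: power_add)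
  then show ?thesis using tr[of "k + N - 1"] by (simp add: power_mult[symmetric] mult.commute del: power_Suc)
qed

end

section \<open>The degree function of a lattice polytope\<close>

locale lattice_polytope =
  fixes S P :: "(real ^ 'n::finite) set"
  assumes finite_S: "finite S"
    and integral_S: "\<And>v i. v \<in> S \<Longrightarrow> vec_nth v i \<in> \<int>"
    and P_def: "P = convex hull (insert 0 S)"
begin

lemma zero_in_P [simp]: "0 \<in> P"
  unfolding P_def by (intro hull_inc) simp

lemma S_subset_P: "S \<subseteq> P"
  unfolding P_def by (meson hull_subset insert_subset)

lemma polytope_P: "polytope P"
  unfolding P_def polytope_def using finite_S by blast

lemma convex_P: "convex P" by (simp add: P_def)

lemma compact_P: "compact P" by (rule polytope_imp_compact[OF polytope_P])

lemma cone_P: "u \<in> cone hull P \<longleftrightarrow> (\<exists>c y. c \<ge> 0 \<and> y \<in> P \<and> u = c *\<^sub>R y)"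
  by (auto simp: cone_hull_expl)

lemma cone_zero [simp]: "0 \<in> cone hull P"
  unfolding cone_P by (intro exI[of _ 0]) auto

lemma cone_scale: "u \<in> cone hull P \<Longrightarrow> r \<ge> 0 \<Longrightarrow> r *\<^sub>R u \<in> cone hull P"
  unfolding cone_P by (metis mult_nonneg_nonneg scaleR_scaleR)

definition gauge_set :: "real ^ 'n \<Rightarrow> real set" where
  "gauge_set u = {r. r \<ge> 0 \<and> (\<exists>y\<in>P. u = r *\<^sub>R y)}"

lemma gauge_scale_le:
  assumes u: "u \<in> cone hull P" and r: "r > 0"
  shows "Inf (gauge_set (r *\<^sub>R u)) \<le> r * Inf (gauge_set u)"
proof -
  have ne: "gauge_set u \<noteq> {}" using u by (auto simp: gauge_set_def cone_P)
  have "Inf (gauge_set (r *\<^sub>R u)) / r \<le> Inf (gauge_set u)"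
  proof (rule cInf_greatest[OF ne])
    fix s assume "s \<in> gauge_set u"
    then have "r * s \<in> gauge_set (r *\<^sub>R u)" using r by (auto simp: gauge_set_def)
    then have "Inf (gauge_set (r *\<^sub>R u)) \<le> r * s"
      by (rule cInf_lower) (auto simp: gauge_set_def bdd_below_def)
    then show "Inf (gauge_set (r *\<^sub>R u)) / r \<le> s" using r by (simp add: field_simps)
  qed
  then show ?thesis using r by (simp add: field_simps)
qed

text \<open>The Minkowski functional of \<open>P\<close> shows that the choice in
  \<open>deg_fun\<close> is not void. On a facet \<open>F\<close> away from \<open>0\<close> it is
  \<open>1\<close>: with a smaller value, a point of \<open>F\<close> would be inside a segment from
  \<open>0\<close> to a point of \<open>P\<close>, and the face \<open>F\<close> would contain
  \<open>0\<close>.\<close>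

lemma is_degree_function_gauge: "is_degree_function P (\<lambda>u. Inf (gauge_set u))"
  unfolding is_degree_function_def
proof (intro conjI allI impI ballI)
  fix F u assume F: "F facet_of P \<and> 0 \<notin> F" and u: "u \<in> F"
  have face: "F face_of P" using F facet_of_imp_face_of by blast
  have uP: "u \<in> P" using face_of_imp_subset[OF face] u by blast
  show "Inf (gauge_set u) = 1"
  proof (rule cInf_eq_minimum)
    show "1 \<in> gauge_set u" using uP by (auto simp: gauge_set_def)
    fix r assume "r \<in> gauge_set u"
    then obtain y where r: "r \<ge> 0" "y \<in> P" "u = r *\<^sub>R y" by (auto simp: gauge_set_def)
    show "1 \<le> r"
    proof (rule ccontr)
      assume "\<not> 1 \<le> r"
      moreover have "u \<noteq> 0" using u F by blast
      ultimately have "u \<in> open_segment 0 y" using r by (auto simp: in_segment)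
      then show False using face_ofD[OF face _ zero_in_P r(2) u] F by blast
    qed
  qed
next
  fix u r assume u: "u \<in> cone hull P" and r: "0 \<le> (r::real)"
  show "Inf (gauge_set (r *\<^sub>R u)) = r * Inf (gauge_set u)"
  proof (cases "r = 0")
    case True
    have "Inf (gauge_set 0) = 0"
      by (rule cInf_eq_minimum) (auto simp: gauge_set_def intro: zero_in_P)
    then show ?thesis using True by simp
  next
    case False
    then have r0: "r > 0" using r by simp
    have "Inf (gauge_set ((1 / r) *\<^sub>R r *\<^sub>R u)) \<le> (1 / r) * Inf (gauge_set (r *\<^sub>R u))"
      by (rule gauge_scale_le) (use u r0 cone_scale in auto)
    then have "r * Inf (gauge_set u) \<le> Inf (gauge_set (r *\<^sub>R u))" using r0 by (simp add: field_simps)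
    then show ?thesis using gauge_scale_le[OF u r0] by simp
  qed
qed

abbreviation "dg \<equiv> deg_fun P"
abbreviation "C \<equiv> cone hull P"
abbreviation "Lat \<equiv> cone_lattice P"

lemma is_degree_function_deg_fun: "is_degree_function P dg"
  unfolding deg_fun_def by (rule someI[of _ "\<lambda>u. Inf (gauge_set u)"]) (rule is_degree_function_gauge)

lemma dg_scale: "u \<in> C \<Longrightarrow> r \<ge> 0 \<Longrightarrow> dg (r *\<^sub>R u) = r * dg u"
  using is_degree_function_deg_fun unfolding is_degree_function_def by blast

lemma dg_facet: "F facet_of P \<Longrightarrow> 0 \<notin> F \<Longrightarrow> u \<in> F \<Longrightarrow> dg u = 1"
  using is_degree_function_deg_fun unfolding is_degree_function_def by blast

lemma dg_zero [simp]: "dg 0 = 0"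
  using dg_scale[of 0 0] by simp

lemma P_subset_C: "u \<in> P \<Longrightarrow> u \<in> C"
  unfolding cone_P by (metis scaleR_one zero_le_one)

text \<open>Describe \<open>P\<close> by irredundant inequalities, one for each facet. If none of
  those with positive right-hand side were tight at \<open>z\<close>, the ray could be prolonged a
  little within \<open>P\<close>.\<close>

lemma exits_through_facet:
  assumes z: "z \<in> P" and max: "\<And>t. t > 1 \<Longrightarrow> t *\<^sub>R z \<notin> P"
  obtains F where "F facet_of P" "0 \<notin> F" "z \<in> F"
proof -
  obtain H where H: "finite H" "P = affine hull P \<inter> \<Inter>H"
    "\<forall>h\<in>H. \<exists>a b. a \<noteq> 0 \<and> h = {x. a \<bullet> x \<le> b}" "\<forall>H'. H' \<subset> H \<longrightarrow> P \<subset> affine hull P \<inter> \<Inter>H'"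
    using polytope_imp_polyhedron[OF polytope_P] unfolding polyhedron_Int_affine_minimal by blast
  from bchoice[OF H(3)] obtain a where "\<forall>h\<in>H. \<exists>b. a h \<noteq> 0 \<and> h = {x. a h \<bullet> x \<le> b}" ..
  from bchoice[OF this] obtain b where ab: "\<forall>h\<in>H. a h \<noteq> 0 \<and> h = {x. a h \<bullet> x \<le> b h}" ..
  have facet: "F facet_of P \<longleftrightarrow> (\<exists>h. h \<in> H \<and> F = P \<inter> {x. a h \<bullet> x = b h})" for F
    by (rule facet_of_polyhedron_explicit[OF H(1,2)]) (use ab H(4) in auto)
  have le: "a h \<bullet> x \<le> b h" if "x \<in> P" "h \<in> H" for x h
  proof -
    have "x \<in> h" using that H(2) by blast
    then show ?thesis using ab that(2) by blast
  qed
  have b0: "b h \<ge> 0" if "h \<in> H" for h using le[OF zero_in_P that] by simp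
  have "\<exists>h\<in>H. a h \<bullet> z = b h \<and> b h > 0"
  proof (rule ccontr)
    assume no: "\<not> (\<exists>h\<in>H. a h \<bullet> z = b h \<and> b h > 0)"
    \<comment> \<open>An inequality with \<open>a h \<bullet> z \<le> 0\<close> never obstructs
      prolongation, as \<open>b h \<ge> 0\<close>; the others are strict at \<open>z\<close> by
      assumption and leave some room.\<close>
    have "\<exists>e>0. \<forall>e'>0. e' \<le> e \<longrightarrow> a h \<bullet> ((1 + e') *\<^sub>R z) \<le> b h" if h: "h \<in> H" for h
    proof (cases "a h \<bullet> z \<le> 0")
      case True
      have "a h \<bullet> ((1 + e) *\<^sub>R z) \<le> b h" if "e > 0" for e
      proof -
        have "(1 + e) * (a h \<bullet> z) \<le> 0" using True that by (intro mult_nonneg_nonpos) auto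
        then show ?thesis using b0[OF h] by simp
      qed
      then show ?thesis by (intro exI[of _ 1]) simp
    next
      case False
      then have lt: "a h \<bullet> z < b h" using le[OF z h] no h by fastforce
      define e where "e = (b h - a h \<bullet> z) / (a h \<bullet> z)"
      have e: "e > 0" using lt False by (simp add: e_def)
      have "a h \<bullet> ((1 + e') *\<^sub>R z) \<le> b h" if "e' \<le> e" for e'
      proof -
        have "e' * (a h \<bullet> z) \<le> e * (a h \<bullet> z)" using that False by (intro mult_right_mono) auto
        also have "\<dots> = b h - a h \<bullet> z" using False by (simp add: e_def)
        finally show ?thesis by (simp add: algebra_simps)
      qed
      then show ?thesis using e by blast
    qed
    then have "\<forall>h\<in>H. \<exists>e>0. \<forall>e'>0. e' \<le> e \<longrightarrow> a h \<bullet> ((1 + e') *\<^sub>R z) \<le> b h" by blast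
    from bchoice[OF this] obtain e where e: "\<forall>h\<in>H. e h > 0 \<and> (\<forall>e'>0. e' \<le> e h \<longrightarrow> a h \<bullet> ((1 + e') *\<^sub>R z) \<le> b h)" ..
    define m where "m = Min (insert 1 (e ` H))"
    have m: "m > 0" "\<And>h. h \<in> H \<Longrightarrow> m \<le> e h" using H(1) e by (auto simp: m_def)
    have "(1 + m) *\<^sub>R z \<in> \<Inter>H"
    proof
      fix h assume h: "h \<in> H"
      then have "a h \<bullet> ((1 + m) *\<^sub>R z) \<le> b h" using e m by blast
      then show "(1 + m) *\<^sub>R z \<in> h" using ab h by blast
    qed
    moreover have "(1 + m) *\<^sub>R z \<in> affine hull P"
    proof -
      have "0 \<in> affine hull P" "z \<in> affine hull P" using z by (auto intro: hull_inc)
      then have "(- m) *\<^sub>R 0 + (1 + m) *\<^sub>R z \<in> affine hull P"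
        by (intro mem_affine) (auto simp: affine_affine_hull)
      then show ?thesis by simp
    qed
    ultimately have "(1 + m) *\<^sub>R z \<in> P" using H(2) by blast
    then show False using max[of "1 + m"] m(1) by simp
  qed
  then obtain h where h: "h \<in> H" "a h \<bullet> z = b h" "b h > 0" by blast
  show ?thesis
  proof (rule that[of "P \<inter> {x. a h \<bullet> x = b h}"])
    show "P \<inter> {x. a h \<bullet> x = b h} facet_of P" unfolding facet using h(1) by blast
  qed (use h z in auto)
qed

text \<open>By compactness the ray of \<open>u\<close> has a last point in \<open>P\<close>, and
  this point is on a facet away from \<open>0\<close>. The final clause compares the degree with the
  gauge of \<open>P\<close> and bounds it by \<open>1\<close> on \<open>P\<close>.\<close>

lemma ray_facet:
  assumes u: "u \<in> C" "u \<noteq> 0"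
  obtains F z where "F facet_of P" "0 \<notin> F" "z \<in> F" "dg u > 0" "u = dg u *\<^sub>R z"
    "\<forall>s\<ge>0. s *\<^sub>R u \<in> P \<longrightarrow> s * dg u \<le> 1"
proof -
  obtain c y where cy: "c \<ge> 0" "y \<in> P" "u = c *\<^sub>R y" using u(1) unfolding cone_P by blast
  have c0: "c > 0" and y0: "y \<noteq> 0" using cy u(2) by (auto simp: less_le)
  define A where "A = {t. 0 \<le> t \<and> t *\<^sub>R y \<in> P}"
  obtain K where K: "\<And>x. x \<in> P \<Longrightarrow> norm x \<le> K" using compact_imp_bounded[OF compact_P] unfolding bounded_iff by blast
  have "closed A"
  proof -
    have "closed ((\<lambda>t. t *\<^sub>R y) -` P)"
      by (rule continuous_closed_vimage[OF compact_imp_closed[OF compact_P]]) (intro continuous_intros)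
    then have "closed ({0..} \<inter> (\<lambda>t. t *\<^sub>R y) -` P)" by (intro closed_Int) auto
    moreover have "A = {0..} \<inter> (\<lambda>t. t *\<^sub>R y) -` P" by (auto simp: A_def)
    ultimately show ?thesis by simp
  qed
  moreover have "bounded A"
  proof (rule boundedI)
    fix t assume "t \<in> A"
    then have "t * norm y \<le> K" "t \<ge> 0" using K[of "t *\<^sub>R y"] by (auto simp: A_def)
    then show "norm t \<le> K / norm y" using y0 by (simp add: field_simps)
  qed
  moreover have "1 \<in> A" using cy by (simp add: A_def)
  ultimately obtain t where t: "t \<in> A" "\<And>s. s \<in> A \<Longrightarrow> s \<le> t"
    using compact_attains_sup[of A] by (auto simp: compact_eq_bounded_closed)
  have t1: "t \<ge> 1" using t(2)[OF \<open>1 \<in> A\<close>] .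
  have z: "t *\<^sub>R y \<in> P" using t(1) by (simp add: A_def)
  have "r *\<^sub>R (t *\<^sub>R y) \<notin> P" if "r > 1" for r
  proof
    assume "r *\<^sub>R (t *\<^sub>R y) \<in> P"
    then have "r * t \<in> A" using that t1 by (simp add: A_def)
    then have "r * t \<le> 1 * t" using t(2) by simp
    then show False using that t1 by simp
  qed
  then obtain F where F: "F facet_of P" "0 \<notin> F" "t *\<^sub>R y \<in> F" using exits_through_facet[OF z] by blast
  have uz: "u = (c / t) *\<^sub>R (t *\<^sub>R y)" using cy(3) t1 by simp
  have "dg u = c / t"
    using dg_scale[OF P_subset_C[OF z], of "c / t"] dg_facet[OF F] c0 t1 by (simp add: uz[symmetric] del: scaleR_scaleR)
  moreover have "s * (c / t) \<le> 1" if "s \<ge> 0" "s *\<^sub>R u \<in> P" for s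
  proof -
    have "s * c \<in> A" using that cy by (simp add: A_def)
    then have "s * c \<le> t" by (rule t(2))
    then show ?thesis using t1 by (simp add: field_simps)
  qed
  ultimately show ?thesis using that[OF F] uz c0 t1 by simp
qed

lemma dg_expand:
  assumes "u \<in> C"
  obtains z where "z \<in> P" "u = dg u *\<^sub>R z" "dg u \<ge> 0"
proof (cases "u = 0")
  case True
  then show ?thesis using that[of 0] by simp
next
  case False
  obtain F z where F: "F facet_of P" "0 \<notin> F" "z \<in> F" "dg u > 0" "u = dg u *\<^sub>R z"
    using ray_facet[OF assms False] by metis
  then have "z \<in> P" using facet_of_imp_subset by blast
  then show ?thesis using that[of z] F by simp
qed

lemma dg_nonneg: "u \<in> C \<Longrightarrow> dg u \<ge> 0"
  by (erule dg_expand)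

lemma dg_le_1: "y \<in> P \<Longrightarrow> dg y \<le> 1"
proof (cases "y = 0")
  case False
  assume y: "y \<in> P"
  obtain F z where "\<forall>s\<ge>0. s *\<^sub>R y \<in> P \<longrightarrow> s * dg y \<le> 1"
    using ray_facet[OF P_subset_C[OF y] False] by metis
  from this[rule_format, of 1] show ?thesis using y by simp
qed simp

text \<open>\<open>u + v\<close>, divided by \<open>dg u + dg v\<close>, is a convex combination of
  two points of \<open>P\<close>, where the degree is at most \<open>1\<close>.\<close>

lemma cone_add_dg:
  assumes u: "u \<in> C" and v: "v \<in> C"
  shows "u + v \<in> C" "dg (u + v) \<le> dg u + dg v"
proof -
  obtain y where y: "y \<in> P" "u = dg u *\<^sub>R y" "dg u \<ge> 0" by (rule dg_expand[OF u])
  obtain z where z: "z \<in> P" "v = dg v *\<^sub>R z" "dg v \<ge> 0" by (rule dg_expand[OF v])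
  define s where "s = dg u + dg v"
  have "u + v \<in> C \<and> dg (u + v) \<le> s"
  proof (cases "s = 0")
    case True
    then have "dg u = 0" "dg v = 0" using y z by (auto simp: s_def)
    then have "u = 0" "v = 0" using y(2) z(2) by simp_all
    then show ?thesis using True by simp
  next
    case False
    then have s: "s > 0" using y z by (simp add: s_def)
    define w where "w = (dg u / s) *\<^sub>R y + (dg v / s) *\<^sub>R z"
    have w: "w \<in> P" unfolding w_def
      by (rule convexD[OF convex_P y(1) z(1)]) (use y z s in \<open>auto simp: s_def add_divide_distrib[symmetric]\<close>)
    have "s *\<^sub>R w = dg u *\<^sub>R y + dg v *\<^sub>R z" using s by (simp add: w_def scaleR_right_distrib)
    then have eq: "u + v = s *\<^sub>R w" using y(2) z(2) by simp
    have "dg (s *\<^sub>R w) \<le> s" using dg_scale[OF P_subset_C[OF w], of s] dg_le_1[OF w] s by (simp add: mult_left_le)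
    then show ?thesis unfolding eq using cone_scale[OF P_subset_C[OF w]] s by simp
  qed
  then show "u + v \<in> C" "dg (u + v) \<le> dg u + dg v" by (auto simp: s_def)
qed

lemma cone_sum: "finite A \<Longrightarrow> (\<And>a. a \<in> A \<Longrightarrow> g a \<in> C) \<Longrightarrow> sum g A \<in> C"
  by (induction A rule: finite_induct) (auto intro: cone_add_dg)

lemma finite_lattice_ball: "finite {u :: real ^ 'n. (\<forall>i. vec_nth u i \<in> \<int>) \<and> norm u \<le> r}"
proof (rule finite_subset)
  let ?F = "PiE UNIV (\<lambda>_::'n. {-\<lceil>r\<rceil>..\<lceil>r\<rceil>})"
  show "finite ((\<lambda>f. \<chi> i. real_of_int (f i)) ` ?F)" by (intro finite_imageI finite_PiE) auto
  show "{u :: real ^ 'n. (\<forall>i. vec_nth u i \<in> \<int>) \<and> norm u \<le> r} \<subseteq> (\<lambda>f. \<chi> i. real_of_int (f i)) ` ?F"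
  proof
    fix u :: "real ^ 'n" assume "u \<in> {u. (\<forall>i. vec_nth u i \<in> \<int>) \<and> norm u \<le> r}"
    then have u: "\<And>i. vec_nth u i \<in> \<int>" "norm u \<le> r" by auto
    define f where "f i = \<lfloor>vec_nth u i\<rfloor>" for i
    have fu: "real_of_int (f i) = vec_nth u i" for i using u(1)[of i] by (simp add: f_def)
    have "f \<in> ?F"
    proof (rule PiE_I)
      fix i
      have "\<bar>vec_nth u i\<bar> \<le> r" using component_le_norm_cart[of u i] u(2) by linarith
      then have "\<bar>real_of_int (f i)\<bar> \<le> r" by (simp add: fu)
      then show "f i \<in> {-\<lceil>r\<rceil>..\<lceil>r\<rceil>}" by (auto simp: le_ceiling_iff minus_le_iff) linarith+
    qed auto
    moreover have "u = (\<chi> i. real_of_int (f i))" by (simp add: fu vec_eq_iff)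
    ultimately show "u \<in> (\<lambda>f. \<chi> i. real_of_int (f i)) ` ?F" by blast
  qed
qed

lemma finite_lattice_le: "finite {u \<in> Lat. dg u \<le> r}"
proof -
  obtain K where K: "\<And>x. x \<in> P \<Longrightarrow> norm x \<le> K" using compact_imp_bounded[OF compact_P] unfolding bounded_iff by blast
  have K0: "K \<ge> 0" using K[OF zero_in_P] by simp
  have "{u \<in> Lat. dg u \<le> r} \<subseteq> {u. (\<forall>i. vec_nth u i \<in> \<int>) \<and> norm u \<le> \<bar>r\<bar> * K}"
  proof
    fix u assume "u \<in> {u \<in> Lat. dg u \<le> r}"
    then have u: "u \<in> C" "\<forall>i. vec_nth u i \<in> \<int>" "dg u \<le> r" by (auto simp: cone_lattice_def)
    obtain z where z: "z \<in> P" "u = dg u *\<^sub>R z" "dg u \<ge> 0" by (rule dg_expand[OF u(1)])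
    have "norm u = dg u * norm z" using z(2,3) by (metis abs_of_nonneg norm_scaleR)
    also have "\<dots> \<le> \<bar>r\<bar> * K" using z K[OF z(1)] u(3) by (intro mult_mono) auto
    finally show "u \<in> {u. (\<forall>i. vec_nth u i \<in> \<int>) \<and> norm u \<le> \<bar>r\<bar> * K}" using u(2) by simp
  qed
  then show ?thesis by (rule finite_subset) (rule finite_lattice_ball)
qed

lemma lattice_in_cone: "u \<in> Lat \<Longrightarrow> u \<in> C" by (simp add: cone_lattice_def)

lemma lattice_zero [simp]: "0 \<in> Lat" by (simp add: cone_lattice_def)

text \<open>Subtracting the integral part of a conic combination of the vertices of a facet changes
  the degree by an integer.\<close>

lemma dg_fractional_part:
  assumes u: "u \<in> Lat"
  obtains w where "w \<in> Lat" "dg w \<le> card S" "dg u - dg w \<in> \<int>"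
proof (cases "u = 0")
  case True
  then show ?thesis using that[of 0] by simp
next
  case False
  obtain F z where F: "F facet_of P" "0 \<notin> F" "z \<in> F" "dg u > 0" "u = dg u *\<^sub>R z"
    using ray_facet[OF lattice_in_cone[OF u] False] by metis
  have "F face_of convex hull (insert 0 S)" using F(1) facet_of_imp_face_of unfolding P_def by blast
  moreover have "compact (insert 0 S)" using finite_S by (intro finite_imp_compact) simp
  ultimately obtain T where T: "T \<subseteq> insert 0 S" "F = convex hull T" using face_of_convex_hull_subset by metis
  have TF: "T \<subseteq> F" unfolding T(2) by (rule hull_subset)
  then have TS: "T \<subseteq> S" using T(1) F(2) by blast
  have fT: "finite T" using TS finite_S by (rule finite_subset)
  obtain l where l: "\<forall>v\<in>T. 0 \<le> l v" "sum l T = 1" "(\<Sum>v\<in>T. l v *\<^sub>R v) = z"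
    using F(3) unfolding T(2) convex_hull_finite[OF fT] by blast
  define c where "c v = dg u * l v" for v
  have uc: "u = (\<Sum>v\<in>T. c v *\<^sub>R v)" by (subst F(5)) (simp add: c_def l(3)[symmetric] scaleR_sum_right)
  have dc: "dg u = sum c T" using l(2) by (simp add: c_def sum_distrib_left[symmetric])
  define w where "w = (\<Sum>v\<in>T. frac (c v) *\<^sub>R v)"
  define s where "s = (\<Sum>v\<in>T. frac (c v))"
  have s0: "s \<ge> 0" by (simp add: s_def sum_nonneg)
  have uw: "u - w = (\<Sum>v\<in>T. real_of_int \<lfloor>c v\<rfloor> *\<^sub>R v)"
    by (simp add: uc w_def sum_subtractf[symmetric] scaleR_left_diff_distrib[symmetric] frac_def)
  have "w \<in> C"
    unfolding w_def using TS S_subset_P by (intro cone_sum[OF fT] cone_scale P_subset_C) auto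
  moreover have "vec_nth w i \<in> \<int>" for i
  proof -
    have "vec_nth (\<Sum>v\<in>T. real_of_int \<lfloor>c v\<rfloor> *\<^sub>R v) i = (\<Sum>v\<in>T. real_of_int \<lfloor>c v\<rfloor> * vec_nth v i)"
      by (simp add: sum_component)
    also have "\<dots> \<in> \<int>" using TS integral_S by (intro Ints_sum Ints_mult) auto
    finally have "vec_nth u i - vec_nth w i \<in> \<int>" unfolding uw[symmetric] by simp
    moreover have "vec_nth u i \<in> \<int>" using u by (simp add: cone_lattice_def)
    ultimately have "vec_nth u i - (vec_nth u i - vec_nth w i) \<in> \<int>" by (rule Ints_diff[rotated])
    then show ?thesis by simp
  qed
  ultimately have w: "w \<in> Lat" by (simp add: cone_lattice_def)
  have "dg w = s"
  proof (cases "s = 0")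
    case True
    then have "\<forall>v\<in>T. frac (c v) = 0" unfolding s_def using fT by (simp add: sum_nonneg_eq_0_iff)
    then have "w = 0" unfolding w_def by (intro sum.neutral) auto
    then show ?thesis using True by simp
  next
    case False
    \<comment> \<open>After division by \<open>s\<close>, \<open>w\<close> is again a convex
      combination of points of \<open>T\<close>, so it lies on the facet and has degree
      \<open>1\<close>.\<close>
    define z' where "z' = (\<Sum>v\<in>T. (frac (c v) / s) *\<^sub>R v)"
    have "z' \<in> F"
      unfolding T(2) convex_hull_finite[OF fT] z'_def using s0 False
      by (auto simp: s_def sum_divide_distrib[symmetric] intro!: exI[of _ "\<lambda>v. frac (c v) / s"])
    moreover have "w = s *\<^sub>R z'" using False by (simp add: w_def z'_def scaleR_sum_right)
    moreover have "z' \<in> C" using \<open>z' \<in> F\<close> facet_of_imp_subset[OF F(1)] P_subset_C by blast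
    ultimately show ?thesis using dg_scale[of z' s] dg_facet[OF F(1,2)] s0 by simp
  qed
  moreover have "s \<le> card S"
  proof -
    have "s \<le> (\<Sum>v\<in>T. 1)" unfolding s_def by (intro sum_mono) (simp add: frac_lt_1 less_imp_le)
    also have "\<dots> = card T" by simp
    also have "\<dots> \<le> card S" using card_mono[OF finite_S TS] by simp
    finally show ?thesis .
  qed
  moreover have "dg u - s = (\<Sum>v\<in>T. real_of_int \<lfloor>c v\<rfloor>)"
    by (simp add: dc s_def sum_subtractf[symmetric] frac_def)
  then have "dg u - s \<in> \<int>" by (simp add: Ints_sum)
  ultimately show ?thesis using that[OF w] by simp
qed

text \<open>Pigeonhole: the remainders of the multiples of \<open>u\<close> lie in a finite set, so
  two multiples share one, and their degrees differ by an integer.\<close>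

lemma dg_rational:
  assumes u: "u \<in> Lat"
  obtains k :: nat where "k \<ge> 1" "real k * dg u \<in> \<int>"
proof -
  have mult: "real k *\<^sub>R u \<in> Lat" for k :: nat
    using u cone_scale[of u "real k"] by (auto simp: cone_lattice_def)
  have "\<exists>w. w \<in> Lat \<and> dg w \<le> card S \<and> dg (real k *\<^sub>R u) - dg w \<in> \<int>" for k
    using dg_fractional_part[OF mult] by metis
  then obtain w where w: "\<And>k. w k \<in> Lat \<and> dg (w k) \<le> card S \<and> dg (real k *\<^sub>R u) - dg (w k) \<in> \<int>" by metis
  have "\<not> inj w"
  proof
    assume "inj w"
    moreover have "range w \<subseteq> {u \<in> Lat. dg u \<le> card S}" using w by auto
    then have "finite (range w)" by (rule finite_subset) (rule finite_lattice_le)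
    ultimately have "finite (UNIV :: nat set)" using finite_imageD by blast
    then show False by simp
  qed
  then obtain i j where "i \<noteq> j" "w i = w j" by (auto simp: inj_def)
  then obtain i j where ij: "i < j" "w i = w j" by (metis nat_neq_iff)
  have d: "dg (real k *\<^sub>R u) = real k * dg u" for k using dg_scale[OF lattice_in_cone[OF u]] by simp
  have "(dg (real j *\<^sub>R u) - dg (w j)) - (dg (real i *\<^sub>R u) - dg (w i)) \<in> \<int>"
    by (rule Ints_diff) (use w in blast)+
  also have "(dg (real j *\<^sub>R u) - dg (w j)) - (dg (real i *\<^sub>R u) - dg (w i)) = real (j - i) * dg u"
    using ij by (simp add: d of_nat_diff algebra_simps)
  finally show ?thesis using that[of "j - i"] ij by simp
qed

abbreviation "Dn \<equiv> deg_denom P"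

text \<open>The finitely many possible remainders have degrees with a common denominator, and every
  degree differs from one of these by an integer. So the \<open>LEAST\<close> in
  \<open>deg_denom\<close> is attained.\<close>

lemma deg_denom: "Dn > 0" "u \<in> Lat \<Longrightarrow> real Dn * dg u \<in> \<int>"
proof -
  let ?W = "{w \<in> Lat. dg w \<le> card S}"
  have "\<forall>w\<in>?W. \<exists>k::nat. k \<ge> 1 \<and> real k * dg w \<in> \<int>" using dg_rational by blast
  from bchoice[OF this] obtain k :: "real ^ 'n \<Rightarrow> nat" where k: "\<forall>w\<in>?W. k w \<ge> 1 \<and> real (k w) * dg w \<in> \<int>" ..
  define D where "D = (\<Prod>w\<in>?W. k w)"
  have D0: "D > 0" unfolding D_def using k by (intro prod_pos) fastforce
  have DW: "real D * dg w \<in> \<int>" if "w \<in> ?W" for w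
  proof -
    have "D = (\<Prod>w\<in>?W - {w}. k w) * k w"
      unfolding D_def using prod.remove[OF finite_lattice_le that, of k] by (simp add: mult.commute)
    then have "real D * dg w = real (\<Prod>w\<in>?W - {w}. k w) * (real (k w) * dg w)" by (simp only: of_nat_mult mult.assoc)
    also have "\<dots> \<in> \<int>" by (rule Ints_mult) (use k that in auto)
    finally show ?thesis .
  qed
  have Du: "\<exists>m::int. dg u = of_int m / real D" if u: "u \<in> Lat" for u
  proof -
    obtain w where w: "w \<in> Lat" "dg w \<le> card S" "dg u - dg w \<in> \<int>" by (rule dg_fractional_part[OF u])
    have "real D * (dg u - dg w) + real D * dg w \<in> \<int>" by (rule Ints_add[OF Ints_mult[OF Ints_of_nat w(3)] DW]) (use w in auto)
    also have "real D * (dg u - dg w) + real D * dg w = real D * dg u" by (simp add: algebra_simps)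
    finally obtain m where "real D * dg u = of_int m" by (auto elim: Ints_cases)
    then show ?thesis using D0 by (intro exI[of _ m]) (simp add: field_simps)
  qed
  have ex: "Dn > 0 \<and> (\<forall>u\<in>Lat. \<exists>m::int. dg u = of_int m / real Dn)"
    unfolding deg_denom_def by (rule LeastI[of _ D]) (use D0 Du in auto)
  then show "Dn > 0" by blast
  show "real Dn * dg u \<in> \<int>" if "u \<in> Lat"
  proof -
    obtain m where "dg u = of_int m / real Dn" using ex \<open>u \<in> Lat\<close> by blast
    then have "real Dn * dg u = of_int m" using ex by simp
    then show ?thesis by simp
  qed
qed

lemma dg_level:
  assumes "u \<in> Lat"
  obtains j :: nat where "dg u = real j / real Dn"
proof -
  obtain m where m: "real Dn * dg u = of_int m" using deg_denom(2)[OF assms] by (auto elim: Ints_cases)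
  then have "m \<ge> 0" using dg_nonneg[OF lattice_in_cone[OF assms]] by (metis mult_nonneg_nonneg of_int_0_le_iff of_nat_0_le_iff)
  then have "real Dn * dg u = real (nat m)" using m by simp
  then show ?thesis using that[of "nat m"] deg_denom(1) by (simp add: field_simps)
qed

section \<open>Supporting lines of the Hodge polygon\<close>

lemma sum_below_level:
  "(\<Sum>u | u \<in> Lat \<and> dg u < real j / real Dn. g (dg u)) = (\<Sum>i<j. real (W_count P i) * g (real i / real Dn))"
    for g :: "real \<Rightarrow> real"
proof -
  let ?A = "{u \<in> Lat. dg u < real j / real Dn}"
  let ?h = "\<lambda>u. nat \<lfloor>real Dn * dg u\<rfloor>"
  have fin: "finite ?A" by (rule finite_subset[OF _ finite_lattice_le[of "real j / real Dn"]]) auto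
  have D: "real Dn > 0" using deg_denom(1) by simp
  have lev: "?h u = i \<longleftrightarrow> dg u = real i / real Dn" if uML: "u \<in> Lat" for u i
  proof -
    obtain k where "dg u = real k / real Dn" by (rule dg_level[OF uML])
    then show ?thesis using D by simp
  qed
  have img: "?h ` ?A \<subseteq> {..<j}"
  proof
    fix i assume "i \<in> ?h ` ?A"
    then obtain u where u: "u \<in> Lat" "dg u < real j / real Dn" "i = ?h u" by blast
    then have "real i / real Dn < real j / real Dn" using lev[of u i] by simp
    then show "i \<in> {..<j}" using D by (simp add: divide_less_cancel)
  qed
  have "(\<Sum>i<j. \<Sum>u\<in>{u \<in> ?A. ?h u = i}. g (dg u)) = (\<Sum>u\<in>?A. g (dg u))"
    by (rule sum.group[OF fin finite_lessThan img])
  moreover have "(\<Sum>u\<in>{u \<in> ?A. ?h u = i}. g (dg u)) = real (W_count P i) * g (real i / real Dn)" if "i < j" for i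
  proof -
    have "{u \<in> ?A. ?h u = i} = {u \<in> Lat. dg u = real i / real Dn}"
      using lev that D by (auto simp: divide_less_cancel)
    then show ?thesis by (simp add: W_count_def)
  qed
  ultimately show ?thesis by simp
qed

text \<open>The line of slope \<open>a (p - 1) j / D\<close> through vertex number \<open>j\<close>,
  that is, the prolongation of the edge starting there. As the slopes increase with
  \<open>j\<close>, lying above all these lines is lying above the polygon, within its
  range.\<close>

definition hp_line :: "nat \<Rightarrow> nat \<Rightarrow> nat \<Rightarrow> real \<Rightarrow> real" where
  "hp_line p a j x = real a * (real p - 1) *
     (real j / real Dn * x - (\<Sum>i<j. real (W_count P i) * (real j / real Dn - real i / real Dn)))"

text \<open>At level \<open>l = j / D\<close>, the sum of \<open>l - dg u\<close> over
  \<open>T\<close> is at most the sum over all pairs with \<open>dg u < l\<close>, where each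
  \<open>u\<close> occurs with \<open>a\<close> second components. This bounds the degrees from
  below without sorting them.\<close>

lemma sum_degrees_ge_line:
  assumes T: "finite T" "T \<subseteq> Lat \<times> {..<a}" "card T = a * k" and p: "p \<ge> 1"
  shows "hp_line p a j (real k) \<le> (real p - 1) * (\<Sum>(u, i)\<in>T. dg u)"
proof -
  let ?l = "real j / real Dn"
  let ?A = "{u \<in> Lat. dg u < ?l}"
  have finA: "finite ?A" by (rule finite_subset[OF _ finite_lattice_le[of ?l]]) auto
  have "real (a * k) * ?l - (\<Sum>(u, i)\<in>T. dg u) = (\<Sum>(u, i)\<in>T. ?l - dg u)"
    by (simp add: sum_subtractf case_prod_unfold T(3))
  also have "\<dots> \<le> (\<Sum>(u, i)\<in>T. if dg u < ?l then ?l - dg u else 0)"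
    by (intro sum_mono) auto
  also have "\<dots> = (\<Sum>(u, i)\<in>T \<inter> (?A \<times> {..<a}). ?l - dg u)"
    using T(1,2) by (intro sum.mono_neutral_cong_right) (auto split: if_splits)
  also have "\<dots> \<le> (\<Sum>(u, i)\<in>?A \<times> {..<a}. ?l - dg u)"
    using finA by (intro sum_mono2) auto
  also have "\<dots> = (\<Sum>u\<in>?A. \<Sum>i<a. ?l - dg u)" by (rule sum.cartesian_product[symmetric])
  also have "\<dots> = real a * (\<Sum>u\<in>?A. ?l - dg u)" by (simp add: sum_distrib_left)
  also have "(\<Sum>u\<in>?A. ?l - dg u) = (\<Sum>i<j. real (W_count P i) * (?l - real i / real Dn))"
    by (rule sum_below_level)
  finally have "real a * (?l * real k - (\<Sum>i<j. real (W_count P i) * (?l - real i / real Dn))) \<le> (\<Sum>(u, i)\<in>T. dg u)"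
    by (simp add: algebra_simps)
  then have "(real p - 1) * (real a * (?l * real k - (\<Sum>i<j. real (W_count P i) * (?l - real i / real Dn)))) \<le>
      (real p - 1) * (\<Sum>(u, i)\<in>T. dg u)"
    using p by (intro mult_left_mono) auto
  then show ?thesis unfolding hp_line_def by (simp only: mult_ac)
qed

text \<open>Meant for a polygon that ends, where the partial sums of \<open>W_count\<close> are
  bounded: no larger set of indices exists, so the coefficients beyond the end vanish.\<close>

lemma card_le_total_count:
  assumes T: "finite T" "T \<subseteq> Lat \<times> {..<a}" "card T = a * k" and a: "a \<ge> 1"
    and bound: "\<forall>j. (\<Sum>i<j. real (W_count P i)) \<le> x"
  shows "real k \<le> x"
proof -
  let ?U = "fst ` T"
  have fU: "finite ?U" using T(1) by simp
  have "T \<subseteq> ?U \<times> {..<a}" using T(2) by force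
  then have "a * k \<le> card ?U * a" using card_mono[of "?U \<times> {..<a}" T] fU T(3) by (simp add: card_cartesian_product)
  then have kU: "k \<le> card ?U" using a by (simp add: mult.commute)
  define r where "r = (\<Sum>u\<in>?U. dg u)"
  \<comment> \<open>A level above all degrees in \<open>?U\<close>, since each of them is at most
    their sum \<open>r\<close>.\<close>
  define j where "j = nat \<lceil>real Dn * r\<rceil> + 1"
  have UM: "?U \<subseteq> Lat" using T(2) by force
  have "dg u < real j / real Dn" if u: "u \<in> ?U" for u
  proof -
    have "dg u \<le> r" unfolding r_def using fU UM dg_nonneg lattice_in_cone u by (intro member_le_sum) auto
    then have "real Dn * dg u \<le> real Dn * r" using deg_denom(1) by simp
    also have "\<dots> < real j" unfolding j_def by linarith
    finally show ?thesis using deg_denom(1) by (simp add: field_simps)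
  qed
  then have sub: "?U \<subseteq> {u. u \<in> Lat \<and> dg u < real j / real Dn}" using UM by blast
  have fin: "finite {u. u \<in> Lat \<and> dg u < real j / real Dn}"
    by (rule finite_subset[OF _ finite_lattice_le[of "real j / real Dn"]]) auto
  have "real k \<le> real (card ?U)" using kU by simp
  also have "\<dots> \<le> (\<Sum>u | u \<in> Lat \<and> dg u < real j / real Dn. 1)" using card_mono[OF fin sub] by simp
  also have "\<dots> = (\<Sum>i<j. real (W_count P i))" using sum_below_level[where j = j and g = "\<lambda>_. 1"] by simp
  also have "\<dots> \<le> x" using bound by blast
  finally show ?thesis .
qed

text \<open>The conditions on the points of \<open>Q\<close> cut out half-planes, so they pass to
  the convex hull. Over the abscissa \<open>x\<close> the polygon has an edge \<open>j\<close>, and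
  on it the polygon is met by \<open>hp_line p a j\<close>.\<close>

lemma HP_le_hull:
  assumes pts: "\<And>x y. (x, y) \<in> Q \<Longrightarrow> 0 \<le> x \<and> (\<forall>j. hp_line p a j x \<le> y) \<and>
      (\<forall>xm. (\<forall>j. (\<Sum>i<j. real (W_count P i)) \<le> xm) \<longrightarrow> x \<le> xm)"
  shows "HP_q p a P x \<le> lower_boundary (convex hull Q) x"
  unfolding lower_boundary_def[of "convex hull Q"]
proof (rule INF_greatest)
  fix y assume "y \<in> {y. (x, y) \<in> convex hull Q}"
  then have xy: "(x, y) \<in> convex hull Q" by simp
  let ?V = "\<lambda>j. \<Sum>i<j. real (W_count P i)"
  let ?H = "({v. 0 \<le> fst v} \<inter> (\<Inter>j. {v. hp_line p a j (fst v) \<le> snd v})) \<inter>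
      (\<Inter>xm\<in>{xm. \<forall>j. ?V j \<le> xm}. {v. fst v \<le> xm}) :: (real \<times> real) set"
  have c1: "convex {v :: real \<times> real. 0 \<le> fst v}"
    using convex_halfspace_ge[of 0 "(1::real, 0::real)"] by (simp add: inner_prod_def)
  have c2: "convex {v :: real \<times> real. fst v \<le> xm}" for xm
    using convex_halfspace_le[of "(1::real, 0::real)" xm] by (simp add: inner_prod_def)
  have c3: "convex {v :: real \<times> real. hp_line p a j (fst v) \<le> snd v}" for j
  proof -
    define m where "m = real a * (real p - 1) * (real j / real Dn)"
    define c where "c = - (real a * (real p - 1) * (\<Sum>i<j. real (W_count P i) * (real j / real Dn - real i / real Dn)))"
    have "hp_line p a j x = m * x + c" for x
      unfolding hp_line_def m_def c_def right_diff_distrib[of "real a * (real p - 1)"] by (simp only: mult.assoc diff_conv_add_uminus)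
    then show ?thesis
      using convex_halfspace_le[of "(m, -1::real)" "- c"] by (simp add: inner_prod_def algebra_simps)
  qed
  have "convex ?H" by (intro convex_Int convex_INT c1 c2 c3)
  moreover have "Q \<subseteq> ?H" using pts by fastforce
  ultimately have "convex hull Q \<subseteq> ?H" by (intro hull_minimal)
  then have H: "0 \<le> x" "\<And>j. hp_line p a j x \<le> y" "\<And>xm. \<forall>j. ?V j \<le> xm \<Longrightarrow> x \<le> xm" using xy by auto
  have fst: "fst (hodge_vertex p a P j) = ?V j" for j by (simp add: hodge_vertex_def)
  \<comment> \<open>If \<open>x\<close> were beyond all vertices, the integer counts would be
    bounded and attain a maximum, and the condition on the range would put \<open>x\<close> below
    that maximum.\<close>
  have "\<exists>j. x \<le> ?V j"
  proof (rule ccontr)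
    assume no: "\<not> (\<exists>j. x \<le> ?V j)"
    let ?N = "\<lambda>j. \<Sum>i<j. W_count P i"
    have "?N j \<le> nat \<lceil>x\<rceil>" for j
    proof -
      have "?V j < x" using no by (meson not_le)
      then have "real (?N j) \<le> x" by simp
      then show ?thesis by linarith
    qed
    then have "range ?N \<subseteq> {..nat \<lceil>x\<rceil>}" by blast
    then have fin: "finite (range ?N)" by (rule finite_subset) simp
    have "Max (range ?N) \<in> range ?N" by (rule Max_in[OF fin]) simp
    then obtain j0 where j0: "Max (range ?N) = ?N j0" by blast
    have "?N j \<le> ?N j0" for j unfolding j0[symmetric] by (rule Max_ge[OF fin]) simp
    then have "\<forall>j. ?V j \<le> ?V j0" by (metis of_nat_le_iff of_nat_sum)
    then have "x \<le> ?V j0" by (rule H(3))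
    then show False using no by blast
  qed
  then have "x \<le> ?V (LEAST j. x \<le> ?V j)" by (rule LeastI_ex)
  moreover define J where "J = (LEAST j. x \<le> ?V j)"
  ultimately have J: "x \<le> ?V J" by simp
  have Jmin: "?V j < x" if "j < J" for j using not_less_Least[of j] that unfolding J_def by fastforce
  obtain j where j: "?V j \<le> x" "x \<le> ?V (Suc j)"
  proof (cases J)
    case 0
    then have "x = 0" using J H(1) by simp
    then show ?thesis using that[of 0] by simp
  next
    case (Suc j)
    then show ?thesis using that[of j] J Jmin[of j] by simp
  qed
  let ?c = "real a * (real p - 1)"
  let ?w = "real (W_count P j)"
  define Y where "Y = ?c * (\<Sum>i<j. real i / real Dn * real (W_count P i))"
  have vj: "hodge_vertex p a P j = (?V j, Y)" by (simp add: hodge_vertex_def Y_def)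
  have vSj: "hodge_vertex p a P (Suc j) = (?V j + ?w, Y + ?c * (real j / real Dn) * ?w)"
    by (simp add: hodge_vertex_def Y_def distrib_left mult.assoc)
  have line: "hp_line p a j x = Y + ?c * (real j / real Dn) * (x - ?V j)"
  proof -
    define l where "l = real j / real Dn"
    define s where "s = (\<Sum>i<j. real i / real Dn * real (W_count P i))"
    have "(\<Sum>i<j. real (W_count P i) * (l - real i / real Dn)) = l * ?V j - s"
      by (simp add: s_def right_diff_distrib sum_subtractf sum_distrib_left mult.commute)
    then have "hp_line p a j x = ?c * (l * x - (l * ?V j - s))"
      unfolding hp_line_def l_def by simp
    then show ?thesis unfolding Y_def l_def[symmetric] s_def[symmetric] by (simp add: algebra_simps)
  qed
  have "(x, hp_line p a j x) \<in> closed_segment (hodge_vertex p a P j) (hodge_vertex p a P (Suc j))"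
  \<comment> \<open>An empty level gives an edge of length zero, whose only point has abscissa
    \<open>x\<close>.\<close>
  proof (cases "?w = 0")
    case True
    then have "x = ?V j" using j by simp
    then show ?thesis unfolding vj line by simp
  next
    case False
    define t where "t = (x - ?V j) / ?w"
    have t: "0 \<le> t" "t \<le> 1" "x = ?V j + t * ?w" using False j by (auto simp: t_def field_simps)
    have "(x, hp_line p a j x) = (1 - t) *\<^sub>R hodge_vertex p a P j + t *\<^sub>R hodge_vertex p a P (Suc j)"
    proof -
      define l where "l = ?c * (real j / real Dn)"
      have xv: "x - ?V j = t * ?w" using t(3) by simp
      have "x = (1 - t) * ?V j + t * (?V j + ?w)" using t(3) by (simp add: algebra_simps)
      moreover have "Y + l * (x - ?V j) = (1 - t) * Y + t * (Y + l * ?w)"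
        unfolding xv by (simp add: algebra_simps)
      ultimately show ?thesis
        unfolding vj vSj line l_def[symmetric] by (simp only: scaleR_Pair add_Pair real_scaleR_def)
    qed
    then show ?thesis unfolding closed_segment_def using t by blast
  qed
  then have "HP_q p a P x \<le> ereal (hp_line p a j x)"
    unfolding HP_q_def lower_boundary_def by (intro INF_lower) blast
  also have "\<dots> \<le> ereal y" using H(2) by simp
  finally show "HP_q p a P x \<le> ereal y" .
qed

end

section \<open>Laurent polynomials\<close>

lemma poly_mapping_sum_singles:
  "F = (\<Sum>u\<in>Poly_Mapping.keys F. Poly_Mapping.single u (Poly_Mapping.lookup F u))"
proof (rule poly_mapping_eqI)
  fix k
  have "Poly_Mapping.lookup (\<Sum>u\<in>Poly_Mapping.keys F. Poly_Mapping.single u (Poly_Mapping.lookup F u)) k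
    = (\<Sum>u\<in>Poly_Mapping.keys F. if u = k then Poly_Mapping.lookup F u else 0)"
    unfolding lookup_sum by (intro sum.cong refl) (simp add: lookup_single when_def)
  also have "\<dots> = Poly_Mapping.lookup F k"
    by (simp add: in_keys_iff)
  finally show "Poly_Mapping.lookup F k =
    Poly_Mapping.lookup (\<Sum>u\<in>Poly_Mapping.keys F. Poly_Mapping.single u (Poly_Mapping.lookup F u)) k" by simp
qed

lemma lookup_times_single:
  fixes A :: "('a::ab_group_add) \<Rightarrow>\<^sub>0 ('b::semiring_0)"
  shows "Poly_Mapping.lookup (A * Poly_Mapping.single k b) m = Poly_Mapping.lookup A (m - k) * b"
proof -
  have "A * Poly_Mapping.single k b =
      (\<Sum>u\<in>Poly_Mapping.keys A. Poly_Mapping.single u (Poly_Mapping.lookup A u)) * Poly_Mapping.single k b"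
    using poly_mapping_sum_singles[of A] by simp
  also have "\<dots> = (\<Sum>u\<in>Poly_Mapping.keys A. Poly_Mapping.single (u + k) (Poly_Mapping.lookup A u * b))"
    by (simp add: sum_distrib_right mult_single)
  finally have "Poly_Mapping.lookup (A * Poly_Mapping.single k b) m =
      (\<Sum>u\<in>Poly_Mapping.keys A. if u = m - k then Poly_Mapping.lookup A u * b else 0)"
    by (auto simp: lookup_sum lookup_single when_def algebra_simps intro!: sum.cong)
  then show ?thesis by (simp add: in_keys_iff)
qed

definition monomial_eval :: "'k::field ^ 'n::finite \<Rightarrow> int ^ 'n \<Rightarrow> 'k" where
  "monomial_eval x u = (\<Prod>i\<in>UNIV. vec_nth x i powi vec_nth u i)"

lemma laurent_eval_eq: "laurent_eval F x = (\<Sum>u\<in>Poly_Mapping.keys F. Poly_Mapping.lookup F u * monomial_eval x u)"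
  by (simp add: laurent_eval_def monomial_eval_def)

lemma laurent_eval_superset:
  assumes "finite A" "Poly_Mapping.keys F \<subseteq> A"
  shows "laurent_eval F x = (\<Sum>u\<in>A. Poly_Mapping.lookup F u * monomial_eval x u)"
  unfolding laurent_eval_eq using assms by (intro sum.mono_neutral_left) (auto simp: in_keys_iff)

lemma laurent_eval_add: "laurent_eval (F + G) x = laurent_eval F x + laurent_eval G x"
proof -
  let ?A = "Poly_Mapping.keys F \<union> Poly_Mapping.keys G"
  have "Poly_Mapping.keys (F + G) \<subseteq> ?A" by (rule Poly_Mapping.keys_add)
  then have "laurent_eval (F + G) x = (\<Sum>u\<in>?A. Poly_Mapping.lookup (F + G) u * monomial_eval x u)"
    by (intro laurent_eval_superset) auto
  also have "\<dots> = laurent_eval F x + laurent_eval G x"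
    by (subst (1 2) laurent_eval_superset[of ?A]) (auto simp: lookup_add distrib_right sum.distrib)
  finally show ?thesis .
qed

lemma laurent_eval_zero [simp]: "laurent_eval 0 x = 0" by (simp add: laurent_eval_eq)

lemma laurent_eval_sum: "laurent_eval (sum G A) x = (\<Sum>a\<in>A. laurent_eval (G a) x)"
  by (induction A rule: infinite_finite_induct) (auto simp: laurent_eval_add)

lemma laurent_eval_single: "laurent_eval (Poly_Mapping.single u b) x = b * monomial_eval x u"
  by (cases "b = 0") (auto simp: laurent_eval_eq)

lemma monomial_eval_zero [simp]: "monomial_eval x 0 = 1" by (simp add: monomial_eval_def)

lemma monomial_eval_add:
  assumes "\<And>i. vec_nth x i \<noteq> 0"
  shows "monomial_eval x (u + v) = monomial_eval x u * monomial_eval x v"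
  using assms by (simp add: monomial_eval_def power_int_add prod.distrib)

lemma laurent_eval_one [simp]: "laurent_eval 1 x = 1"
  using laurent_eval_single[of 0 1 x] by simp

lemma laurent_eval_mult:
  assumes "\<And>i. vec_nth x i \<noteq> 0"
  shows "laurent_eval (F * G) x = laurent_eval F x * laurent_eval G x"
proof -
  have "F * G = (\<Sum>u\<in>Poly_Mapping.keys F. \<Sum>v\<in>Poly_Mapping.keys G.
      Poly_Mapping.single (u + v) (Poly_Mapping.lookup F u * Poly_Mapping.lookup G v))"
    by (subst poly_mapping_sum_singles[of F], subst poly_mapping_sum_singles[of G])
      (simp add: sum_product mult_single)
  then have "laurent_eval (F * G) x = (\<Sum>u\<in>Poly_Mapping.keys F. \<Sum>v\<in>Poly_Mapping.keys G.
      (Poly_Mapping.lookup F u * Poly_Mapping.lookup G v) * monomial_eval x (u + v))"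
    by (simp only: laurent_eval_sum laurent_eval_single)
  then show ?thesis
    by (simp add: laurent_eval_eq[of F] laurent_eval_eq[of G] sum_product monomial_eval_add[OF assms] mult_ac)
qed

lemma laurent_eval_diff: "laurent_eval (F - G) x = laurent_eval F x - laurent_eval G x"
  using laurent_eval_add[of "F - G" G x] by simp

lemma laurent_eval_of_nat: "laurent_eval (of_nat n) x = of_nat n"
  by (induction n) (auto simp: laurent_eval_add)

lemma laurent_eval_prod:
  assumes "\<And>i. vec_nth x i \<noteq> 0"
  shows "laurent_eval (prod G A) x = (\<Prod>a\<in>A. laurent_eval (G a) x)"
  by (induction A rule: infinite_finite_induct) (auto simp: laurent_eval_mult[OF assms])

definition expo_scale :: "nat \<Rightarrow> int ^ 'n::finite \<Rightarrow> int ^ 'n" where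
  "expo_scale c u = (\<chi> i. int c * vec_nth u i)"

lemma expo_scale_nth [simp]: "vec_nth (expo_scale c u) i = int c * vec_nth u i"
  by (simp add: expo_scale_def)

lemma expo_scale_mult: "expo_scale c (expo_scale d u) = expo_scale (c * d) u"
  by (simp add: Finite_Cartesian_Product.vec_eq_iff mult.assoc)

lemma expo_scale_diff: "expo_scale c (u - v) = expo_scale c u - expo_scale c v"
  by (simp add: Finite_Cartesian_Product.vec_eq_iff right_diff_distrib)

lemma expo_scale_one [simp]: "expo_scale 1 u = u" "expo_scale (Suc 0) u = u"
  by (simp_all add: Finite_Cartesian_Product.vec_eq_iff)

lemma expo_scale_inj: "c > 0 \<Longrightarrow> expo_scale c u = expo_scale c v \<longleftrightarrow> u = v"
  by (auto simp: Finite_Cartesian_Product.vec_eq_iff)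

text \<open>Substitution of \<open>x ^ c\<close> for \<open>x\<close>, by which a later factor
  enters the product of the splitting series.\<close>

definition laurent_scale :: "nat \<Rightarrow> (int ^ 'n::finite \<Rightarrow>\<^sub>0 'k::field) \<Rightarrow> (int ^ 'n \<Rightarrow>\<^sub>0 'k)" where
  "laurent_scale c F = (\<Sum>u\<in>Poly_Mapping.keys F. Poly_Mapping.single (expo_scale c u) (Poly_Mapping.lookup F u))"

lemma laurent_eval_scale: "laurent_eval (laurent_scale c F) x = laurent_eval F (\<chi> i. vec_nth x i ^ c)"
proof -
  have "monomial_eval x (expo_scale c u) = monomial_eval (\<chi> i. vec_nth x i ^ c) u" for u
    by (simp add: monomial_eval_def power_int_mult)
  then show ?thesis
    by (simp only: laurent_scale_def laurent_eval_sum laurent_eval_single laurent_eval_eq[of F])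
qed

lemma lookup_times_scale:
  "Poly_Mapping.lookup (A * laurent_scale c F) m =
    (\<Sum>w\<in>Poly_Mapping.keys F. Poly_Mapping.lookup A (m - expo_scale c w) * Poly_Mapping.lookup F w)"
  by (simp add: laurent_scale_def sum_distrib_left lookup_sum lookup_times_single)

text \<open>The binomial coefficient \<open>g choose n\<close>, kept as a product of
  \<open>n\<close> factors so that the degrees of its exponents can be bounded factor by
  factor.\<close>

definition binomial_poly :: "nat \<Rightarrow> (int ^ 'n::finite \<Rightarrow>\<^sub>0 'k::field_char_0) \<Rightarrow> (int ^ 'n \<Rightarrow>\<^sub>0 'k)" where
  "binomial_poly n g = (\<Prod>i = 0..<n. g - of_nat i) * Poly_Mapping.single 0 (1 / fact n)"

lemma laurent_eval_binomial_poly: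
  assumes "\<And>i. vec_nth x i \<noteq> 0"
  shows "laurent_eval (binomial_poly n g) x = laurent_eval g x gchoose n"
  by (simp add: binomial_poly_def laurent_eval_mult[OF assms] laurent_eval_prod[OF assms] laurent_eval_single
      laurent_eval_diff laurent_eval_of_nat gbinomial_prod_rev)

definition laurent_frob :: "nat \<Rightarrow> (int ^ 'n::finite \<Rightarrow>\<^sub>0 'k::field) \<Rightarrow> (int ^ 'n \<Rightarrow>\<^sub>0 'k)" where
  "laurent_frob e g = (\<Sum>u\<in>Poly_Mapping.keys g. Poly_Mapping.single u (Poly_Mapping.lookup g u ^ e))"

lemma lookup_laurent_frob:
  "e > 0 \<Longrightarrow> Poly_Mapping.lookup (laurent_frob e g) u = Poly_Mapping.lookup g u ^ e"
  unfolding laurent_frob_def lookup_sum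
  by (simp add: lookup_single when_def in_keys_iff sum.delta' power_0_left)

lemma laurent_eval_frob:
  "laurent_eval (laurent_frob e g) x = (\<Sum>u\<in>Poly_Mapping.keys g. Poly_Mapping.lookup g u ^ e * monomial_eval x u)"
  by (simp add: laurent_frob_def laurent_eval_sum laurent_eval_single)

lemma monomial_eval_power:
  "monomial_eval (\<chi> i. vec_nth x i ^ c) u = monomial_eval x u ^ c"
  by (simp add: monomial_eval_def prod_power_distrib power_int_power power_int_power' mult.commute)

section \<open>Sums over tuples of roots of unity\<close>

definition vec_tuples :: "'k set \<Rightarrow> ('k ^ 'n::finite) set" where
  "vec_tuples A = {x. \<forall>i. vec_nth x i \<in> A}"

lemma bij_vec_tuples: "bij_betw vec_lambda (PiE UNIV (\<lambda>_. A)) (vec_tuples A)"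
  unfolding bij_betw_def
proof
  show "inj_on vec_lambda (PiE UNIV (\<lambda>_. A))" by (auto simp: inj_on_def vec_lambda_inject)
  show "vec_lambda ` (PiE UNIV (\<lambda>_. A)) = vec_tuples A"
  proof
    show "vec_tuples A \<subseteq> vec_lambda ` (PiE UNIV (\<lambda>_. A))"
    proof
      fix x assume x: "x \<in> vec_tuples A"
      have "x = vec_lambda (vec_nth x)" by (simp add: vec_nth_inverse)
      moreover have "vec_nth x \<in> PiE UNIV (\<lambda>_. A)" using x by (auto simp: vec_tuples_def)
      ultimately show "x \<in> vec_lambda ` (PiE UNIV (\<lambda>_. A))" by (rule image_eqI)
    qed
  qed (auto simp: vec_tuples_def)
qed

lemma finite_vec_tuples: "finite A \<Longrightarrow> finite (vec_tuples A)"
  by (rule bij_betw_finite[OF bij_vec_tuples, THEN iffD1]) (intro finite_PiE, auto)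

lemma sum_vec_tuples_monomial:
  assumes "finite A"
  shows "(\<Sum>x\<in>vec_tuples A. monomial_eval x u) = (\<Prod>i\<in>UNIV. \<Sum>t\<in>A. t powi vec_nth u i)"
proof -
  have "(\<Sum>x\<in>vec_tuples A. monomial_eval x u) = (\<Sum>g\<in>PiE UNIV (\<lambda>_. A). monomial_eval (vec_lambda g) u)"
    by (rule sum.reindex_bij_betw[OF bij_vec_tuples, symmetric])
  also have "\<dots> = (\<Sum>g\<in>PiE UNIV (\<lambda>_. A). \<Prod>i\<in>UNIV. g i powi vec_nth u i)"
    by (simp add: monomial_eval_def)
  also have "\<dots> = (\<Prod>i\<in>UNIV. \<Sum>t\<in>A. t powi vec_nth u i)"
    using assms by (intro prod_sum_PiE[symmetric]) auto
  finally show ?thesis .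
qed

text \<open>Orthogonality of the characters of a cyclic group, by the geometric sum.\<close>

lemma sum_powi_roots:
  fixes g :: "'k::field_char_0"
  assumes N: "N \<ge> 1" and g: "g ^ N = 1" "inj_on (\<lambda>i. g ^ i) {..<N}"
    and A: "A = (\<lambda>i. g ^ i) ` {..<N}"
  shows "(\<Sum>t\<in>A. t powi w) = (if int N dvd w then of_nat N else 0)"
proof -
  have g0: "g \<noteq> 0" using g(1) N by (auto simp: power_0_left)
  have gN: "g powi int N = 1" using g(1) by simp
  have S: "(\<Sum>t\<in>A. t powi w) = (\<Sum>i<N. (g powi w) ^ i)"
    unfolding A by (simp add: sum.reindex[OF g(2)] power_int_power power_int_power' mult.commute)
  have cN: "(g powi w) ^ N = 1"
  proof -
    have "(g powi w) ^ N = (g powi w) powi int N" by simp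
    also have "\<dots> = g powi (w * int N)" by (rule power_int_mult[symmetric])
    also have "w * int N = int N * w" by (rule mult.commute)
    also have "g powi (int N * w) = 1" by (simp only: power_int_mult gN power_int_1_left)
    finally show ?thesis .
  qed
  show ?thesis
  proof (cases "int N dvd w")
    case True
    then obtain k where "w = int N * k" by (auto simp: dvd_def)
    then have "g powi w = 1" using gN by (simp add: power_int_mult)
    then show ?thesis using True S by simp
  next
    case False
    have "g powi w = g powi (int N * (w div int N)) * g powi (w mod int N)"
      using g0 by (simp add: power_int_add[symmetric])
    also have "g powi (int N * (w div int N)) = 1" using gN by (simp only: power_int_mult power_int_1_left)
    also have "g powi (w mod int N) = g ^ nat (w mod int N)"
      using N by (simp add: power_int_def)
    finally have eq: "g powi w = g ^ nat (w mod int N)" by simp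
    have "nat (w mod int N) < N" using N by (simp add: nat_less_iff)
    moreover have "nat (w mod int N) \<noteq> 0"
    proof -
      have "0 \<le> w mod int N" using N by simp
      moreover have "w mod int N \<noteq> 0" using False by (simp add: dvd_eq_mod_eq_0)
      ultimately show ?thesis by simp
    qed
    ultimately have "g ^ nat (w mod int N) \<noteq> g ^ 0"
      using inj_onD[OF g(2), of "nat (w mod int N)" 0] N by auto
    then have "g powi w \<noteq> 1" using eq by simp
    moreover have "(g powi w - 1) * (\<Sum>i<N. (g powi w) ^ i) = 0"
      using cN by (simp add: power_diff_1_eq[symmetric])
    ultimately show ?thesis using False S by simp
  qed
qed

text \<open>Only exponents divisible by \<open>N\<close> survive the summation. \<open>V\<close> may
  be any finite set that contains the quotients, so one truncation set can serve for all
  \<open>H\<close>.\<close>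

lemma sum_laurent_eval_roots:
  fixes H :: "int ^ 'n::finite \<Rightarrow>\<^sub>0 'k::field_char_0"
  assumes N: "N \<ge> 1" and g: "g ^ N = 1" "inj_on (\<lambda>i. g ^ i) {..<N}"
    and A: "A = (\<lambda>i. g ^ i) ` {..<N}"
    and V: "finite V" "\<And>u. Poly_Mapping.lookup H (expo_scale N u) \<noteq> 0 \<Longrightarrow> u \<in> V"
  shows "(\<Sum>x\<in>vec_tuples A. laurent_eval H x) = of_nat N ^ CARD('n) * (\<Sum>u\<in>V. Poly_Mapping.lookup H (expo_scale N u))"
proof -
  have fin: "finite A" unfolding A by simp
  let ?K = "Poly_Mapping.keys H"
  have mon: "(\<Sum>x\<in>vec_tuples A. monomial_eval x w) = (if w \<in> range (expo_scale N) then of_nat N ^ CARD('n) else 0)" for w :: "int ^ 'n"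
  proof (cases "\<forall>i. int N dvd vec_nth w i")
    case True
    then have "w = expo_scale N (\<chi> i. vec_nth w i div int N)" by (simp add: Finite_Cartesian_Product.vec_eq_iff)
    then show ?thesis
      using True unfolding sum_vec_tuples_monomial[OF fin] sum_powi_roots[OF N g A] by auto
  next
    case False
    then have "w \<notin> range (expo_scale N)" by auto
    moreover have "(\<Prod>i\<in>UNIV. if int N dvd vec_nth w i then of_nat N else 0 :: 'k) = 0"
      using False by (intro prod_zero) auto
    ultimately show ?thesis
      unfolding sum_vec_tuples_monomial[OF fin] sum_powi_roots[OF N g A] by simp
  qed
  have "(\<Sum>x\<in>vec_tuples A. laurent_eval H x) = (\<Sum>w\<in>?K. Poly_Mapping.lookup H w * (\<Sum>x\<in>vec_tuples A. monomial_eval x w))"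
    unfolding laurent_eval_eq by (subst sum.swap) (simp add: sum_distrib_left)
  also have "\<dots> = (\<Sum>w\<in>?K \<inter> range (expo_scale N). of_nat N ^ CARD('n) * Poly_Mapping.lookup H w)"
    unfolding mon by (intro sum.mono_neutral_cong_right) auto
  also have "\<dots> = (\<Sum>w\<in>expo_scale N ` V. of_nat N ^ CARD('n) * Poly_Mapping.lookup H w)"
    using V by (intro sum.mono_neutral_left) (auto simp: in_keys_iff)
  also have "\<dots> = (\<Sum>u\<in>V. of_nat N ^ CARD('n) * Poly_Mapping.lookup H (expo_scale N u))"
    using N by (subst sum.reindex) (auto simp: inj_on_def expo_scale_inj)
  finally show ?thesis by (simp add: sum_distrib_left)
qed

section \<open>The transfer matrix\<close>

definition real_vec :: "int ^ 'n::finite \<Rightarrow> real ^ 'n" where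
  "real_vec u = (\<chi> i. real_of_int (vec_nth u i))"

lemma real_vec_arith:
  "real_vec 0 = 0" "real_vec (u + v) = real_vec u + real_vec v" "real_vec (u - v) = real_vec u - real_vec v"
  "real_vec (expo_scale c u) = real c *\<^sub>R real_vec u"
  by (simp_all add: real_vec_def Finite_Cartesian_Product.vec_eq_iff)

lemma real_vec_inj: "inj real_vec"
  by (rule injI) (simp add: real_vec_def Finite_Cartesian_Product.vec_eq_iff)

definition fps_eval :: "'k::field ^ 'n::finite \<Rightarrow> (int ^ 'n \<Rightarrow>\<^sub>0 'k) fps \<Rightarrow> 'k fps" where
  "fps_eval x F = Abs_fps (\<lambda>n. laurent_eval (fps_nth F n) x)"

lemma fps_eval_nth [simp]: "fps_nth (fps_eval x F) n = laurent_eval (fps_nth F n) x"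
  by (simp add: fps_eval_def)

lemma fps_eval_mult:
  assumes "\<And>i. vec_nth x i \<noteq> 0"
  shows "fps_eval x (F * G) = fps_eval x F * fps_eval x G"
  by (rule fps_ext) (simp add: fps_mult_nth laurent_eval_sum laurent_eval_mult[OF assms])

lemma power_iterate_periodic:
  fixes x :: "'k::monoid_mult"
  assumes "x ^ (p ^ a) = x"
  shows "x ^ (p ^ (a * k)) = x"
  using assms by (induction k) (simp_all add: power_add power_mult)

lemma power_frob_mod:
  fixes x :: "'k::monoid_mult"
  assumes "x ^ (p ^ a) = x"
  shows "x ^ (p ^ (j mod a)) = x ^ (p ^ j)"
proof -
  have "x ^ (p ^ j) = x ^ (p ^ (a * (j div a)) * p ^ (j mod a))"
    by (simp add: power_add[symmetric])
  also have "\<dots> = (x ^ (p ^ (a * (j div a)))) ^ (p ^ (j mod a))" by (rule power_mult)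
  finally show ?thesis using power_iterate_periodic[OF assms] by simp
qed

text \<open>The combinatorial side over a general field of characteristic \<open>0\<close>. The
  condition \<open>frob_f\<close> makes the factors periodic in the level with period
  \<open>a\<close>, so that finitely many levels suffice.\<close>

locale toric_exp_sum = lattice_polytope S P for S P :: "(real ^ 'n::finite) set" +
  fixes f :: "int ^ 'n \<Rightarrow>\<^sub>0 'k::field_char_0" and p a :: nat
  assumes p2: "p \<ge> 2" and a1: "a \<ge> 1"
    and keys_P: "\<And>u. u \<in> Poly_Mapping.keys f \<Longrightarrow> real_vec u \<in> P"
    and frob_f: "\<And>u. Poly_Mapping.lookup f u ^ (p ^ a) = Poly_Mapping.lookup f u"
begin

definition supp :: "real \<Rightarrow> (int ^ 'n \<Rightarrow>\<^sub>0 'k) \<Rightarrow> bool" where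
  "supp r F \<longleftrightarrow> (\<forall>w. Poly_Mapping.lookup F w \<noteq> 0 \<longrightarrow> real_vec w \<in> C \<and> dg (real_vec w) \<le> r)"

lemma suppD: "supp r F \<Longrightarrow> Poly_Mapping.lookup F w \<noteq> 0 \<Longrightarrow> real_vec w \<in> C \<and> dg (real_vec w) \<le> r"
  by (simp add: supp_def)

lemma supp_mono: "supp r F \<Longrightarrow> r \<le> s \<Longrightarrow> supp s F"
  unfolding supp_def by fastforce

lemma supp_zero: "supp r 0" by (simp add: supp_def)

lemma supp_add: "supp r F \<Longrightarrow> supp r G \<Longrightarrow> supp r (F + G)"
  unfolding supp_def lookup_add by (metis add.right_neutral diff_zero)

lemma supp_diff: "supp r F \<Longrightarrow> supp r G \<Longrightarrow> supp r (F - G)"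
  unfolding supp_def lookup_minus by (metis add.right_neutral diff_zero)

lemma supp_sum: "(\<And>x. x \<in> A \<Longrightarrow> supp r (F x)) \<Longrightarrow> supp r (sum F A)"
  by (induction A rule: infinite_finite_induct) (auto intro: supp_add supp_zero)

lemma supp_single_0: "r \<ge> 0 \<Longrightarrow> supp r (Poly_Mapping.single 0 b)"
  by (auto simp: supp_def lookup_single when_def real_vec_arith)

lemma supp_mult:
  assumes "supp r F" "supp s G"
  shows "supp (r + s) (F * G)"
  unfolding supp_def
proof (intro allI impI)
  fix w assume "Poly_Mapping.lookup (F * G) w \<noteq> 0"
  then have "w \<in> Poly_Mapping.keys (F * G)" by (simp add: in_keys_iff)
  then obtain u v where uv: "w = u + v" "u \<in> Poly_Mapping.keys F" "v \<in> Poly_Mapping.keys G"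
    using Poly_Mapping.keys_mult[of F G] by blast
  then have "real_vec u \<in> C" "dg (real_vec u) \<le> r" "real_vec v \<in> C" "dg (real_vec v) \<le> s"
    using suppD[OF assms(1), of u] suppD[OF assms(2), of v] by (auto simp: in_keys_iff)
  then show "real_vec w \<in> C \<and> dg (real_vec w) \<le> r + s"
    using cone_add_dg[of "real_vec u" "real_vec v"] by (simp add: uv(1) real_vec_arith)
qed

lemma supp_prod:
  assumes "finite A" "\<And>x. x \<in> A \<Longrightarrow> supp 1 (F x)"
  shows "supp (card A) (prod F A)"
  using assms
proof (induction A rule: finite_induct)
  case empty
  have "supp 0 (Poly_Mapping.single 0 1)" by (rule supp_single_0) simp
  then show ?case by simp
next
  case (insert x A)
  have "supp (1 + real (card A)) (F x * prod F A)" using insert by (intro supp_mult) auto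
  then show ?case using insert by (simp add: add.commute)
qed

lemma supp_binomial_poly:
  assumes "supp 1 g"
  shows "supp (real n) (binomial_poly n g)"
proof -
  have "supp 1 (g - of_nat i)" for i
  proof (rule supp_diff[OF assms])
    show "supp 1 (of_nat i)" unfolding single_of_nat[symmetric] by (rule supp_single_0) simp
  qed
  then have "supp (real (card {0..<n})) (\<Prod>i = 0..<n. g - of_nat i)" by (intro supp_prod) auto
  then have "supp (real n + 0) (binomial_poly n g)"
    unfolding binomial_poly_def by (intro supp_mult supp_single_0) auto
  then show ?thesis by simp
qed

lemma supp_scale:
  assumes "supp r F" "c > 0"
  shows "supp (real c * r) (laurent_scale c F)"
  unfolding laurent_scale_def
proof (rule supp_sum)
  fix u assume "u \<in> Poly_Mapping.keys F"
  then have u: "real_vec u \<in> C" "dg (real_vec u) \<le> r" using suppD[OF assms(1), of u] by (auto simp: in_keys_iff)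
  show "supp (real c * r) (Poly_Mapping.single (expo_scale c u) (Poly_Mapping.lookup F u))"
    unfolding supp_def
  proof (intro allI impI)
    fix w assume "Poly_Mapping.lookup (Poly_Mapping.single (expo_scale c u) (Poly_Mapping.lookup F u)) w \<noteq> 0"
    then have "w = expo_scale c u" by (auto simp: lookup_single when_def split: if_splits)
    then show "real_vec w \<in> C \<and> dg (real_vec w) \<le> real c * r"
      using u cone_scale[OF u(1), of "real c"] dg_scale[OF u(1), of "real c"] by (simp add: real_vec_arith mult_left_mono)
  qed
qed

definition frob_factor :: "nat \<Rightarrow> nat \<Rightarrow> int ^ 'n \<Rightarrow>\<^sub>0 'k" where
  "frob_factor j n = binomial_poly n (laurent_frob (p ^ j) f)"

lemma p_pow_pos: "p ^ j > 0" using p2 by simp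

lemma supp_frob: "supp 1 (laurent_frob (p ^ j) f)"
  unfolding supp_def
proof (intro allI impI)
  fix w assume "Poly_Mapping.lookup (laurent_frob (p ^ j) f) w \<noteq> 0"
  then have "w \<in> Poly_Mapping.keys f" using p_pow_pos[of j] by (auto simp: lookup_laurent_frob in_keys_iff power_0_left)
  then show "real_vec w \<in> C \<and> dg (real_vec w) \<le> 1" using keys_P P_subset_C dg_le_1 by blast
qed

lemma supp_frob_factor: "supp (real n) (frob_factor j n)"
  unfolding frob_factor_def by (rule supp_binomial_poly[OF supp_frob])

lemma frob_factor_mod: "frob_factor (j mod a) n = frob_factor j n"
proof -
  have "laurent_frob (p ^ (j mod a)) f = laurent_frob (p ^ j) f"
    by (rule poly_mapping_eqI) (simp only: lookup_laurent_frob[OF p_pow_pos] power_frob_mod[OF frob_f])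
  then show ?thesis by (simp add: frob_factor_def)
qed

primrec frob_prod :: "nat \<Rightarrow> nat \<Rightarrow> (int ^ 'n \<Rightarrow>\<^sub>0 'k) fps" where
  "frob_prod j 0 = 1"
| "frob_prod j (Suc i) = frob_prod j i * Abs_fps (\<lambda>n. laurent_scale (p ^ i) (frob_factor (j + i) n))"

text \<open>The factor number \<open>l\<close> is taken at \<open>x ^ (p ^ l)\<close>, so a share
  \<open>k\<close> of the \<open>T\<close>-degree adds at most \<open>p ^ l * k\<close>, and
  \<open>p ^ l \<le> p ^ i - 1\<close> for \<open>l < i\<close>. The bound has this form because the
  trace involves exponents \<open>(p ^ i - 1) u\<close>, for which it gives degree at most
  \<open>n\<close> for \<open>u\<close>.\<close>

lemma supp_frob_prod: "supp (real ((p ^ i - 1) * n)) (fps_nth (frob_prod j i) n)"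
proof (induction i arbitrary: n)
  case 0
  have "supp 0 (Poly_Mapping.single 0 (1::'k))" by (rule supp_single_0) simp
  then show ?case by (auto simp: fps_one_nth supp_zero)
next
  case (Suc i)
  have "supp (real ((p ^ Suc i - 1) * n)) (fps_nth (frob_prod j i) k * laurent_scale (p ^ i) (frob_factor (j + i) (n - k)))" if k: "k \<le> n" for k
  proof -
    have "supp (real ((p ^ i - 1) * k) + real (p ^ i) * real (n - k)) (fps_nth (frob_prod j i) k * laurent_scale (p ^ i) (frob_factor (j + i) (n - k)))"
      by (intro supp_mult Suc.IH supp_scale supp_frob_factor p_pow_pos)
    moreover have "real ((p ^ i - 1) * k) + real (p ^ i) * real (n - k) \<le> real ((p ^ Suc i - 1) * n)"
    proof -
      have "2 * p ^ i \<le> p ^ Suc i" using p2 by simp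
      then have le: "p ^ i \<le> p ^ Suc i - 1" using p_pow_pos[of i] by linarith
      have "(p ^ i - 1) * k + p ^ i * (n - k) \<le> (p ^ Suc i - 1) * k + (p ^ Suc i - 1) * (n - k)"
        using le by (intro add_mono mult_le_mono1) auto
      also have "\<dots> = (p ^ Suc i - 1) * n" using k by (simp add: distrib_left[symmetric] del: power_Suc)
      finally show ?thesis unfolding of_nat_mult[symmetric] of_nat_add[symmetric] of_nat_le_iff .
    qed
    ultimately show ?thesis by (rule supp_mono)
  qed
  then show ?case by (auto simp: fps_mult_nth simp del: power_Suc intro!: supp_sum)
qed

text \<open>Starting at level \<open>j\<close> shifts the powers of the coefficients but not those
  of the monomials; a substitution \<open>x ^ (p ^ j)\<close> for \<open>x\<close> later removes
  this asymmetry.\<close>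

lemma fps_eval_frob_prod:
  assumes "\<And>i. vec_nth x i \<noteq> 0"
  shows "fps_eval x (frob_prod j i) =
    fps_binomial (\<Sum>l<i. \<Sum>u\<in>Poly_Mapping.keys f. Poly_Mapping.lookup f u ^ (p ^ (j + l)) * monomial_eval x u ^ (p ^ l))"
proof (induction i)
  case 0
  show ?case by (rule fps_ext) (simp add: fps_one_nth)
next
  case (Suc i)
  let ?x = "\<chi> k. vec_nth x k ^ (p ^ i)"
  have "fps_eval x (Abs_fps (\<lambda>n. laurent_scale (p ^ i) (frob_factor (j + i) n))) =
      fps_binomial (\<Sum>u\<in>Poly_Mapping.keys f. Poly_Mapping.lookup f u ^ (p ^ (j + i)) * monomial_eval x u ^ (p ^ i))"
  proof (rule fps_ext)
    fix n
    have nz: "vec_nth ?x k \<noteq> 0" for k using assms by simp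
    show "fps_nth (fps_eval x (Abs_fps (\<lambda>n. laurent_scale (p ^ i) (frob_factor (j + i) n)))) n =
      fps_nth (fps_binomial (\<Sum>u\<in>Poly_Mapping.keys f. Poly_Mapping.lookup f u ^ (p ^ (j + i)) * monomial_eval x u ^ (p ^ i))) n"
      by (simp add: laurent_eval_scale frob_factor_def laurent_eval_binomial_poly[OF nz] laurent_eval_frob monomial_eval_power)
  qed
  then show ?case by (simp add: fps_eval_mult[OF assms] Suc fps_binomial_add_mult)
qed

section \<open>Truncation by degree, traces of powers and T-adic orders\<close>

definition low_exps :: "nat \<Rightarrow> (int ^ 'n) set" where
  "low_exps N = {u. real_vec u \<in> C \<and> dg (real_vec u) \<le> real N}"

definition mat_index :: "nat \<Rightarrow> ((int ^ 'n) \<times> nat) set" where "mat_index N = low_exps N \<times> {..<a}"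

lemma real_vec_lattice: "real_vec u \<in> Lat \<longleftrightarrow> real_vec u \<in> C"
  by (simp add: cone_lattice_def real_vec_def)

lemma finite_low_exps: "finite (low_exps N)"
proof -
  have "real_vec ` low_exps N \<subseteq> {u \<in> Lat. dg u \<le> real N}" by (auto simp: low_exps_def real_vec_lattice)
  then have "finite (real_vec ` low_exps N)" by (rule finite_subset) (rule finite_lattice_le)
  then show ?thesis using real_vec_inj by (metis finite_imageD inj_on_subset subset_UNIV)
qed

lemma finite_mat_index: "finite (mat_index N)" by (simp add: mat_index_def finite_low_exps)

text \<open>The matrix of multiplication by a splitting factor followed by Dwork's operator, which
  keeps the exponents \<open>p v\<close> and replaces them by \<open>v\<close>. The second
  coordinate steps cyclically, so that consecutive steps use consecutive factors.\<close>

definition transfer_mat :: "(int ^ 'n) \<times> nat \<Rightarrow> (int ^ 'n) \<times> nat \<Rightarrow> 'k fps" where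
  "transfer_mat s t = (if snd t = Suc (snd s) mod a
     then Abs_fps (\<lambda>n. Poly_Mapping.lookup (frob_factor (snd s) n) (expo_scale p (fst t) - fst s)) else 0)"

text \<open>The estimate \<open>(q - 1) n + N \<le> q N\<close> for \<open>n \<le> N\<close> is what
  keeps walks inside the truncated index set.\<close>

lemma low_exps_divide:
  assumes "real_vec y \<in> C" "dg (real_vec y) \<le> real ((q - 1) * n)" "n \<le> N" "u \<in> low_exps N" "q > 0"
    "expo_scale q z = y + u"
  shows "z \<in> low_exps N"
proof -
  have u: "real_vec u \<in> C" "dg (real_vec u) \<le> real N" using assms(4) by (auto simp: low_exps_def)
  have qz: "real q *\<^sub>R real_vec z = real_vec y + real_vec u"
    using arg_cong[OF assms(6), of real_vec] by (simp add: real_vec_arith)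
  have yu: "real_vec y + real_vec u \<in> C" "dg (real_vec y + real_vec u) \<le> real ((q - 1) * n) + real N"
    using cone_add_dg[OF assms(1) u(1)] assms(2) u(2) by auto
  have "(q - 1) * n + N \<le> (q - 1) * N + N" using assms(3) by simp
  also have "\<dots> = q * N" using assms(5) by (simp add: algebra_simps)
  finally have le: "dg (real q *\<^sub>R real_vec z) \<le> real q * real N"
    using yu(2) unfolding qz by (metis of_nat_add of_nat_le_iff of_nat_mult order_trans)
  have z: "real_vec z = (1 / real q) *\<^sub>R (real q *\<^sub>R real_vec z)" using assms(5) by simp
  have zC: "real_vec z \<in> C" by (subst z, rule cone_scale) (use yu(1) in \<open>simp_all add: qz\<close>)
  then have "real q * dg (real_vec z) \<le> real q * real N" using le dg_scale[OF zC, of "real q"] by simp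
  then show ?thesis using zC assms(5) by (simp add: low_exps_def)
qed

text \<open>The last step of a walk: if the last factor contributes the exponent \<open>w\<close>,
  the intermediate index is \<open>z = p v - w\<close>. For \<open>z\<close> outside
  \<open>low_exps N\<close> the coefficient from the earlier factors vanishes.\<close>

lemma lookup_frob_prod_Suc:
  assumes u: "u \<in> low_exps N" and n: "n \<le> N"
  shows "Poly_Mapping.lookup (fps_nth (frob_prod j (Suc i)) n) (expo_scale (p ^ Suc i) v - u) =
    (\<Sum>z\<in>low_exps N. \<Sum>k = 0..n. Poly_Mapping.lookup (fps_nth (frob_prod j i) k) (expo_scale (p ^ i) z - u) *
       Poly_Mapping.lookup (frob_factor (j + i) (n - k)) (expo_scale p v - z))"
proof -
  let ?W = "expo_scale (p ^ Suc i) v - u"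
  have "Poly_Mapping.lookup (fps_nth (frob_prod j i) k * laurent_scale (p ^ i) (frob_factor (j + i) (n - k))) ?W =
      (\<Sum>z\<in>low_exps N. Poly_Mapping.lookup (fps_nth (frob_prod j i) k) (expo_scale (p ^ i) z - u) *
       Poly_Mapping.lookup (frob_factor (j + i) (n - k)) (expo_scale p v - z))" if k: "k \<le> n" for k
  proof -
    let ?F = "fps_nth (frob_prod j i) k" and ?G = "frob_factor (j + i) (n - k)"
    let ?h = "\<lambda>w. expo_scale p v - w"
    let ?g = "\<lambda>z. Poly_Mapping.lookup ?F (expo_scale (p ^ i) z - u) * Poly_Mapping.lookup ?G (?h z)"
    have shift: "?W - expo_scale (p ^ i) w = expo_scale (p ^ i) (?h w) - u" for w
      by (simp add: expo_scale_diff expo_scale_mult mult.commute)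
    have "Poly_Mapping.lookup (?F * laurent_scale (p ^ i) ?G) ?W = (\<Sum>w\<in>Poly_Mapping.keys ?G. ?g (?h w))"
      unfolding lookup_times_scale shift by simp
    also have "\<dots> = (\<Sum>z\<in>?h ` Poly_Mapping.keys ?G. ?g z)"
      by (rule sum.reindex[symmetric, unfolded o_def]) (auto simp: inj_on_def)
    also have "\<dots> = (\<Sum>z\<in>?h ` Poly_Mapping.keys ?G \<inter> low_exps N. ?g z)"
    proof (rule sum.mono_neutral_right)
      show "\<forall>z\<in>?h ` Poly_Mapping.keys ?G - ?h ` Poly_Mapping.keys ?G \<inter> low_exps N. ?g z = 0"
      proof
        fix z assume z: "z \<in> ?h ` Poly_Mapping.keys ?G - ?h ` Poly_Mapping.keys ?G \<inter> low_exps N"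
        have "Poly_Mapping.lookup ?F (expo_scale (p ^ i) z - u) = 0"
        proof (rule ccontr)
          assume "Poly_Mapping.lookup ?F (expo_scale (p ^ i) z - u) \<noteq> 0"
          note s = suppD[OF supp_frob_prod this]
          have kN: "k \<le> N" using k n by (rule order_trans)
          have "z \<in> low_exps N"
            by (rule low_exps_divide[OF conjunct1[OF s] conjunct2[OF s] kN u p_pow_pos]) (rule diff_add_cancel[symmetric])
          then show False using z by blast
        qed
        then show "?g z = 0" by simp
      qed
    qed auto
    also have "\<dots> = (\<Sum>z\<in>low_exps N. ?g z)"
    proof (rule sum.mono_neutral_left[OF finite_low_exps])
      show "\<forall>z\<in>low_exps N - ?h ` Poly_Mapping.keys ?G \<inter> low_exps N. ?g z = 0"
      proof
        fix z assume z: "z \<in> low_exps N - ?h ` Poly_Mapping.keys ?G \<inter> low_exps N"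
        have "?h z \<notin> Poly_Mapping.keys ?G"
        proof
          assume "?h z \<in> Poly_Mapping.keys ?G"
          then have "?h (?h z) \<in> ?h ` Poly_Mapping.keys ?G" by (rule imageI)
          then show False using z by simp
        qed
        then show "?g z = 0" by (simp add: in_keys_iff)
      qed
    qed auto
    finally show ?thesis .
  qed
  then have "Poly_Mapping.lookup (fps_nth (frob_prod j (Suc i)) n) ?W =
    (\<Sum>k = 0..n. \<Sum>z\<in>low_exps N. Poly_Mapping.lookup (fps_nth (frob_prod j i) k) (expo_scale (p ^ i) z - u) *
       Poly_Mapping.lookup (frob_factor (j + i) (n - k)) (expo_scale p v - z))"
    by (simp add: fps_mult_nth lookup_sum del: power_Suc)
  then show ?thesis by (subst sum.swap)
qed

text \<open>Modulo \<open>T ^ (N + 1)\<close> the transfer matrix may be cut off at degree \<open>N\<close>, because paths that start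
  there do not leave the set of exponents of degree at most \<open>N\<close>.\<close>

lemma mpow_transfer_mat:
  assumes "u \<in> low_exps N" "j < a" "v \<in> low_exps N" "j' < a" "n \<le> N"
  shows "fps_nth (mpow (mat_index N) transfer_mat i (u, j) (v, j')) n =
    (if j' = (j + i) mod a then Poly_Mapping.lookup (fps_nth (frob_prod j i) n) (expo_scale (p ^ i) v - u) else 0)"
  using assms(3-5)
proof (induction i arbitrary: v j' n)
  case 0
  then show ?case using assms(2)
    by (auto simp: fps_one_nth lookup_one when_def)
next
  case (Suc i)
  let ?l = "(j + i) mod a"
  have la: "?l < a" using a1 by simp
  let ?L = "\<lambda>k z. Poly_Mapping.lookup (fps_nth (frob_prod j i) k) (expo_scale (p ^ i) z - u)"
  have summand: "(\<Sum>k = 0..n. fps_nth (mpow (mat_index N) transfer_mat i (u, j) (z, l)) k * fps_nth (transfer_mat (z, l) (v, j')) (n - k)) =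
      (if l = ?l then (if j' = (j + Suc i) mod a
        then \<Sum>k = 0..n. ?L k z * Poly_Mapping.lookup (frob_factor (j + i) (n - k)) (expo_scale p v - z) else 0) else 0)"
    if z: "z \<in> low_exps N" and l: "l < a" for z l
  proof -
    have IH: "fps_nth (mpow (mat_index N) transfer_mat i (u, j) (z, l)) k = (if l = ?l then ?L k z else 0)" if "k \<in> {0..n}" for k
      using Suc.IH[OF z l, of k] that Suc.prems by simp
    have B: "fps_nth (transfer_mat (z, ?l) (v, j')) k = (if j' = (j + Suc i) mod a
        then Poly_Mapping.lookup (frob_factor (j + i) k) (expo_scale p v - z) else 0)" for k
      by (simp add: transfer_mat_def frob_factor_mod mod_Suc_eq)
    have "(\<Sum>k = 0..n. fps_nth (mpow (mat_index N) transfer_mat i (u, j) (z, l)) k * fps_nth (transfer_mat (z, l) (v, j')) (n - k)) =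
      (\<Sum>k = 0..n. (if l = ?l then ?L k z else 0) * fps_nth (transfer_mat (z, l) (v, j')) (n - k))"
      by (intro sum.cong refl) (simp only: IH)
    also have "\<dots> = (if l = ?l then \<Sum>k = 0..n. ?L k z * fps_nth (transfer_mat (z, ?l) (v, j')) (n - k) else 0)"
      by auto
    finally show ?thesis unfolding B by auto
  qed
  have "fps_nth (mpow (mat_index N) transfer_mat (Suc i) (u, j) (v, j')) n =
      (\<Sum>(z, l)\<in>mat_index N. \<Sum>k = 0..n. fps_nth (mpow (mat_index N) transfer_mat i (u, j) (z, l)) k * fps_nth (transfer_mat (z, l) (v, j')) (n - k))"
    by (simp add: fps_sum_nth fps_mult_nth case_prod_unfold)
  also have "\<dots> = (\<Sum>z\<in>low_exps N. \<Sum>l<a. \<Sum>k = 0..n. fps_nth (mpow (mat_index N) transfer_mat i (u, j) (z, l)) k * fps_nth (transfer_mat (z, l) (v, j')) (n - k))"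
    unfolding mat_index_def by (rule sum.cartesian_product[symmetric])
  also have "\<dots> = (\<Sum>z\<in>low_exps N. \<Sum>l<a. (if l = ?l then (if j' = (j + Suc i) mod a
        then \<Sum>k = 0..n. ?L k z * Poly_Mapping.lookup (frob_factor (j + i) (n - k)) (expo_scale p v - z) else 0) else 0))"
    by (intro sum.cong refl summand) auto
  also have "\<dots> = (\<Sum>z\<in>low_exps N. if j' = (j + Suc i) mod a
        then \<Sum>k = 0..n. ?L k z * Poly_Mapping.lookup (frob_factor (j + i) (n - k)) (expo_scale p v - z) else 0)"
    using la by simp
  also have "\<dots> = (if j' = (j + Suc i) mod a then Poly_Mapping.lookup (fps_nth (frob_prod j (Suc i)) n) (expo_scale (p ^ Suc i) v - u) else 0)"
    unfolding lookup_frob_prod_Suc[OF assms(1) Suc.prems(3)] by auto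
  finally show ?case .
qed

text \<open>A closed walk returns to its level, so its length is a multiple of \<open>a\<close>;
  then every starting level \<open>j\<close> contributes.\<close>

lemma trace_mpow_transfer_mat:
  assumes n: "n \<le> N"
  shows "fps_nth (\<Sum>s\<in>mat_index N. mpow (mat_index N) transfer_mat i s s) n =
    (if a dvd i then \<Sum>j<a. \<Sum>u\<in>low_exps N. Poly_Mapping.lookup (fps_nth (frob_prod j i) n) (expo_scale (p ^ i - 1) u) else 0)"
proof -
  have md: "j = (j + i) mod a \<longleftrightarrow> a dvd i" if "j < a" for j
  proof -
    have "j = (j + i) mod a \<longleftrightarrow> j mod a = (j + i) mod a" using that by simp
    also have "\<dots> \<longleftrightarrow> a dvd (j + i) - j" by (subst eq_commute, rule mod_eq_dvd_iff_nat) simp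
    finally show ?thesis by simp
  qed
  have sc: "expo_scale (p ^ i) u - u = expo_scale (p ^ i - 1) u" for u :: "int ^ 'n"
    using p_pow_pos[of i] by (simp add: Finite_Cartesian_Product.vec_eq_iff of_nat_diff left_diff_distrib Suc_le_eq)
  have "fps_nth (\<Sum>s\<in>mat_index N. mpow (mat_index N) transfer_mat i s s) n = (\<Sum>u\<in>low_exps N. \<Sum>j<a. fps_nth (mpow (mat_index N) transfer_mat i (u, j) (u, j)) n)"
    unfolding fps_sum_nth by (subst (1) mat_index_def, subst sum.cartesian_product) (simp add: case_prod_unfold)
  also have "\<dots> = (\<Sum>u\<in>low_exps N. \<Sum>j<a. if a dvd i then Poly_Mapping.lookup (fps_nth (frob_prod j i) n) (expo_scale (p ^ i - 1) u) else 0)"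
    using md n by (intro sum.cong refl) (simp add: mpow_transfer_mat sc)
  also have "\<dots> = (\<Sum>j<a. \<Sum>u\<in>low_exps N. if a dvd i then Poly_Mapping.lookup (fps_nth (frob_prod j i) n) (expo_scale (p ^ i - 1) u) else 0)"
    by (rule sum.swap)
  finally show ?thesis by auto
qed

text \<open>This makes \<open>low_exps N\<close> an admissible \<open>V\<close> in the summation
  over roots of unity.\<close>

lemma lookup_frob_prod_in_low_exps:
  assumes "i \<ge> 1" "n \<le> N" "Poly_Mapping.lookup (fps_nth (frob_prod j i) n) (expo_scale (p ^ i - 1) u) \<noteq> 0"
  shows "u \<in> low_exps N"
proof -
  define q where "q = p ^ i - 1"
  have "p ^ 1 \<le> p ^ i" using assms(1) p2 by (intro power_increasing) auto
  then have q: "q > 0" using p2 by (simp add: q_def)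
  have 1: "real q *\<^sub>R real_vec u \<in> C" "dg (real q *\<^sub>R real_vec u) \<le> real (q * n)"
    using suppD[OF supp_frob_prod assms(3), folded q_def, unfolded real_vec_arith] by blast+
  have z: "real_vec u = (1 / real q) *\<^sub>R (real q *\<^sub>R real_vec u)" using q by simp
  have uC: "real_vec u \<in> C" by (subst z, rule cone_scale[OF 1(1)]) simp
  then have "real q * dg (real_vec u) \<le> real q * real n" using 1(2) dg_scale[OF uC, of "real q"] by simp
  then have "dg (real_vec u) \<le> real n" using q by simp
  then show ?thesis using uC assms(2) by (simp add: low_exps_def)
qed

text \<open>A lower bound for the \<open>T\<close>-adic order. It is real-valued, since degrees are
  fractions and the bound for a single matrix entry may be negative, and the zero series satisfies
  it for every \<open>r\<close>.\<close>

definition ordge :: "real \<Rightarrow> 'k fps \<Rightarrow> bool" where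
  "ordge r F \<longleftrightarrow> (\<forall>n. fps_nth F n \<noteq> 0 \<longrightarrow> r \<le> real n)"

lemma ordge_mult:
  assumes "ordge r F" "ordge s G"
  shows "ordge (r + s) (F * G)"
  unfolding ordge_def
proof (intro allI impI)
  fix n assume "fps_nth (F * G) n \<noteq> 0"
  then obtain k where k: "k \<in> {0..n}" "fps_nth F k * fps_nth G (n - k) \<noteq> 0"
    unfolding fps_mult_nth by (meson sum.not_neutral_contains_not_neutral)
  then have "r \<le> real k" "s \<le> real (n - k)" using assms unfolding ordge_def by auto
  then show "r + s \<le> real n" using k(1) by simp
qed

lemma ordge_prod:
  assumes "finite A" "\<And>x. x \<in> A \<Longrightarrow> ordge (r x) (F x)"
  shows "ordge (sum r A) (prod F A)"
  using assms
proof (induction A rule: finite_induct)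
  case empty
  show ?case by (simp add: ordge_def fps_one_nth)
next
  case (insert x A)
  then show ?case using ordge_mult[of "r x" "F x" "sum r A" "prod F A"] by simp
qed

text \<open>Subadditivity gives \<open>p deg v \<le> deg (p v - u) + deg u\<close>, and exponents in
  the coefficient of \<open>T ^ n\<close> have degree at most \<open>n\<close>.\<close>

lemma ordge_transfer_mat:
  assumes "s \<in> mat_index N" "t \<in> mat_index N"
  shows "ordge (real p * dg (real_vec (fst t)) - dg (real_vec (fst s))) (transfer_mat s t)"
  unfolding ordge_def
proof (intro allI impI)
  fix n assume "fps_nth (transfer_mat s t) n \<noteq> 0"
  then have "Poly_Mapping.lookup (frob_factor (snd s) n) (expo_scale p (fst t) - fst s) \<noteq> 0"
    by (auto simp: transfer_mat_def split: if_splits)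
  from suppD[OF supp_frob_factor this] have w: "real p *\<^sub>R real_vec (fst t) - real_vec (fst s) \<in> C"
    "dg (real p *\<^sub>R real_vec (fst t) - real_vec (fst s)) \<le> real n" by (simp_all add: real_vec_arith)
  have C: "real_vec (fst s) \<in> C" "real_vec (fst t) \<in> C" using assms by (auto simp: mat_index_def low_exps_def)
  have "real p * dg (real_vec (fst t)) = dg (real p *\<^sub>R real_vec (fst t))" by (simp add: dg_scale[OF C(2)])
  also have "real p *\<^sub>R real_vec (fst t) = (real p *\<^sub>R real_vec (fst t) - real_vec (fst s)) + real_vec (fst s)" by simp
  also have "dg \<dots> \<le> dg (real p *\<^sub>R real_vec (fst t) - real_vec (fst s)) + dg (real_vec (fst s))"
    by (rule cone_add_dg(2)[OF w(1) C(1)])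
  finally show "real p * dg (real_vec (fst t)) - dg (real_vec (fst s)) \<le> real n" using w(2) by simp
qed

text \<open>Both conclusions are carried as one property of series that is stable under sums. A set
  of \<open>a k\<close> matrix indices, with its exponents read as real vectors, is a set
  \<open>T\<close> as in \<open>sum_degrees_ge_line\<close> and
  \<open>card_le_total_count\<close>.\<close>

lemma rev_char_poly_coeff_bounds:
  assumes h: "inj_on h {..<m}" "h ` {..<m} \<subseteq> mat_index N"
    and nz: "fps_nth (Polynomial.coeff (rev_char_poly m (\<lambda>i j. transfer_mat (h i) (h j))) (a * k)) n \<noteq> 0"
  shows "(\<forall>j. hp_line p a j (real k) \<le> real n) \<and> (\<forall>b. (\<forall>j. (\<Sum>i<j. real (W_count P i)) \<le> b) \<longrightarrow> real k \<le> b)"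
proof -
  define Q where "Q F \<longleftrightarrow> (\<forall>n. fps_nth F n \<noteq> 0 \<longrightarrow> (\<forall>j. hp_line p a j (real k) \<le> real n) \<and>
    (\<forall>b. (\<forall>j. (\<Sum>i<j. real (W_count P i)) \<le> b) \<longrightarrow> real k \<le> b))" for F :: "'k fps"
  have "Q (Polynomial.coeff (rev_char_poly m (\<lambda>i j. transfer_mat (h i) (h j))) (a * k))"
  proof (rule rev_char_poly_coeff_closed)
    show "Q 0" by (simp add: Q_def)
    show "Q (x + y)" if "Q x" "Q y" for x y
      unfolding Q_def
    proof (intro allI impI)
      fix n assume "fps_nth (x + y) n \<noteq> 0"
      then have "fps_nth x n \<noteq> 0 \<or> fps_nth y n \<noteq> 0" by auto
      then show "(\<forall>j. hp_line p a j (real k) \<le> real n) \<and> (\<forall>b. (\<forall>j. (\<Sum>i<j. real (W_count P i)) \<le> b) \<longrightarrow> real k \<le> b)"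
        using that unfolding Q_def by blast
    qed
    show "Q (- x)" if "Q x" for x using that by (simp add: Q_def)
    fix S' \<sigma> assume S': "S' \<subseteq> {..<m}" "card S' = a * k" "\<sigma> permutes S'"
    have fin: "finite S'" using S'(1) finite_subset by blast
    have hI: "h i \<in> mat_index N" if "i \<in> S'" for i using h(2) S'(1) that by blast
    let ?d = "\<lambda>i. dg (real_vec (fst (h i)))"
    have "ordge (\<Sum>i\<in>S'. real p * ?d (\<sigma> i) - ?d i) (\<Prod>i\<in>S'. transfer_mat (h i) (h (\<sigma> i)))"
      using permutes_in_image[OF S'(3)] hI by (intro ordge_prod[OF fin] ordge_transfer_mat) auto
    moreover have "(\<Sum>i\<in>S'. real p * ?d (\<sigma> i) - ?d i) = (real p - 1) * (\<Sum>i\<in>S'. ?d i)"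
    proof -
      have "(\<Sum>i\<in>S'. ?d (\<sigma> i)) = (\<Sum>i\<in>S'. ?d i)"
        using sum.permute[OF S'(3), of ?d] by (simp add: o_def)
      then show ?thesis by (simp add: sum_subtractf sum_distrib_left[symmetric] left_diff_distrib)
    qed
    ultimately have ord: "ordge ((real p - 1) * (\<Sum>i\<in>S'. ?d i)) (\<Prod>i\<in>S'. transfer_mat (h i) (h (\<sigma> i)))" by simp
    let ?g = "\<lambda>i. (real_vec (fst (h i)), snd (h i))"
    have inj: "inj_on ?g S'"
    proof (rule inj_onI)
      fix i j assume ij: "i \<in> S'" "j \<in> S'" "?g i = ?g j"
      then have "h i = h j" using real_vec_inj by (auto simp: inj_def prod_eq_iff)
      then show "i = j" using inj_onD[OF h(1)] ij S'(1) by blast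
    qed
    have T: "finite (?g ` S')" "?g ` S' \<subseteq> Lat \<times> {..<a}" "card (?g ` S') = a * k"
      using fin hI inj S'(2) by (auto simp: card_image mat_index_def low_exps_def real_vec_lattice mem_Times_iff)
    have "(\<Sum>(u, i)\<in>?g ` S'. dg u) = (\<Sum>i\<in>S'. ?d i)" by (subst sum.reindex[OF inj]) simp
    then have line: "hp_line p a j (real k) \<le> (real p - 1) * (\<Sum>i\<in>S'. ?d i)" for j
      using sum_degrees_ge_line[OF T, of p j] p2 by simp
    show "Q (\<Prod>i\<in>S'. transfer_mat (h i) (h (\<sigma> i)))"
      unfolding Q_def
    proof (intro allI impI conjI)
      fix n j assume "fps_nth (\<Prod>i\<in>S'. transfer_mat (h i) (h (\<sigma> i))) n \<noteq> 0"
      then have "(real p - 1) * (\<Sum>i\<in>S'. ?d i) \<le> real n" using ord unfolding ordge_def by blast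
      then show "hp_line p a j (real k) \<le> real n" using line[of j] by simp
    next
      fix b assume "\<forall>j. (\<Sum>i<j. real (W_count P i)) \<le> b"
      then show "real k \<le> b" by (rule card_le_total_count[OF T a1])
    qed
  qed
  then show ?thesis using nz unfolding Q_def by blast
qed

end

lemma mpow_reindex:
  assumes h: "bij_betw h {..<m} I" and "i < m" "j < m"
  shows "mpow {..<m} (\<lambda>i j. B (h i) (h j)) k i j = mpow I B k (h i) (h j)"
  using assms(3)
proof (induction k arbitrary: j)
  case 0
  then show ?case using h assms(2) by (auto simp: bij_betw_def inj_on_def)
next
  case (Suc k)
  have "mpow I B (Suc k) (h i) (h j) = (\<Sum>z<m. mpow I B k (h i) (h z) * B (h z) (h j))"
    using sum.reindex_bij_betw[OF h, of "\<lambda>z. mpow I B k (h i) z * B z (h j)"] by simp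
  then show ?case using Suc by simp
qed

section \<open>Comparison with the exponential sums\<close>

text \<open>Shifting by one drops \<open>t ^ (p ^ j)\<close> and adds
  \<open>t ^ (p ^ (j + m))\<close>, which is the same element.\<close>

lemma frobenius_orbit_sum:
  fixes t :: "'k::comm_ring_1"
  assumes "t ^ (p ^ m) = t"
  shows "(\<Sum>l<m. t ^ (p ^ (j + l))) = (\<Sum>l<m. t ^ (p ^ l))"
proof (induction j)
  case (Suc j)
  have "(\<Sum>l<m. t ^ (p ^ (Suc j + l))) + t ^ (p ^ j) = (\<Sum>l<Suc m. t ^ (p ^ (j + l)))"
    by (simp add: sum.lessThan_Suc_shift del: sum.lessThan_Suc)
  also have "\<dots> = (\<Sum>l<m. t ^ (p ^ (j + l))) + t ^ (p ^ (j + m))" by simp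
  also have "t ^ (p ^ (j + m)) = (t ^ (p ^ m)) ^ (p ^ j)"
    by (simp add: power_add power_mult[symmetric] mult.commute)
  finally show ?case using Suc assms by simp
qed simp

text \<open>On \<open>A\<close> the power \<open>p ^ j\<close> is undone by the power
  \<open>p ^ (m * j - j)\<close>, and an injective self-map of a finite set is onto.\<close>

lemma bij_vec_tuples_power:
  fixes A :: "'k::field set"
  assumes A: "finite A" "\<And>t. t \<in> A \<Longrightarrow> t ^ p \<in> A" "\<And>t. t \<in> A \<Longrightarrow> t ^ (p ^ m) = t" and m: "m \<ge> 1"
  shows "bij_betw (\<lambda>x. \<chi> i. vec_nth x i ^ (p ^ j)) (vec_tuples A :: ('k ^ 'n::finite) set) (vec_tuples A)"
proof -
  have Aj: "t ^ (p ^ j) \<in> A" if "t \<in> A" for t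
    using that by (induction j) (auto simp: power_mult A(2) mult.commute[of p])
  have Aj': "t ^ (p ^ (m * j)) = t" if "t \<in> A" for t
    by (rule power_iterate_periodic[OF A(3)[OF that]])
  have inj: "s = t" if "s \<in> A" "t \<in> A" "s ^ (p ^ j) = t ^ (p ^ j)" for s t
  proof -
    have e: "m * j = j + (m * j - j)" using m by simp
    have "s = (s ^ (p ^ j)) ^ (p ^ (m * j - j))"
      using Aj'[OF that(1)] by (subst (asm) e) (simp add: power_add power_mult)
    also have "\<dots> = (t ^ (p ^ j)) ^ (p ^ (m * j - j))" by (simp only: that(3))
    also have "\<dots> = t" using Aj'[OF that(2)] by (subst (asm) e) (simp add: power_add power_mult)
    finally show ?thesis .
  qed
  have injv: "inj_on (\<lambda>x. \<chi> i. vec_nth x i ^ (p ^ j)) (vec_tuples A :: ('k ^ 'n) set)"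
  proof (rule inj_onI)
    fix x y :: "'k ^ 'n" assume xy: "x \<in> vec_tuples A" "y \<in> vec_tuples A"
      "(\<chi> i. vec_nth x i ^ (p ^ j)) = (\<chi> i. vec_nth y i ^ (p ^ j))"
    then have "vec_nth x i ^ (p ^ j) = vec_nth y i ^ (p ^ j)" for i
      by (simp add: Finite_Cartesian_Product.vec_eq_iff)
    then have "vec_nth x i = vec_nth y i" for i using inj xy(1,2) by (simp add: vec_tuples_def)
    then show "x = y" by (simp add: Finite_Cartesian_Product.vec_eq_iff)
  qed
  moreover have "(\<lambda>x. \<chi> i. vec_nth x i ^ (p ^ j)) ` (vec_tuples A :: ('k ^ 'n) set) \<subseteq> vec_tuples A"
    using Aj by (auto simp: vec_tuples_def)
  ultimately show ?thesis
    unfolding bij_betw_def using endo_inj_surj[OF finite_vec_tuples[OF A(1)]] by blast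
qed

lemma to_ac_gbinomial: "to_ac (b gchoose n) = to_ac (b :: 'k::field_char_0) gchoose n"
proof -
  have "to_ac (fact n :: 'k) = fact n" by (metis of_nat_fact to_ac_of_nat)
  then show ?thesis by (simp add: gbinomial_prod_rev to_ac_prod)
qed

definition fps_to_ac :: "'k::field fps \<Rightarrow> 'k alg_closure fps" where
  "fps_to_ac F = Abs_fps (\<lambda>n. to_ac (fps_nth F n))"

lemma fps_to_ac_nth [simp]: "fps_nth (fps_to_ac F) n = to_ac (fps_nth F n)"
  by (simp add: fps_to_ac_def)

lemma fps_to_ac_mult: "fps_to_ac (F * G) = fps_to_ac F * fps_to_ac G"
  by (rule fps_ext) (simp add: fps_mult_nth to_ac_sum)

lemma fps_to_ac_sum: "fps_to_ac (sum g A) = (\<Sum>x\<in>A. fps_to_ac (g x))"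
  by (rule fps_ext) (simp add: fps_sum_nth to_ac_sum)

lemma fps_to_ac_one: "fps_to_ac 1 = 1"
  by (rule fps_ext) (simp add: fps_one_nth)

lemma fps_to_ac_of_nat: "fps_to_ac (of_nat n) = of_nat n"
  by (rule fps_ext) (simp add: fps_of_nat[symmetric])

text \<open>This says \<open>e (X) = c (X ^ a)\<close> modulo \<open>T ^ (N + 1)\<close>. Both sides
  obey Newton recursions, whose coefficient at \<open>T ^ n\<close> involves the traces only up to
  \<open>T ^ n\<close>, so traces that are right up to \<open>T ^ N\<close> are enough. For
  \<open>m = a k\<close> the factor \<open>a\<close> of \<open>Tr\<close> cancels against that of
  \<open>m\<close>. The minus sign arises because \<open>\<tau>\<close> belongs to an exponential
  and \<open>Tr\<close> to a determinant.\<close>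

lemma newton_recursion_truncated:
  fixes e Tr c \<tau> :: "nat \<Rightarrow> 'k::field_char_0 fps"
  assumes a: "a \<ge> 1" and e0: "e 0 = 1" and c0: "c 0 = 1"
    and recE: "\<And>m. of_nat (Suc m) * e (Suc m) = - (\<Sum>l\<le>m. e l * Tr (Suc m - l))"
    and recC: "\<And>k. of_nat (Suc k) * c (Suc k) = (\<Sum>l\<le>k. c l * \<tau> (Suc k - l))"
    and Tr: "\<And>i n. i \<ge> 1 \<Longrightarrow> n \<le> N \<Longrightarrow>
      fps_nth (Tr i) n = (if a dvd i then - (of_nat a * fps_nth (\<tau> (i div a)) n) else 0)"
    and n: "n \<le> N"
  shows "fps_nth (e m) n = (if a dvd m then fps_nth (c (m div a)) n else 0)"
  using n
proof (induction m arbitrary: n rule: less_induct)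
  case (less m)
  show ?case
  proof (cases m)
    case 0
    then show ?thesis by (simp add: e0 c0)
  next
    case (Suc m')
    have nth_of_nat: "fps_nth (of_nat k * F) j = of_nat k * fps_nth F j" for k j and F :: "'k fps"
      by (simp add: fps_of_nat[symmetric])
    let ?h = "\<lambda>l. of_nat a * fps_nth (c l * \<tau> (m div a - l)) n"
    have "of_nat m * fps_nth (e m) n = - (\<Sum>l\<le>m'. \<Sum>i=0..n. fps_nth (e l) i * fps_nth (Tr (m - l)) (n - i))"
      using arg_cong[OF recE[of m'], of "\<lambda>F. fps_nth F n"] unfolding nth_of_nat Suc[symmetric]
      by (simp add: fps_sum_nth fps_mult_nth)
    also have "(\<Sum>l\<le>m'. \<Sum>i=0..n. fps_nth (e l) i * fps_nth (Tr (m - l)) (n - i)) =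
        (\<Sum>l\<le>m'. if a dvd l \<and> a dvd m then - ?h (l div a) else 0)"
    proof (rule sum.cong[OF refl])
      fix l assume l: "l \<in> {..m'}"
      have "(\<Sum>i=0..n. fps_nth (e l) i * fps_nth (Tr (m - l)) (n - i)) =
        (\<Sum>i=0..n. (if a dvd l then fps_nth (c (l div a)) i else 0) *
          (if a dvd m - l then - (of_nat a * fps_nth (\<tau> ((m - l) div a)) (n - i)) else 0))"
      proof (rule sum.cong[OF refl])
        fix i assume i: "i \<in> {0..n}"
        have "fps_nth (e l) i = (if a dvd l then fps_nth (c (l div a)) i else 0)"
          by (rule less.IH) (use l i Suc less.prems in auto)
        moreover have "fps_nth (Tr (m - l)) (n - i) = (if a dvd m - l then - (of_nat a * fps_nth (\<tau> ((m - l) div a)) (n - i)) else 0)"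
          by (rule Tr) (use l i Suc less.prems in auto)
        ultimately show "fps_nth (e l) i * fps_nth (Tr (m - l)) (n - i) = (if a dvd l then fps_nth (c (l div a)) i else 0) *
          (if a dvd m - l then - (of_nat a * fps_nth (\<tau> ((m - l) div a)) (n - i)) else 0)" by simp
      qed
      also have "\<dots> = (if a dvd l \<and> a dvd m then - ?h (l div a) else 0)"
      proof (cases "a dvd l")
        case True
        have lm: "l \<le> m" using l Suc by simp
        have dv: "a dvd m - l \<longleftrightarrow> a dvd m" using dvd_add_left_iff[OF True, of "m - l"] lm by simp
        have "(m - l) div a = m div a - l div a" if "a dvd m" using that True a by (auto simp: dvd_def diff_mult_distrib2[symmetric])
        then show ?thesis using True dv
          by (auto simp: fps_mult_nth sum_distrib_left sum_negf mult_ac)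
      qed simp
      finally show "(\<Sum>i=0..n. fps_nth (e l) i * fps_nth (Tr (m - l)) (n - i)) =
        (if a dvd l \<and> a dvd m then - ?h (l div a) else 0)" .
    qed
    finally have main: "of_nat m * fps_nth (e m) n = - (\<Sum>l\<le>m'. if a dvd l \<and> a dvd m then - ?h (l div a) else 0)" .
    show ?thesis
    proof (cases "a dvd m")
      case False
      then have "of_nat m * fps_nth (e m) n = 0" using main by simp
      then show ?thesis using False Suc by (simp del: of_nat_Suc)
    next
      case True
      then obtain k where k: "m = a * k" by (auto simp: dvd_def)
      have k1: "k = Suc (k - 1)" using k Suc by (cases k) auto
      have mda: "m div a = k" using k a by simp
      have "(\<Sum>l\<le>m'. if a dvd l \<and> a dvd m then - ?h (l div a) else 0) = (\<Sum>l\<in>(\<lambda>l. a * l) ` {..<k}. - ?h (l div a))"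
      proof (rule sum.mono_neutral_cong_right)
        show "(\<lambda>l. a * l) ` {..<k} \<subseteq> {..m'}"
        proof
          fix l assume "l \<in> (\<lambda>l. a * l) ` {..<k}"
          then obtain l' where "l = a * l'" "l' < k" by blast
          then have "l < m" using k a by simp
          then show "l \<in> {..m'}" using Suc by simp
        qed
        show "\<forall>l\<in>{..m'} - (\<lambda>l. a * l) ` {..<k}. (if a dvd l \<and> a dvd m then - ?h (l div a) else 0) = 0"
        proof
          fix l assume l: "l \<in> {..m'} - (\<lambda>l. a * l) ` {..<k}"
          have "\<not> a dvd l"
          proof
            assume "a dvd l"
            then obtain l' where l': "l = a * l'" by (auto simp: dvd_def)
            have "l < m" using l Suc by simp
            then have "l' < k" using k l' a by simp
            then show False using l l' by blast
          qed
          then show "(if a dvd l \<and> a dvd m then - ?h (l div a) else 0) = 0" by simp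
        qed
      qed (use True in auto)
      also have "\<dots> = (\<Sum>l<k. - ?h l)"
        using a by (subst sum.reindex) (auto simp: inj_on_def)
      finally have "of_nat m * fps_nth (e m) n = (\<Sum>l<k. ?h l)" unfolding main by (simp add: sum_negf)
      also have "\<dots> = of_nat a * fps_nth (\<Sum>l\<le>k - 1. c l * \<tau> (k - l)) n"
      proof -
        have "{..<k} = {..k - 1}" using k1 lessThan_Suc_atMost[of "k - 1"] by simp
        then show ?thesis unfolding mda by (simp add: fps_sum_nth sum_distrib_left)
      qed
      also have "(\<Sum>l\<le>k - 1. c l * \<tau> (k - l)) = of_nat k * c k"
        using recC[of "k - 1"] unfolding k1[symmetric] by (rule sym)
      also have "of_nat a * fps_nth (of_nat k * c k) n = of_nat a * (of_nat k * fps_nth (c k) n)"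
        by (simp only: nth_of_nat)
      also have "\<dots> = of_nat m * fps_nth (c k) n" by (simp add: k)
      finally have "fps_nth (e m) n = fps_nth (c k) n" using Suc by (simp del: of_nat_Suc)
      then show ?thesis using True mda by simp
    qed
  qed
qed

text \<open>The differential equation \<open>F' = F A'\<close> of the exponential, coefficient by
  coefficient.\<close>

lemma fps_exp_compose_recursion:
  fixes A :: "'k::field_char_0 fps fps"
  assumes A0: "fps_nth A 0 = 0"
  defines "F \<equiv> Abs_fps (\<lambda>i. fps_const (1 / fact i)) oo A"
  shows "fps_nth F 0 = 1"
    and "of_nat (Suc k) * fps_nth F (Suc k) = (\<Sum>l\<le>k. fps_nth F l * (of_nat (Suc k - l) * fps_nth A (Suc k - l)))"
proof -
  let ?E = "Abs_fps (\<lambda>i. fps_const (1 / fact i)) :: 'k fps fps"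
  show "fps_nth F 0 = 1" by (simp add: F_def)
  have "fps_deriv ?E = ?E"
  proof (rule fps_ext)
    fix n
    have "fps_nth (fps_deriv ?E) n = fps_const (of_nat (Suc n) * (1 / fact (Suc n)))"
      by (simp add: fps_of_nat[symmetric] del: of_nat_Suc fact_Suc)
    also have "of_nat (Suc n) * (1 / fact (Suc n)) = (1 / fact n :: 'k)"
      by (simp add: field_simps del: of_nat_Suc)
    finally show "fps_nth (fps_deriv ?E) n = fps_nth ?E n" by simp
  qed
  then have "fps_deriv F = F * fps_deriv A" unfolding F_def by (simp add: fps_compose_deriv[OF A0])
  from arg_cong[OF this, of "\<lambda>G. fps_nth G k"]
  show "of_nat (Suc k) * fps_nth F (Suc k) = (\<Sum>l\<le>k. fps_nth F l * (of_nat (Suc k - l) * fps_nth A (Suc k - l)))"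
    by (simp add: fps_mult_nth atLeast0AtMost Suc_diff_le del: of_nat_Suc)
qed

locale toric_padic = toric_exp_sum S P f "CARD('p)" a
  for S P :: "(real ^ 'n::finite) set" and f :: "int ^ 'n \<Rightarrow>\<^sub>0 'p::prime_card padic_closure" and a +
  assumes roots: "\<And>u. Poly_Mapping.lookup f u \<noteq> 0 \<Longrightarrow> Poly_Mapping.lookup f u ^ (CARD('p) ^ a - 1) = 1"
begin

text \<open>For each starting level \<open>j\<close> the sum over the tuples of roots of unity is
  the same exponential sum, since raising to the power \<open>p ^ j\<close> permutes the tuples. The
  \<open>a\<close> levels together give the factor \<open>a\<close>.\<close>

lemma exp_sum_trace:
  assumes k: "k \<ge> 1" and n: "n \<le> N"
  shows "of_nat a * to_ac (fps_nth (exp_sum (CARD('p) ^ a) f k) n) =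
    of_nat (CARD('p) ^ (a * k) - 1) ^ CARD('n) * fps_nth (\<Sum>s\<in>mat_index N. mpow (mat_index N) transfer_mat (a * k) s s) n"
proof -
  define m where "m = a * k"
  define N' where "N' = CARD('p) ^ m - 1"
  define mu where "mu = (roots_of_unity N' :: 'p padic_closure set)"
  have m1: "m \<ge> 1" using k a1 by (simp add: m_def)
  interpret U: unramified_roots m N' mu
    by unfold_locales (use m1 in \<open>auto simp: N'_def mu_def roots_of_unity_def\<close>)
  have pm: "CARD('p) ^ m = Suc N'" by (rule U.N(2))
  have qk: "(CARD('p) ^ a) ^ k = CARD('p) ^ m" by (simp add: m_def power_mult)
  obtain g :: "'p padic_closure" where g: "g ^ N' = 1" "inj_on (\<lambda>i. g ^ i) {..<N'}" "{x. x ^ N' = 1} = (\<lambda>i. g ^ i) ` {..<N'}"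
    by (rule primitive_root_of_unity[OF U.N(1)])
  have mug: "mu = (\<lambda>i. g ^ i) ` {..<N'}" using g(3) by (simp add: U.mu_def)
  have per: "t ^ (CARD('p) ^ m) = t" if "t \<in> mu" for t
    using that by (simp add: pm U.mu_def)
  let ?X = "vec_tuples mu :: ('p padic_closure ^ 'n) set"
  have f_mu: "Poly_Mapping.lookup f u \<in> mu" if "u \<in> Poly_Mapping.keys f" for u
  proof -
    have "CARD('p) ^ a - 1 dvd CARD('p) ^ m - 1"
    proof -
      have "int (CARD('p) ^ a) - 1 dvd int (CARD('p) ^ a) ^ k - 1"
        by (metis dvd_triv_left power_diff_1_eq)
      then have "int (CARD('p) ^ a - 1) dvd int (CARD('p) ^ m - 1)"
        using p_pow_pos[of a] p_pow_pos[of m] by (simp add: of_nat_diff m_def power_mult Suc_le_eq)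
      then show ?thesis by (simp only: of_nat_dvd_iff)
    qed
    then obtain d where "N' = (CARD('p) ^ a - 1) * d" unfolding N'_def by (auto simp: dvd_def)
    then show ?thesis using roots[of u] that by (simp add: U.mu_def in_keys_iff power_mult)
  qed
  have mon_mu: "monomial_eval x u \<in> mu" if "x \<in> ?X" for x u
  proof -
    have "(vec_nth x i powi vec_nth u i) ^ N' = 1" for i
    proof -
      have "(vec_nth x i powi vec_nth u i) ^ N' = (vec_nth x i ^ N') powi vec_nth u i"
        by (simp add: power_int_power power_int_power' mult.commute)
      then show ?thesis using that by (simp add: vec_tuples_def U.mu_def)
    qed
    then show ?thesis by (simp add: U.mu_def monomial_eval_def prod_power_distrib)
  qed
  have x0: "vec_nth x i \<noteq> 0" if "x \<in> ?X" for x i using that U.mu_nonzero by (simp add: vec_tuples_def)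
  define tr where "tr x = (\<Sum>u\<in>Poly_Mapping.keys f. \<Sum>l<m. (Poly_Mapping.lookup f u * monomial_eval x u) ^ (CARD('p) ^ l))" for x
  have trace: "to_ac (field_trace (unramified_field (CARD('p) ^ m)) (laurent_eval f x)) = tr x" if x: "x \<in> ?X" for x
  proof -
    have t: "Poly_Mapping.lookup f u * monomial_eval x u \<in> mu" if "u \<in> Poly_Mapping.keys f" for u
      using f_mu[OF that] mon_mu[OF x] by simp
    then show ?thesis
      unfolding U.unramified_field_eq laurent_eval_eq
      by (subst U.field_trace_sum) (auto simp: U.mu_K0 to_ac_sum U.trace_mu tr_def)
  qed
  have sum_j: "of_nat N' ^ CARD('n) * (\<Sum>u\<in>low_exps N. Poly_Mapping.lookup (fps_nth (frob_prod j m) n) (expo_scale N' u)) =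
      to_ac (fps_nth (exp_sum (CARD('p) ^ a) f k) n)" for j
  proof -
    have "of_nat N' ^ CARD('n) * (\<Sum>u\<in>low_exps N. Poly_Mapping.lookup (fps_nth (frob_prod j m) n) (expo_scale N' u)) =
        (\<Sum>x\<in>?X. laurent_eval (fps_nth (frob_prod j m) n) x)"
      by (rule sum_laurent_eval_roots[OF U.N(1) g(1,2) mug finite_low_exps, symmetric])
        (use lookup_frob_prod_in_low_exps[OF m1 n] in \<open>simp add: N'_def\<close>)
    also have "\<dots> = (\<Sum>x\<in>?X. fps_nth (fps_eval x (frob_prod j m)) n)" by simp
    also have "\<dots> = (\<Sum>x\<in>?X. (\<Sum>l<m. \<Sum>u\<in>Poly_Mapping.keys f.
        Poly_Mapping.lookup f u ^ (CARD('p) ^ (j + l)) * monomial_eval x u ^ (CARD('p) ^ l)) gchoose n)"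
      by (intro sum.cong refl) (simp only: fps_eval_frob_prod[OF x0] fps_binomial_nth)
    \<comment> \<open>With \<open>x ^ (p ^ j)\<close> in place of \<open>x\<close>, the monomials
      are raised to the same power \<open>p ^ (j + l)\<close> as the coefficients, and whole orbits
      under the \<open>p\<close>-th power appear.\<close>
    also have "\<dots> = (\<Sum>x\<in>?X. (\<Sum>l<m. \<Sum>u\<in>Poly_Mapping.keys f.
        Poly_Mapping.lookup f u ^ (CARD('p) ^ (j + l)) *
        monomial_eval (\<chi> i. vec_nth x i ^ (CARD('p) ^ j)) u ^ (CARD('p) ^ l)) gchoose n)"
      by (rule sum.reindex_bij_betw[symmetric], rule bij_vec_tuples_power[where m = m])
        (use per m1 in auto)
    also have "\<dots> = (\<Sum>x\<in>?X. tr x gchoose n)"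
    proof (rule sum.cong[OF refl])
      fix x assume x: "x \<in> ?X"
      have "(\<Sum>l<m. \<Sum>u\<in>Poly_Mapping.keys f. Poly_Mapping.lookup f u ^ (CARD('p) ^ (j + l)) *
          monomial_eval (\<chi> i. vec_nth x i ^ (CARD('p) ^ j)) u ^ (CARD('p) ^ l)) =
        (\<Sum>u\<in>Poly_Mapping.keys f. \<Sum>l<m. (Poly_Mapping.lookup f u * monomial_eval x u) ^ (CARD('p) ^ (j + l)))"
        by (subst sum.swap) (simp add: monomial_eval_power power_mult_distrib power_mult[symmetric] power_add)
      also have "\<dots> = tr x"
        unfolding tr_def using f_mu mon_mu[OF x] by (intro sum.cong refl frobenius_orbit_sum per) auto
      finally show "(\<Sum>l<m. \<Sum>u\<in>Poly_Mapping.keys f. Poly_Mapping.lookup f u ^ (CARD('p) ^ (j + l)) *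
          monomial_eval (\<chi> i. vec_nth x i ^ (CARD('p) ^ j)) u ^ (CARD('p) ^ l)) gchoose n = tr x gchoose n"
        by (rule arg_cong)
    qed
    also have "\<dots> = (\<Sum>x\<in>?X. to_ac (field_trace (unramified_field (CARD('p) ^ m)) (laurent_eval f x) gchoose n))"
      by (intro sum.cong refl) (simp only: to_ac_gbinomial trace)
    also have "\<dots> = to_ac (fps_nth (exp_sum (CARD('p) ^ a) f k) n)"
      unfolding exp_sum_def qk N'_def[symmetric] mu_def[symmetric] vec_tuples_def
      by (simp add: fps_sum_nth to_ac_sum)
    finally show ?thesis .
  qed
  have "of_nat N' ^ CARD('n) * fps_nth (\<Sum>s\<in>mat_index N. mpow (mat_index N) transfer_mat m s s) n =
      (\<Sum>j<a. of_nat N' ^ CARD('n) * (\<Sum>u\<in>low_exps N. Poly_Mapping.lookup (fps_nth (frob_prod j m) n) (expo_scale N' u)))"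
    unfolding trace_mpow_transfer_mat[OF n] by (simp add: m_def N'_def sum_distrib_left)
  also have "\<dots> = of_nat a * to_ac (fps_nth (exp_sum (CARD('p) ^ a) f k) n)"
    unfolding sum_j by simp
  finally show ?thesis unfolding m_def N'_def by simp
qed

text \<open>The truncation is placed at the exponent \<open>n\<close> of the given nonzero
  coefficient of \<open>T ^ n\<close>, so the finite determinant agrees with \<open>C_fun\<close>
  exactly as far as is needed.\<close>

lemma C_fun_coeff_bounds:
  assumes nz: "fps_nth (fps_nth (C_fun (CARD('p) ^ a) f) k) n \<noteq> 0"
  shows "(\<forall>j. hp_line CARD('p) a j (real k) \<le> real n) \<and>
    (\<forall>b. (\<forall>j. (\<Sum>i<j. real (W_count P i)) \<le> b) \<longrightarrow> real k \<le> b)"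
proof -
  let ?q = "CARD('p) ^ a"
  define A where "A = Abs_fps (\<lambda>k. if k = 0 then 0
    else fps_const (- (1 / ((of_nat (?q ^ k) - 1) ^ CARD('n) * of_nat k))) * exp_sum ?q f k :: 'p padic fps)"
  have C: "C_fun ?q f = Abs_fps (\<lambda>i. fps_const (1 / fact i)) oo A"
    unfolding C_fun_def A_def ..
  have A0: "fps_nth A 0 = 0" by (simp add: A_def)
  define c where "c k = fps_to_ac (fps_nth (C_fun ?q f) k)" for k
  define \<tau> where "\<tau> i = fps_to_ac (of_nat i * fps_nth A i)" for i
  obtain h0 where h0: "bij_betw h0 {0..<card (mat_index n)} (mat_index n)" using ex_bij_betw_nat_finite[OF finite_mat_index] by blast
  define M where "M = card (mat_index n)"
  have h: "bij_betw h0 {..<M} (mat_index n)" using h0 by (simp add: M_def lessThan_atLeast0)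
  define e where "e = Polynomial.coeff (rev_char_poly M (\<lambda>i j. transfer_mat (h0 i) (h0 j)))"
  define Tr where "Tr i = (\<Sum>s\<in>mat_index n. mpow (mat_index n) transfer_mat i s s)" for i
  have "fps_nth (e (a * k)) n = (if a dvd a * k then fps_nth (c (a * k div a)) n else 0)"
  proof (rule newton_recursion_truncated[OF a1, where N = n and Tr = Tr and \<tau> = \<tau>])
    show "e 0 = 1" by (simp add: e_def rev_char_poly_0)
    show "c 0 = 1" unfolding c_def C fps_exp_compose_recursion(1)[OF A0] by (rule fps_to_ac_one)
    fix m
    have "(\<Sum>i<M. mpow {..<M} (\<lambda>i j. transfer_mat (h0 i) (h0 j)) l i i) = Tr l" for l
    proof -
      have "(\<Sum>i<M. mpow {..<M} (\<lambda>i j. transfer_mat (h0 i) (h0 j)) l i i) = (\<Sum>i<M. mpow (mat_index n) transfer_mat l (h0 i) (h0 i))"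
        by (intro sum.cong refl mpow_reindex[OF h]) auto
      also have "\<dots> = Tr l" unfolding Tr_def by (rule sum.reindex_bij_betw[OF h])
      finally show ?thesis .
    qed
    then show "of_nat (Suc m) * e (Suc m) = - (\<Sum>l\<le>m. e l * Tr (Suc m - l))"
      unfolding e_def rev_char_poly_recursion by simp
    have "fps_to_ac (of_nat (Suc m) * fps_nth (C_fun ?q f) (Suc m)) =
      fps_to_ac (\<Sum>l\<le>m. fps_nth (C_fun ?q f) l * (of_nat (Suc m - l) * fps_nth A (Suc m - l)))"
      unfolding C fps_exp_compose_recursion(2)[OF A0] ..
    then show "of_nat (Suc m) * c (Suc m) = (\<Sum>l\<le>m. c l * \<tau> (Suc m - l))"
      unfolding c_def \<tau>_def by (simp only: fps_to_ac_mult fps_to_ac_sum fps_to_ac_of_nat)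
  next
    fix i n' :: nat assume i: "i \<ge> 1" and n': "n' \<le> n"
    show "fps_nth (Tr i) n' = (if a dvd i then - (of_nat a * fps_nth (\<tau> (i div a)) n') else 0)"
    proof (cases "a dvd i")
      case False
      then show ?thesis unfolding Tr_def trace_mpow_transfer_mat[OF n'] by simp
    next
      case True
      then obtain l where l: "i = a * l" by (auto simp: dvd_def)
      have l1: "l \<ge> 1" using l i by (cases l) auto
      have la: "i div a = l" using l a1 by simp
      have ql: "?q ^ l = CARD('p) ^ i" by (simp add: l power_mult)
      define N' where "N' = CARD('p) ^ i - 1"
      have "CARD('p) ^ 1 \<le> CARD('p) ^ i" using i p2 by (intro power_increasing) auto
      then have N': "N' > 0" "CARD('p) ^ i = Suc N'" using p2 by (auto simp: N'_def)
      let ?d = "of_nat N' ^ CARD('n) :: 'p padic"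
      have "fps_nth A l = fps_const (- (1 / ((of_nat (?q ^ l) - 1) ^ CARD('n) * of_nat l))) * exp_sum ?q f l"
        using l1 by (simp only: A_def fps_nth_Abs_fps) simp
      also have "of_nat (?q ^ l) - 1 = (of_nat N' :: 'p padic)" unfolding ql N'(2) by simp
      finally have "of_nat l * fps_nth A l = fps_const (of_nat l * - (1 / (?d * of_nat l))) * exp_sum ?q f l"
        unfolding fps_of_nat[symmetric] by (simp only: mult.assoc[symmetric] fps_const_mult)
      also have "of_nat l * - (1 / (?d * of_nat l)) = - (1 / ?d)" using l1 by simp
      finally have "fps_nth (\<tau> l) n' = - (1 / of_nat N' ^ CARD('n)) * to_ac (fps_nth (exp_sum ?q f l) n')"
        unfolding \<tau>_def by simp
      then have "- (of_nat a * fps_nth (\<tau> l) n') = (of_nat a * to_ac (fps_nth (exp_sum ?q f l) n')) / of_nat N' ^ CARD('n)"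
        by simp
      also have "\<dots> = fps_nth (Tr i) n'"
        unfolding exp_sum_trace[OF l1 n'] Tr_def l[symmetric] N'_def[symmetric] using N'(1) by simp
      finally show ?thesis using True la by simp
    qed
  qed simp
  then have "fps_nth (e (a * k)) n \<noteq> 0" using a1 nz by (simp add: c_def)
  then show ?thesis
    unfolding e_def using h by (intro rev_char_poly_coeff_bounds[of h0 M n]) (auto simp: bij_betw_def)
qed

end

theorem theorem1p5:
  fixes f :: "(int ^ 'n::finite) \<Rightarrow>\<^sub>0 'p::prime_card padic_closure"
    and p a q :: nat
  assumes "p = CARD('p)" and "a \<ge> 1" and "q = p ^ a"
    and "\<And>u. Poly_Mapping.lookup f u \<in> ring_of_integers (unramified_field q)"
    and "\<And>u. Poly_Mapping.lookup f u \<noteq> 0 \<Longrightarrow> Poly_Mapping.lookup f u \<in> roots_of_unity (q - 1)"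
  shows "\<forall>x. NP_T q f x \<ge> HP_q p a (newton_polytope f) x"
proof -
  let ?P = "newton_polytope f"
  let ?S = "real_vec ` Poly_Mapping.keys f"
  have q: "q = CARD('p) ^ a" using assms by simp
  have PS: "?P = convex hull (insert 0 ?S)"
    unfolding newton_polytope_def real_vec_def[abs_def] ..
  have p2: "CARD('p) \<ge> 2" by (rule prime_ge_2_nat[OF prime_CARD])
  have roots: "Poly_Mapping.lookup f u ^ (CARD('p) ^ a - 1) = 1" if "Poly_Mapping.lookup f u \<noteq> 0" for u
    using assms(5)[OF that] by (simp add: q roots_of_unity_def)
  have frob: "Poly_Mapping.lookup f u ^ (CARD('p) ^ a) = Poly_Mapping.lookup f u" for u
  proof (cases "Poly_Mapping.lookup f u = 0")
    case False
    have "CARD('p) ^ a = Suc (CARD('p) ^ a - 1)" using p2 by simp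
    then show ?thesis using roots[OF False] by (metis mult.right_neutral power_Suc)
  qed (use p2 in simp)
  interpret toric_padic ?S ?P f a
  proof
    show "real_vec u \<in> ?P" if "u \<in> Poly_Mapping.keys f" for u
      unfolding PS using that by (intro hull_inc) simp
  qed (use PS assms(2) p2 frob roots in \<open>auto simp: real_vec_def\<close>)
  show ?thesis
    unfolding NP_T_def q assms(1)
  proof (intro allI HP_le_hull)
    fix x y assume "(x, y) \<in> {(real k, real (subdegree (fps_nth (C_fun (CARD('p) ^ a) f) k))) | k.
      fps_nth (C_fun (CARD('p) ^ a) f) k \<noteq> 0}"
    then obtain k where k: "x = real k" "y = real (subdegree (fps_nth (C_fun (CARD('p) ^ a) f) k))"
      "fps_nth (C_fun (CARD('p) ^ a) f) k \<noteq> 0" by blast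
    show "0 \<le> x \<and> (\<forall>j. hp_line CARD('p) a j x \<le> y) \<and>
      (\<forall>xm. (\<forall>j. (\<Sum>i<j. real (W_count ?P i)) \<le> xm) \<longrightarrow> x \<le> xm)"
      unfolding k(1,2) using C_fun_coeff_bounds[OF nth_subdegree_nonzero[OF k(3)]] by simp
  qed
qed

end
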